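(* Let $n\ge 1$ and let $\sigma,\tau,\pi\in\mathcal{D}_n$ satisfy $d(\sigma)+d(\tau)=d(\pi)$. Then $P\mapsto\Phi(P)$ is a bijection between the set $\mathbf{KT}_{\sigma,\tau}^{\pi}$ of Knutson--Tao puzzles with boundary $\sigma,\tau,\pi$ and the set $\mathbf{TFPL}_{\sigma,\tau}^{\pi}$ of fully packed loop configurations in a triangle with boundary conditions $\sigma,\tau,\pi$.
   Context: **Words.** $\mathcal{D}_n$ is the set of words $\sigma\in\{0,1\}^{2n}$ with $n$ letters $0$ and $n$ letters $1$ such that every prefix contains at least as many $0$s as $1$s. A word $\pi\in\mathcal{D}_n$ is identified with a link pattern, i.e. a partition of $\{1,\dots,2n\}$ into $n$ pairwise noncrossing pairs, whose pairs $\{i<j\}$ satisfy $\pi_i=0$, $\pi_j=1$. The degree $d(\sigma)$ is the number of pairs $i<j$ with $(\sigma_i,\sigma_j)=(1,0)$. **Triangle.** $\mathcal{T}^n$ is the set of points $(x,y)\in\mathbb{Z}^2$ with $x\ge y\ge 0$ and $x+y\le 4n-2$. Left vertices are $(i-1,i-1)$, right vertices are $(2n-2+i,2n-i)$, $1\le i\le 2n$; all other vertices are inner vertices. The following edges are imposed: the $2n$ vertical (external) edges $e_i$ below $(2i-2,0)$, $i=1,\dots,2n$; and the horizontal edges between $(i,i)$ and $(i+1,i)$ and between $(4n-3-i,i)$ and $(4n-2-i,i)$, for $i=0,\dots,2n-2$. Given $\sigma,\tau\in\mathcal{D}_n$, $\mathcal{T}^n(\sigma,\tau)$ is the triangle with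 the further conditions: the vertical edge below $(i-1,i-1)$ is present if $\sigma_i=0$ and forbidden if $\sigma_i=1$; the vertical edge below $(2n-2+i,2n-i)$ is present if $\tau_i=1$ and forbidden if $\tau_i=0$. (These conditions determine all edges incident to left and right vertices.) **TFPL.** A TFPL with boundary conditions $\sigma,\tau,\pi\in\mathcal{D}_n$ is a graph on $\mathcal{T}^n(\sigma,\tau)$ (a set of edges between nearest neighbours of $\mathcal{T}^n$ together with the external edges $e_i$, containing all imposed edges and no forbidden edge) such that all inner vertices have degree $2$ and (I) for each pair $\{i,j\}$ of $\pi$, $e_i$ and $e_j$ are linked by a path of the graph; (II) every path starting from a left (resp. right) vertex, i.e. having such a vertex of degree $1$ as an extremity, ends at a right (resp. left) vertex. Their set is $\mathbf{TFPL}_{\sigma,\tau}^{\pi}$. **Knutson--Tao puzzles.** Consider an upward-pointing triangle of side $2n$ in the regular triangular lattice (with horizontal edges), divided into $(2n)^2$ unit triangles. For $0\le j\le 2n-1$, the $j$-th row from the bottom (starting at $j=0$) contains, from left to right, the unit triangles $U(j,0),D(j,0),U(j,1),D(j,1),\dots,D(j,2n-2-j),U(j,2n-1-j)$, where the $U$'s point up and the $D$'s point down. So the right edge of $U(j,k)$ is the left edge of $D(j,k)$, the right edge of $D(j,k)$ is the left edge of $U(j,k+1)$, and the top edge of $D(j,k)$ is the bottom edge of $U(j+1,k)$. A KT puzzle with boundary $\sigma,\tau,\pi$ is a labeling of all unit edges by $0,1,2$ such that: the left edge of $U(j,0)$ has label $\sigma_{j+1}$, the right edge of $U(j,2n-1-j)$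 has label $\tau_{2n-j}$, the bottom edge of $U(0,k)$ has label $\pi_{k+1}$ (i.e. left, right and bottom sides are labeled by $\sigma,\tau,\pi$ read from left to right); and each unit triangle has its edges labeled by three $0$s, or three $1$s, or $0,1,2$ in counterclockwise order. Their set is $\mathbf{KT}_{\sigma,\tau}^{\pi}$. **The map $\Phi$.** The right edge of $U(j,k)$ corresponds to the vertex $(j+2k,j)$ of $\mathcal{T}^n$, and the right edge of $D(j,k)$ to the vertex $(j+2k+1,j)$. For a puzzle $P$, $\Phi(P)$ is the graph on $\mathcal{T}^n$ with the following edges: - the vertical edge below $(j+2k,j)$ (which is $e_{k+1}$ if $j=0$) is present if and only if the bottom edge of $U(j,k)$ has label $0$ or $1$; - the horizontal edge between $(j+2k,j)$ and $(j+2k+1,j)$ is present if and only if the left edge of $D(j,k)$ has label $0$ or $2$; - for $k\ge1$, the horizontal edge between $(j+2k-1,j)$ and $(j+2k,j)$ is present if and only if the left edge of $U(j,k)$ has label $1$ or $2$. *)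

theory Defs
  imports Main "HOL-Library.FuncSet" "HOL-Library.Disjoint_Sets"
begin

section \<open>Words and link patterns\<close>

text \<open>Words are lists over \<open>{0, 1}\<close>; letters are counted from 1 in the mathematics, so the
  \<open>i\<close>-th letter of \<open>w\<close> is \<open>w ! (i - 1)\<close>.\<close>

definition dyck_words :: "nat \<Rightarrow> nat list set" where
  "dyck_words n = {w. length w = 2 * n \<and> set w \<subseteq> {0, 1} \<and>
     count_list w 0 = n \<and> count_list w 1 = n \<and>
     (\<forall>k \<le> 2 * n. count_list (take k w) 1 \<le> count_list (take k w) 0)}"

definition word_degree :: "nat list \<Rightarrow> nat" where
  "word_degree w = card {(i, j). i < j \<and> j < length w \<and> w ! i = 1 \<and> w ! j = 0}"

definition is_link_pattern_of :: "nat \<Rightarrow> nat list \<Rightarrow> nat set set \<Rightarrow> bool" where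
  "is_link_pattern_of n w M \<longleftrightarrow>
     partition_on {1..2 * n} M \<and> (\<forall>b \<in> M. card b = 2) \<and>
     (\<forall>i k j l. i < k \<and> k < j \<and> j < l \<longrightarrow> \<not> ({i, j} \<in> M \<and> {k, l} \<in> M)) \<and>
     (\<forall>i j. i < j \<and> {i, j} \<in> M \<longrightarrow> w ! (i - 1) = 0 \<and> w ! (j - 1) = 1)"

text \<open>Every \<open>w \<in> dyck_words n\<close> has exactly one such partition (parenthesis matching).\<close>

definition link_pattern :: "nat \<Rightarrow> nat list \<Rightarrow> nat set set" where
  "link_pattern n w = (THE M. is_link_pattern_of n w M)"


section \<open>Graphs on the triangle\<close>

text \<open>A graph is given by its set of edges, an edge being the set of its two endpoints. The lower
  endpoint of an external edge is a point \<open>(x, -1)\<close>, which is not a vertex of the triangle.\<close>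

type_synonym point = "int \<times> int"

definition vedge_below :: "point \<Rightarrow> point set" where
  "vedge_below v = {(fst v, snd v - 1), v}"

definition hedge_right :: "point \<Rightarrow> point set" where
  "hedge_right v = {v, (fst v + 1, snd v)}"

definition triangle :: "nat \<Rightarrow> point set" where
  "triangle n = {(x, y). y \<le> x \<and> 0 \<le> y \<and> x + y \<le> 4 * int n - 2}"

definition left_vertex :: "nat \<Rightarrow> point" where
  "left_vertex i = (int i - 1, int i - 1)"

definition right_vertex :: "nat \<Rightarrow> nat \<Rightarrow> point" where
  "right_vertex n i = (2 * int n - 2 + int i, 2 * int n - int i)"

definition left_vertices :: "nat \<Rightarrow> point set" where
  "left_vertices n = left_vertex ` {1..2 * n}"

definition right_vertices :: "nat \<Rightarrow> point set" where
  "right_vertices n = right_vertex n ` {1..2 * n}"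

definition inner_vertices :: "nat \<Rightarrow> point set" where
  "inner_vertices n = triangle n - left_vertices n - right_vertices n"

definition external_end :: "nat \<Rightarrow> point" where
  "external_end i = (2 * int i - 2, -1)"

definition external_edge :: "nat \<Rightarrow> point set" where
  "external_edge i = vedge_below (2 * int i - 2, 0)"

definition triangle_edges :: "nat \<Rightarrow> point set set" where
  "triangle_edges n =
     {{(x, y), (x', y')} | x y x' y'. (x, y) \<in> triangle n \<and> (x', y') \<in> triangle n \<and>
        \<bar>x - x'\<bar> + \<bar>y - y'\<bar> = 1}
     \<union> external_edge ` {1..2 * n}"

text \<open>The apex \<open>(2n - 1, 2n - 1)\<close> is both a left and a right vertex; since a Dyck word starts with 0
  and ends with 1, the two conditions on the edge below it agree. The same holds at the two bottom
  corners, where the edge in question is an external one.\<close>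

definition imposed_edges :: "nat \<Rightarrow> nat list \<Rightarrow> nat list \<Rightarrow> point set set" where
  "imposed_edges n \<sigma> \<tau> =
     external_edge ` {1..2 * n}
     \<union> {hedge_right (int i, int i) | i. i \<le> 2 * n - 2}
     \<union> {hedge_right (4 * int n - 3 - int i, int i) | i. i \<le> 2 * n - 2}
     \<union> {vedge_below (left_vertex i) | i. i \<in> {1..2 * n} \<and> \<sigma> ! (i - 1) = 0}
     \<union> {vedge_below (right_vertex n i) | i. i \<in> {1..2 * n} \<and> \<tau> ! (i - 1) = 1}"

definition forbidden_edges :: "nat \<Rightarrow> nat list \<Rightarrow> nat list \<Rightarrow> point set set" where
  "forbidden_edges n \<sigma> \<tau> =
     {vedge_below (left_vertex i) | i. i \<in> {1..2 * n} \<and> \<sigma> ! (i - 1) = 1}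
     \<union> {vedge_below (right_vertex n i) | i. i \<in> {1..2 * n} \<and> \<tau> ! (i - 1) = 0}"

definition vertex_degree :: "point set set \<Rightarrow> point \<Rightarrow> nat" where
  "vertex_degree G v = card {e \<in> G. v \<in> e}"

definition graph_path :: "point set set \<Rightarrow> point list \<Rightarrow> bool" where
  "graph_path G p \<longleftrightarrow> p \<noteq> [] \<and> distinct p \<and> successively (\<lambda>u v. {u, v} \<in> G) p"

text \<open>In the graphs considered below all degrees are at most 2, so the connected components are
  cycles, paths and isolated points. The following predicate describes the components that are
  paths with at least one edge.\<close>

definition full_path :: "point set set \<Rightarrow> point list \<Rightarrow> bool" where
  "full_path G p \<longleftrightarrow> graph_path G p \<and> 2 \<le> length p \<and>
     vertex_degree G (hd p) = 1 \<and> vertex_degree G (last p) = 1"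

text \<open>Every \<open>external_end i\<close> with \<open>1 \<le> i \<le> 2n\<close> is incident to \<open>external_edge i\<close> only, so paths
  between two such points are the paths linking the two external edges.\<close>

definition TFPL :: "nat \<Rightarrow> nat list \<Rightarrow> nat list \<Rightarrow> nat list \<Rightarrow> point set set set" where
  "TFPL n \<sigma> \<tau> \<pi> = {G.
     G \<subseteq> triangle_edges n \<and>
     imposed_edges n \<sigma> \<tau> \<subseteq> G \<and>
     G \<inter> forbidden_edges n \<sigma> \<tau> = {} \<and>
     (\<forall>v \<in> inner_vertices n. vertex_degree G v = 2) \<and>
     (\<forall>i j. {i, j} \<in> link_pattern n \<pi> \<longrightarrow>
        (\<exists>p. graph_path G p \<and> hd p = external_end i \<and> last p = external_end j)) \<and>
     (\<forall>p. full_path G p \<and> hd p \<in> left_vertices n \<longrightarrow> last p \<in> right_vertices n) \<and>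
     (\<forall>p. full_path G p \<and> hd p \<in> right_vertices n \<longrightarrow> last p \<in> left_vertices n)}"


section \<open>Knutson--Tao puzzles\<close>

text \<open>Every unit edge of the subdivided triangle is an edge of exactly one upward unit triangle
  \<open>U(j, k)\<close>, which is used to name it.\<close>

datatype unit_edge = LeftU nat nat | RightU nat nat | BottomU nat nat

definition up_triangles :: "nat \<Rightarrow> (nat \<times> nat) set" where
  "up_triangles n = {(j, k). j + k < 2 * n}"

definition down_triangles :: "nat \<Rightarrow> (nat \<times> nat) set" where
  "down_triangles n = {(j, k). j + k + 1 < 2 * n}"

abbreviation LeftD :: "nat \<Rightarrow> nat \<Rightarrow> unit_edge" where "LeftD j k \<equiv> RightU j k"
abbreviation RightD :: "nat \<Rightarrow> nat \<Rightarrow> unit_edge" where "RightD j k \<equiv> LeftU j (k + 1)"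
abbreviation TopD :: "nat \<Rightarrow> nat \<Rightarrow> unit_edge" where "TopD j k \<equiv> BottomU (j + 1) k"

definition unit_edges :: "nat \<Rightarrow> unit_edge set" where
  "unit_edges n = (\<Union>(j, k) \<in> up_triangles n. {LeftU j k, RightU j k, BottomU j k})"

text \<open>The arguments are the labels of the three edges in counterclockwise order.\<close>

definition puzzle_piece :: "nat \<Rightarrow> nat \<Rightarrow> nat \<Rightarrow> bool" where
  "puzzle_piece a b c \<longleftrightarrow>
     (a, b, c) \<in> {(0, 0, 0), (1, 1, 1), (0, 1, 2), (1, 2, 0), (2, 0, 1)}"

definition KT :: "nat \<Rightarrow> nat list \<Rightarrow> nat list \<Rightarrow> nat list \<Rightarrow> (unit_edge \<Rightarrow> nat) set" where
  "KT n \<sigma> \<tau> \<pi> = {P \<in> unit_edges n \<rightarrow>\<^sub>E {0, 1, 2}.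
     (\<forall>j < 2 * n. P (LeftU j 0) = \<sigma> ! j) \<and>
     (\<forall>j < 2 * n. P (RightU j (2 * n - 1 - j)) = \<tau> ! (2 * n - 1 - j)) \<and>
     (\<forall>k < 2 * n. P (BottomU 0 k) = \<pi> ! k) \<and>
     (\<forall>(j, k) \<in> up_triangles n. puzzle_piece (P (LeftU j k)) (P (BottomU j k)) (P (RightU j k))) \<and>
     (\<forall>(j, k) \<in> down_triangles n. puzzle_piece (P (TopD j k)) (P (LeftD j k)) (P (RightD j k)))}"


section \<open>From puzzles to graphs\<close>

definition Phi :: "nat \<Rightarrow> (unit_edge \<Rightarrow> nat) \<Rightarrow> point set set" where
  "Phi n P =
     {vedge_below (int j + 2 * int k, int j) | j k.
        (j, k) \<in> up_triangles n \<and> P (BottomU j k) \<in> {0, 1}}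
     \<union> {hedge_right (int j + 2 * int k, int j) | j k.
        (j, k) \<in> down_triangles n \<and> P (LeftD j k) \<in> {0, 2}}
     \<union> {hedge_right (int j + 2 * int k - 1, int j) | j k.
        (j, k) \<in> up_triangles n \<and> 1 \<le> k \<and> P (LeftU j k) \<in> {1, 2}}"

end

theory Submission
  imports Defs
begin

text \<open>A puzzle is an oriented version of its graph. Read the label of the bottom edge of an upward
  triangle as a vertical edge traversed upwards (label \<open>0\<close>) or downwards (label \<open>1\<close>), the label of a
  right edge (\<open>0\<close>) or of a left edge (\<open>1\<close>) as a horizontal edge traversed to the right, and the label
  \<open>2\<close> of a left or right edge as a horizontal edge traversed to the left. Under this dictionary the
  puzzle pieces at a vertex are exactly the ways in which an oriented path can pass through it,
  subject to two restrictions: a vertex \<open>(x, y)\<close> with \<open>x - y\<close> even has no edge above it and one with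
  \<open>x - y\<close> odd has none below it, and no path makes two consecutive steps to the left
  (\<open>up_piece\<close>, \<open>down_piece\<close>, \<open>KT_iff_flow\<close>). An orientation without the restrictions is called a flow.

  The heart of the proof is \<open>excess_identity\<close>: for every flow, \<open>2 d(\<pi>)\<close> equals \<open>2 d(\<sigma>) + 2 d(\<tau>)\<close> plus
  a sum of local contributions, one for each vertex, which are nonnegative and count violations of
  the restrictions. It is proved by comparing consecutive horizontal levels: a quadratic functional
  \<open>area\<close> of a level, which computes the degree of the bottom word, changes across a row by a sum that
  telescopes vertex by vertex (\<open>vertex_step\<close>).

  Surjectivity: a TFPL is oriented from \<open>0\<close> to \<open>1\<close> along the paths between external edges, from left
  to right along the other paths, and arbitrarily along closed cycles (\<open>TFPL_flow\<close>). If
  \<open>d(\<sigma>) + d(\<tau>) = d(\<pi>)\<close>, its excess vanishes, so it is the flow of a puzzle. Closed cycles do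
  not occur then, since one of the two orientations of a cycle violates the restrictions.

  A puzzle gives a TFPL: one has to see where the paths of its flow end. Since the flow is conserved,
  the faces of the graph carry a stream function, and the pair of values on the two sides of a path is
  constant along it; this gives each path a \<open>level\<close>. Paths that enter at the left or leave at the right
  have negative level, and external edges have nonnegative level. So the former run from left to right,
  and a path through an external edge joins a \<open>0\<close> and a \<open>1\<close> of \<open>\<pi>\<close> at the same height. Moreover the \<open>0\<close> is to the left
  of the \<open>1\<close>: otherwise reversing this path would yield a flow whose bottom word has smaller degree
  than \<open>\<pi>\<close>, hence negative excess (\<open>no_leftward_path\<close>). The only such pairing is the bracket matching,
  i.e. the link pattern of \<open>\<pi>\<close> (\<open>linked\<close>).

  Injectivity: the graph and \<open>\<pi>\<close> determine the labels row by row, starting from the bottom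
  (\<open>Phi_inj\<close>).\<close>

section \<open>Passing a row of vertices\<close>

definition cum :: "(nat \<Rightarrow> int) \<Rightarrow> nat \<Rightarrow> int" where
  "cum f x = (\<Sum>i<x. f i)"

lemma cum_0 [simp]: "cum f 0 = 0" and cum_Suc [simp]: "cum f (Suc x) = cum f x + f x"
  by (simp_all add: cum_def)

text \<open>Let \<open>f\<close> be the flow through the vertical edges at one level and \<open>w\<close> its absolute value with a sign
  that depends on the parity of the position. For a level consisting of letters only, \<open>area\<close> is four
  times the number of inversions, up to a polynomial in the numbers of letters
  (see \<open>word_row_area\<close>). In contrast to the number of inversions it makes sense for every flow.\<close>

definition area :: "(nat \<Rightarrow> int) \<Rightarrow> (nat \<Rightarrow> int) \<Rightarrow> nat \<Rightarrow> int" where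
  "area f w x = (\<Sum>i<x. - 2 * cum f (Suc i) - cum w i * f i + cum f i * w i)"

lemma area_0 [simp]: "area f w 0 = 0"
  and area_Suc [simp]:
    "area f w (Suc x) = area f w x - 2 * cum f (Suc x) - cum w x * f x + cum f x * w x"
  by (simp_all add: area_def)

text \<open>The arguments \<open>s\<close>, \<open>n\<close>, \<open>l\<close>, \<open>r\<close> are the flows through the edges below, above, to the left and to
  the right of a vertex \<open>(x, y)\<close>, counted positively upwards and to the right; \<open>p\<close> tells whether
  \<open>x - y\<close> is even. The vertical edges that cannot occur for a puzzle count \<open>1\<close> at both of their ends,
  and a vertex at which a step to the left meets such an edge or another step to the left counts \<open>2\<close>
  more. These are the weights for which the comparison of levels below is exact.\<close>

definition excess :: "bool \<Rightarrow> int \<Rightarrow> int \<Rightarrow> int \<Rightarrow> int \<Rightarrow> int" where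
  "excess p s n l r = (let b = (if p then \<bar>n\<bar> else \<bar>s\<bar>) in
     b + (if l = -1 \<and> r = -1 \<or> b = 1 \<and> (l = -1 \<or> r = -1) then 2 else 0))"

definition vertex_ok :: "int \<Rightarrow> int \<Rightarrow> int \<Rightarrow> int \<Rightarrow> bool" where
  "vertex_ok s n l r \<longleftrightarrow> s \<in> {-1, 0, 1} \<and> n \<in> {-1, 0, 1} \<and> l \<in> {-1, 0, 1} \<and> r \<in> {-1, 0, 1} \<and>
     \<bar>s\<bar> + \<bar>n\<bar> + \<bar>l\<bar> + \<bar>r\<bar> = 2 \<and> s + l = n + r"

definition signed_abs :: "bool \<Rightarrow> int \<Rightarrow> int" where
  "signed_abs p a = (if p then \<bar>a\<bar> else - \<bar>a\<bar>)"

lemma vertex_ok_iff: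
  "vertex_ok s n l r \<longleftrightarrow> (s, n, l, r) \<in>
    {(1, 1, 0, 0), (-1, -1, 0, 0), (0, 0, 1, 1), (0, 0, -1, -1),
     (1, 0, 0, 1), (1, 0, -1, 0), (-1, 0, 1, 0), (-1, 0, 0, -1),
     (0, 1, 1, 0), (0, 1, 0, -1), (0, -1, 0, 1), (0, -1, -1, 0)}" (is "_ \<longleftrightarrow> ?R")
proof
  assume "vertex_ok s n l r"
  then have "s = -1 \<or> s = 0 \<or> s = 1" "n = -1 \<or> n = 0 \<or> n = 1" "l = -1 \<or> l = 0 \<or> l = 1"
    "\<bar>s\<bar> + \<bar>n\<bar> + \<bar>l\<bar> + \<bar>r\<bar> = 2" "r = s + l - n"
    by (auto simp: vertex_ok_def)
  then show ?R by (elim disjE) simp_all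
next
  assume ?R
  then show "vertex_ok s n l r" by (simp add: vertex_ok_def) (elim disjE; simp)
qed

text \<open>The edges traversed from vertices with \<open>x - y\<close> even to those with \<open>x - y\<close> odd form a matching, and so
  do the edges traversed in the opposite direction. Each matching has a height function, which changes
  by \<open>0\<close> or \<open>1\<close> across a row. The flow \<open>e\<close> through a horizontal edge is the difference of the two changes
  at this place, and \<open>theta\<close> is their sum; \<open>p\<close> is the parity of the vertex to the right of the edge.\<close>

definition theta :: "bool \<Rightarrow> int \<Rightarrow> int" where
  "theta p e = (if p then \<bar>e\<bar> else 2 - \<bar>e\<bar>)"

text \<open>The non-local part of the difference of the areas of two consecutive levels, after \<open>k\<close> vertices of
  the row between them: \<open>P\<close> and \<open>T\<close> are the partial sums on the upper level, \<open>l\<close> and \<open>t\<close> are the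
  horizontal flow and \<open>theta\<close> at the current place, and \<open>g\<close> is the flow that enters at the left end.\<close>

definition row_balance :: "int \<Rightarrow> int \<Rightarrow> int \<Rightarrow> int \<Rightarrow> int \<Rightarrow> int \<Rightarrow> int" where
  "row_balance g k P T t l = P * t - T * l + g * (P - T) + g * (l - t)
     + 2 * g * k + 2 * (t - l) - 2 * P + 4 * T - 2 * k"

text \<open>By conservation the partial sums on the lower level are \<open>P + l - g\<close> and \<open>T + t - g\<close>. Hence the
  identity involves a single vertex only, and there are twelve kinds of vertices in two parities.\<close>

lemma vertex_step:
  fixes P T g k s n l r :: int and p :: bool
  assumes "vertex_ok s n l r"
  defines "t \<equiv> theta p l" and "t' \<equiv> theta (\<not> p) r"
    and "w \<equiv> signed_abs p s" and "w' \<equiv> signed_abs (\<not> p) n"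
  shows "P + l - g + s = (P + n) + r - g"
    and "T + t - g + w = (T + w') + t' - g"
    and "- 2 * (P + l - g + s) - (T + t - g) * s + (P + l - g) * w
         - (- 2 * (P + n) - T * n + P * w') =
       row_balance g (k + 1) (P + n) (T + w') t' r - row_balance g k P T t l + 2 * excess p s n l r"
proof -
  have *: "(s, n, l, r) \<in> {(1, 1, 0, 0), (-1, -1, 0, 0), (0, 0, 1, 1), (0, 0, -1, -1),
     (1, 0, 0, 1), (1, 0, -1, 0), (-1, 0, 1, 0), (-1, 0, 0, -1),
     (0, 1, 1, 0), (0, 1, 0, -1), (0, -1, 0, 1), (0, -1, -1, 0)}"
    using assms(1) unfolding vertex_ok_iff .
  show "P + l - g + s = (P + n) + r - g"
    using assms(1) by (simp add: vertex_ok_def)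
  show "T + t - g + w = (T + w') + t' - g"
    using assms(1) by (cases p) (simp_all add: vertex_ok_def t_def t'_def w_def w'_def theta_def signed_abs_def)
  show "- 2 * (P + l - g + s) - (T + t - g) * s + (P + l - g) * w
         - (- 2 * (P + n) - T * n + P * w') =
       row_balance g (k + 1) (P + n) (T + w') t' r - row_balance g k P T t l + 2 * excess p s n l r"
    using * unfolding t_def t'_def w_def w'_def row_balance_def insert_iff prod.inject empty_iff
    by (elim disjE conjE; cases p;
        simp add: signed_abs_def theta_def excess_def Let_def algebra_simps)
qed

lemma row_invariant:
  fixes s n e :: "nat \<Rightarrow> int" and a k :: nat
  defines "ws \<equiv> \<lambda>i. signed_abs (even (i + a)) (s i)"
    and "wn \<equiv> \<lambda>i. signed_abs (odd (i + a)) (n i)"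
  assumes out: "\<And>i. i < a \<Longrightarrow> s i = 0" "\<And>i. i < a \<Longrightarrow> n i = 0"
    and ok: "\<And>i. a \<le> i \<Longrightarrow> i < a + k \<Longrightarrow> vertex_ok (s i) (n i) (e i) (e (Suc i))"
    and g: "e a \<in> {0, 1}"
  shows "cum s (a + k) = cum n (a + k) + e (a + k) - e a \<and>
    cum ws (a + k) = cum wn (a + k) + theta (even k) (e (a + k)) - e a \<and>
    area s ws (a + k) - area n wn (a + k) =
      row_balance (e a) (int k) (cum n (a + k)) (cum wn (a + k)) (theta (even k) (e (a + k))) (e (a + k))
      + 2 * (\<Sum>i=a..<a + k. excess (even (i + a)) (s i) (n i) (e i) (e (Suc i)))"
  using ok
proof (induction k)
  case 0
  have c0: "cum s i = 0" "cum n i = 0" "cum ws i = 0" "cum wn i = 0" if "i \<le> a" for i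
    using that by (auto simp: cum_def ws_def wn_def out signed_abs_def intro!: sum.neutral)
  have ar: "area s ws a = 0" "area n wn a = 0"
    unfolding area_def by (auto simp del: cum_Suc intro!: sum.neutral simp: c0)
  show ?case using g by (auto simp: theta_def row_balance_def c0 ar)
next
  case (Suc k)
  let ?t = "theta (even k) (e (a + k))"
  have IH1: "cum s (a+k) = cum n (a+k) + e (a+k) - e a" and
    IH2: "cum ws (a+k) = cum wn (a+k) + ?t - e a" and
    IH3: "area s ws (a+k) - area n wn (a+k) =
      row_balance (e a) (int k) (cum n (a+k)) (cum wn (a+k)) ?t (e (a+k))
      + 2 * (\<Sum>i=a..<a+k. excess (even (i + a)) (s i) (n i) (e i) (e (Suc i)))"
    using Suc by auto
  have v: "vertex_ok (s (a+k)) (n (a+k)) (e (a+k)) (e (Suc (a+k)))"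
    using Suc.prems by simp
  have par: "even (a + k + a) = even k" by auto
  have w: "ws (a+k) = signed_abs (even k) (s (a+k))" "wn (a+k) = signed_abs (\<not> even k) (n (a+k))"
    by (simp_all only: ws_def wn_def par)
  note st = vertex_step(1)[OF v, where P = "cum n (a+k)" and g = "e a", folded IH1]
    vertex_step(2)[OF v, where g = "e a" and T = "cum wn (a+k)" and p = "even k", folded w IH2]
    vertex_step(3)[OF v, where P = "cum n (a+k)" and g = "e a" and T = "cum wn (a+k)"
      and p = "even k" and k = "int k", folded w IH1 IH2]
  have ar: "area f u (Suc x) = area f u x + (- 2 * (cum f x + f x) - cum u x * f x + cum f x * u x)"
    for f u x by simp
  have k: "a + Suc k = Suc (a + k)" "int (Suc k) = int k + 1" "even (Suc k) = (\<not> even k)" by simp_all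
  have S: "(\<Sum>i=a..<Suc (a+k). excess (even (i + a)) (s i) (n i) (e i) (e (Suc i))) =
      (\<Sum>i=a..<a+k. excess (even (i + a)) (s i) (n i) (e i) (e (Suc i)))
      + excess (even k) (s (a+k)) (n (a+k)) (e (a+k)) (e (Suc (a+k)))"
    by (subst sum.atLeastLessThan_Suc) (simp_all only: par le_add1)
  have ab: "A + X - (B + Y) = C' + 2 * (D + E)"
    if "X - Y = C' - C + 2 * E" "A - B = C + 2 * D" for A B C C' D E X Y :: int
    using that by simp
  show ?case
    unfolding k S cum_Suc ar using st(1,2) ab[OF st(3) IH3] by (intro conjI)
qed

section \<open>The excess identity\<close>

lemma word_degree_Cons:
  "word_degree (a # w) = (if a = 1 then count_list w 0 else 0) + word_degree w"
proof -
  let ?S = "{(i, j). i < j \<and> j < length (a # w) \<and> (a # w) ! i = 1 \<and> (a # w) ! j = 0}"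
  let ?A = "{(i, j). i < j \<and> j < length w \<and> w ! i = 1 \<and> w ! j = 0}"
  let ?B = "{j. a = 1 \<and> j < length w \<and> w ! j = 0}"
  have fin: "finite ?A" by (rule finite_subset[of _ "{..<length w} \<times> {..<length w}"]) auto
  have finB: "finite ?B" by (rule finite_subset[of _ "{..<length w}"]) auto
  have "?S = (\<lambda>(i, j). (Suc i, Suc j)) ` ?A \<union> (\<lambda>j. (0, Suc j)) ` ?B" (is "_ = ?R")
  proof (rule set_eqI)
    fix p :: "nat \<times> nat"
    obtain i j where p: "p = (i, j)" by (cases p)
    show "p \<in> ?S \<longleftrightarrow> p \<in> ?R"
      unfolding p by (cases i; cases j) (auto simp: image_iff)
  qed
  moreover have "card ((\<lambda>(i, j). (Suc i, Suc j)) ` ?A) = card ?A"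
    by (intro card_image) (auto simp: inj_on_def)
  moreover have "card ((\<lambda>j. (0::nat, Suc j)) ` ?B) = card ?B"
    by (intro card_image) (auto simp: inj_on_def)
  moreover have "card ((\<lambda>(i, j). (Suc i, Suc j)) ` ?A \<union> (\<lambda>j. (0, Suc j)) ` ?B) =
      card ((\<lambda>(i, j). (Suc i, Suc j)) ` ?A) + card ((\<lambda>j. (0::nat, Suc j)) ` ?B)"
  proof (rule card_Un_disjoint)
    show "finite ((\<lambda>(i, j). (Suc i, Suc j)) ` ?A)" "finite ((\<lambda>j. (0::nat, Suc j)) ` ?B)"
      using fin finB by blast+
    show "(\<lambda>(i, j). (Suc i, Suc j)) ` ?A \<inter> (\<lambda>j. (0, Suc j)) ` ?B = {}" by auto
  qed
  moreover have "card ?B = (if a = 1 then count_list w 0 else 0)"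
  proof -
    have "count_list w 0 = card {j. j < length w \<and> w ! j = 0}"
      unfolding count_list_eq_length_filter length_filter_conv_card by metis
    then show ?thesis by simp
  qed
  ultimately show ?thesis unfolding word_degree_def by simp
qed

lemma word_degree_Nil [simp]: "word_degree [] = 0"
  by (simp add: word_degree_def)

lemma word_degree_snoc:
  "word_degree (w @ [a]) = word_degree w + (if a = 0 then count_list w 1 else 0)"
  by (induction w) (auto simp: word_degree_Cons)

definition tri :: "nat \<Rightarrow> nat \<Rightarrow> nat \<Rightarrow> bool" where
  "tri n x y \<longleftrightarrow> y \<le> x \<and> x + y + 2 \<le> 4 * n"

text \<open>\<open>v x y\<close> is \<open>1\<close>, \<open>-1\<close> or \<open>0\<close> if the vertical edge below \<open>(x, y)\<close> is traversed upwards, downwards or is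
  absent, and \<open>h x y\<close> is \<open>1\<close>, \<open>-1\<close> or \<open>0\<close> if the horizontal edge to the left of \<open>(x, y)\<close> is traversed to
  the right, to the left or is absent. Paths that start at a left vertex or end at a right vertex are
  prolonged by ghost edges outside the triangle; then every vertex lies in the interior of a path or on
  a cycle, and the boundary vertices obey the same rule \<open>vertex_ok\<close> as the inner ones.\<close>

definition flow :: "nat \<Rightarrow> nat list \<Rightarrow> nat list \<Rightarrow> nat list \<Rightarrow>
    (nat \<Rightarrow> nat \<Rightarrow> int) \<Rightarrow> (nat \<Rightarrow> nat \<Rightarrow> int) \<Rightarrow> bool" where
  "flow n \<sigma> \<tau> \<pi> v h \<longleftrightarrow>
     (\<forall>x y. tri n x y \<longrightarrow> vertex_ok (v x y) (v x (Suc y)) (h x y) (h (Suc x) y)) \<and>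
     (\<forall>x y. \<not> tri n x y \<longrightarrow> v x y = 0) \<and>
     (\<forall>x. tri n x 0 \<longrightarrow> v x 0 = (if odd x then 0 else if \<pi> ! (x div 2) = 0 then 1 else -1)) \<and>
     (\<forall>y < 2 * n. h y y = of_bool (\<sigma> ! y = 1)) \<and>
     (\<forall>y < 2 * n. h (4 * n - 1 - y) y = of_bool (\<tau> ! (2 * n - 1 - y) = 0))"

definition vertex_excess :: "(nat \<Rightarrow> nat \<Rightarrow> int) \<Rightarrow> (nat \<Rightarrow> nat \<Rightarrow> int) \<Rightarrow> nat \<Rightarrow> nat \<Rightarrow> int" where
  "vertex_excess v h x y = excess (even (x + y)) (v x y) (v x (Suc y)) (h x y) (h (Suc x) y)"

lemma excess_nonneg: "0 \<le> excess p s n l r"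
  by (simp add: excess_def Let_def)

definition level_cum where "level_cum n v y = cum (\<lambda>x. v x y) (4 * n - 1 - y)"
definition level_abs where
  "level_abs n v y = cum (\<lambda>x. signed_abs (even (x + y)) (v x y)) (4 * n - 1 - y)"
definition level_area where
  "level_area n v y = area (\<lambda>x. v x y) (\<lambda>x. signed_abs (even (x + y)) (v x y)) (4 * n - 1 - y)"

text \<open>The right end of row \<open>y\<close>, where \<open>1 - u\<close> leaves through the ghost edge. Level \<open>y + 1\<close> is shorter than
  level \<open>y\<close> by one position at each end; the position at the right contributes
  \<open>- 2 * level_cum n v (Suc y)\<close>.\<close>

lemma row_step:
  assumes fl: "flow n \<sigma> \<tau> \<pi> v h" and y: "y < 2 * n"
  defines "g \<equiv> of_bool (\<sigma> ! y = 1)" and "u \<equiv> of_bool (\<tau> ! (2 * n - 1 - y) \<noteq> 0)"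
  shows "level_cum n v y = level_cum n v (Suc y) + 1 - u - g"
    and "level_abs n v y = level_abs n v (Suc y) + 1 + u - g"
    and "level_area n v y = level_area n v (Suc y) - 2 * level_cum n v (Suc y)
      + row_balance g (4 * int n - 1 - 2 * int y) (level_cum n v (Suc y)) (level_abs n v (Suc y)) (1 + u) (1 - u)
      + 2 * (\<Sum>x=y..<4 * n - 1 - y. vertex_excess v h x y)"
proof -
  let ?k = "4 * n - 1 - 2 * y"
  have k: "y + ?k = 4 * n - 1 - y" and kp: "odd ?k" and ik: "int ?k = 4 * int n - 1 - 2 * int y"
    using y by auto
  have out: "v i y = 0" "v i (Suc y) = 0" if "i < y" for i
    using fl that by (auto simp: flow_def tri_def)
  have ok: "vertex_ok (v i y) (v i (Suc y)) (h i y) (h (Suc i) y)" if "y \<le> i" "i < y + ?k" for i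
    using fl that y by (auto simp: flow_def tri_def)
  have g: "h y y = g" "h y y \<in> {0, 1}" using fl y by (auto simp: flow_def g_def)
  have u: "h (4 * n - 1 - y) y = 1 - u" using fl y by (auto simp: flow_def u_def)
  have th: "theta (even ?k) (1 - u) = 1 + u" using kp by (auto simp: theta_def u_def)
  note R = row_invariant[of y "\<lambda>x. v x y" "\<lambda>x. v x (Suc y)" ?k "\<lambda>x. h x y", OF out ok g(2),
      unfolded k u th ik g(1)]
  have last: "4 * n - 1 - y = Suc (4 * n - 1 - Suc y)" using y by simp
  have lz: "v (4 * n - 1 - Suc y) (Suc y) = 0"
  proof -
    have "\<not> tri n (4 * n - 1 - Suc y) (Suc y)" using y by (auto simp: tri_def)
    then show ?thesis using fl unfolding flow_def by blast
  qed
  have par: "odd (x + y) = even (x + Suc y)" for x by simp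
  have c: "cum (\<lambda>x. v x (Suc y)) (4 * n - 1 - y) = level_cum n v (Suc y)"
    "cum (\<lambda>x. signed_abs (odd (x + y)) (v x (Suc y))) (4 * n - 1 - y) = level_abs n v (Suc y)"
    "area (\<lambda>x. v x (Suc y)) (\<lambda>x. signed_abs (odd (x + y)) (v x (Suc y))) (4 * n - 1 - y)
      = level_area n v (Suc y) - 2 * level_cum n v (Suc y)"
    unfolding last level_cum_def level_abs_def level_area_def par cum_Suc area_Suc lz
    by (simp_all only: signed_abs_def abs_zero minus_zero if_cancel add_0_right mult_zero_right
        diff_zero)
  note R' = R[unfolded c, folded level_cum_def level_abs_def level_area_def]
  show "level_cum n v y = level_cum n v (Suc y) + 1 - u - g"
    "level_abs n v y = level_abs n v (Suc y) + 1 + u - g"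
    "level_area n v y = level_area n v (Suc y) - 2 * level_cum n v (Suc y)
      + row_balance g (4 * int n - 1 - 2 * int y) (level_cum n v (Suc y)) (level_abs n v (Suc y)) (1 + u) (1 - u)
      + 2 * (\<Sum>x=y..<4 * n - 1 - y. vertex_excess v h x y)"
    using R' unfolding vertex_excess_def by linarith+
qed

definition balanced :: "nat \<Rightarrow> nat list \<Rightarrow> bool" where
  "balanced n w \<longleftrightarrow> length w = 2 * n \<and> set w \<subseteq> {0, 1} \<and> count_list w 0 = n \<and> count_list w 1 = n"

text \<open>Downward induction on the level. Above level \<open>y\<close> only the letters of \<open>\<sigma>\<close> from position \<open>y\<close> on and the
  first \<open>2 * n - y\<close> letters of \<open>\<tau>\<close> matter. Row \<open>y\<close> removes the first letter of the former and the last
  letter of the latter word; the lost inversions are the terms \<open>g * s (Suc y)\<close> and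
  \<open>(1 - u) * r (Suc y)\<close> of the row balance.\<close>

lemma level_identity:
  assumes fl: "flow n \<sigma> \<tau> \<pi> v h" and w: "balanced n \<sigma>" "balanced n \<tau>" and y: "y \<le> 2 * n"
  defines "s \<equiv> \<lambda>y. int (count_list (drop y \<sigma>) 0)"
    and "r \<equiv> \<lambda>y. int (count_list (take (2 * n - y) \<tau>) 1)"
  shows "level_cum n v y = s y - r y \<and> level_abs n v y = s y + r y \<and>
    level_area n v y + 2 * (4 * int n - 2 - 2 * int y) * s y - 2 * r y * s y - 2 * r y * r y
      - 2 * s y * s y + 4 * s y =
    4 * (int (word_degree (drop y \<sigma>)) + int (word_degree (take (2 * n - y) \<tau>)))
      + 2 * (\<Sum>j=y..<2 * n. \<Sum>x=j..<4 * n - 1 - j. vertex_excess v h x j)"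
  using y
proof (induction y rule: inc_induct)
  case base
  have z: "signed_abs p 0 = 0" for p by (simp add: signed_abs_def)
  have "v x (2 * n) = 0" for x using fl by (auto simp: flow_def tri_def)
  then show ?case using w
    by (simp add: level_cum_def level_abs_def level_area_def s_def r_def balanced_def cum_def area_def
        z)
next
  case (step y)
  define g :: int where "g = of_bool (\<sigma> ! y = 1)"
  define u :: int where "u = of_bool (\<tau> ! (2 * n - 1 - y) \<noteq> 0)"
  note rs = row_step[OF fl step.hyps(2), folded g_def u_def]
  have d: "drop y \<sigma> = \<sigma> ! y # drop (Suc y) \<sigma>"
    using step.hyps w by (intro Cons_nth_drop_Suc[symmetric]) (auto simp: balanced_def)
  have t: "take (2 * n - y) \<tau> = take (2 * n - Suc y) \<tau> @ [\<tau> ! (2 * n - 1 - y)]"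
  proof -
    have "2 * n - y = Suc (2 * n - Suc y)" using step.hyps by simp
    then show ?thesis using step.hyps w
      by (simp add: take_Suc_conv_app_nth balanced_def)
  qed
  have so: "\<sigma> ! y = 0 \<or> \<sigma> ! y = 1" and ta: "\<tau> ! (2 * n - 1 - y) = 0 \<or> \<tau> ! (2 * n - 1 - y) = 1"
  proof -
    have "\<sigma> ! y \<in> set \<sigma>" "\<tau> ! (2 * n - 1 - y) \<in> set \<tau>"
      using step.hyps w by (auto simp: balanced_def)
    then show "\<sigma> ! y = 0 \<or> \<sigma> ! y = 1" "\<tau> ! (2 * n - 1 - y) = 0 \<or> \<tau> ! (2 * n - 1 - y) = 1"
      using w by (auto simp: balanced_def)
  qed
  have s: "s y = s (Suc y) + 1 - g" unfolding s_def d using so by (auto simp: g_def)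
  have r: "r y = r (Suc y) + u" unfolding r_def t using ta by (auto simp: u_def)
  have dd: "int (word_degree (drop y \<sigma>)) = int (word_degree (drop (Suc y) \<sigma>)) + g * s (Suc y)"
    unfolding d word_degree_Cons by (auto simp: g_def s_def)
  have dt: "int (word_degree (take (2 * n - y) \<tau>)) =
      int (word_degree (take (2 * n - Suc y) \<tau>)) + (1 - u) * r (Suc y)"
    unfolding t word_degree_snoc by (auto simp: u_def r_def)
  have gu: "g = 0 \<or> g = 1" "u = 0 \<or> u = 1" by (auto simp: g_def u_def)
  have E: "(\<Sum>j=y..<2 * n. \<Sum>x=j..<4 * n - 1 - j. vertex_excess v h x j) =
      (\<Sum>x=y..<4 * n - 1 - y. vertex_excess v h x y) +
      (\<Sum>j=Suc y..<2 * n. \<Sum>x=j..<4 * n - 1 - j. vertex_excess v h x j)"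
    using step.hyps by (simp add: sum.atLeast_Suc_lessThan)
  have IH1: "level_cum n v (Suc y) = s (Suc y) - r (Suc y)"
    and IH2: "level_abs n v (Suc y) = s (Suc y) + r (Suc y)"
    and IH3: "level_area n v (Suc y) = - 2 * (4 * int n - 2 - 2 * int (Suc y)) * s (Suc y)
       + 2 * r (Suc y) * s (Suc y) + 2 * r (Suc y) * r (Suc y)
      + 2 * s (Suc y) * s (Suc y) - 4 * s (Suc y) +
    4 * (int (word_degree (drop (Suc y) \<sigma>)) + int (word_degree (take (2 * n - Suc y) \<tau>)))
      + 2 * (\<Sum>j=Suc y..<2 * n. \<Sum>x=j..<4 * n - 1 - j. vertex_excess v h x j)"
    using step.IH by (auto simp: algebra_simps)
  show ?case
    unfolding rs E dd dt IH1 IH2 IH3 s r row_balance_def using gu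
    by (elim disjE) (simp_all add: algebra_simps)
qed

text \<open>The bottom level of a flow: the letters of \<open>w\<close> are at the even positions.\<close>

definition word_row :: "nat list \<Rightarrow> nat \<Rightarrow> int" where
  "word_row w x = (if odd x \<or> 2 * length w \<le> x then 0 else if w ! (x div 2) = 0 then 1 else - 1)"

lemma word_row_area:
  assumes "set w \<subseteq> {0, 1}"
  defines "s \<equiv> int (count_list w 0)" and "r \<equiv> int (count_list w 1)"
  shows "cum (word_row w) (2 * length w) = s - r \<and>
    cum (\<lambda>x. signed_abs (even x) (word_row w x)) (2 * length w) = s + r \<and>
    area (word_row w) (\<lambda>x. signed_abs (even x) (word_row w x)) (2 * length w) =
     4 * int (word_degree w) - 2 * s * s - 2 * s - 2 * r * s + 2 * r * r + 2 * r"
  using assms(1) unfolding s_def r_def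
proof (induction w rule: rev_induct)
  case Nil
  then show ?case by simp
next
  case (snoc a w)
  define f where "f = word_row w"
  define f' where "f' = word_row (w @ [a])"
  define W where "W = (\<lambda>x. signed_abs (even x) (f x))"
  define W' where "W' = (\<lambda>x. signed_abs (even x) (f' x))"
  have eq: "f' x = f x" if "x < 2 * length w" for x
    using that by (auto simp: f_def f'_def word_row_def nth_append)
  have c: "cum f' x = cum f x" "cum W' x = cum W x" if "x \<le> 2 * length w" for x
    using that eq unfolding cum_def W_def W'_def by (auto intro!: sum.cong)
  have ar: "area f' W' (2 * length w) = area f W (2 * length w)"
    unfolding area_def
  proof (rule sum.cong[OF refl])
    fix i assume "i \<in> {..<2 * length w}"
    then have "i < 2 * length w" by simp
    moreover from this have "Suc i \<le> 2 * length w" by simp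
    ultimately show "- 2 * cum f' (Suc i) - cum W' i * f' i + cum f' i * W' i =
       - 2 * cum f (Suc i) - cum W i * f i + cum f i * W i"
      unfolding c(1)[OF \<open>Suc i \<le> _\<close>] using eq c by (simp add: W_def W'_def del: cum_Suc)
  qed
  have IH: "cum f (2 * length w) = int (count_list w 0) - int (count_list w 1)"
    "cum W (2 * length w) = int (count_list w 0) + int (count_list w 1)"
    "area f W (2 * length w) =
     4 * int (word_degree w) - 2 * int (count_list w 0) * int (count_list w 0) - 2 * int (count_list w 0)
     - 2 * int (count_list w 1) * int (count_list w 0) + 2 * int (count_list w 1) * int (count_list w 1)
     + 2 * int (count_list w 1)"
    using snoc.IH snoc.prems unfolding f_def[symmetric] W_def[symmetric] by auto
  have l: "2 * length (w @ [a]) = Suc (Suc (2 * length w))" by simp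
  have z: "f' (Suc (2 * length w)) = 0" "W' (Suc (2 * length w)) = 0"
    by (auto simp: f'_def W'_def word_row_def signed_abs_def)
  have a: "a = 0 \<or> a = 1" using snoc.prems by auto
  have fa: "f' (2 * length w) = (if a = 0 then 1 else -1)" "W' (2 * length w) = 1"
    by (auto simp: f'_def W'_def word_row_def signed_abs_def nth_append)
  show ?case
    unfolding f'_def[symmetric] W'_def[symmetric] unfolding l cum_Suc area_Suc z fa ar c[OF order_refl] IH
    using a by (elim disjE) (simp_all add: word_degree_snoc algebra_simps)
qed

text \<open>Evaluate \<open>level_identity\<close> at the bottom, where \<open>word_row_area\<close> computes the area.\<close>

theorem excess_identity:
  assumes n: "1 \<le> n" and fl: "flow n \<sigma> \<tau> \<pi> v h"
    and w: "balanced n \<sigma>" "balanced n \<tau>" "balanced n \<pi>"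
  shows "2 * int (word_degree \<pi>) = 2 * (int (word_degree \<sigma>) + int (word_degree \<tau>))
    + (\<Sum>j<2 * n. \<Sum>x=j..<4 * n - 1 - j. vertex_excess v h x j)"
proof -
  define f where "f = word_row \<pi>"
  have len: "length \<pi> = 2 * n" using w by (simp add: balanced_def)
  have f: "v x 0 = f x" for x
  proof (cases "tri n x 0")
    case True
    then show ?thesis using fl n by (auto simp: flow_def f_def word_row_def len tri_def)
  next
    case False
    then have "v x 0 = 0" using fl by (auto simp: flow_def)
    moreover from False have "4 * n - 1 \<le> x" by (auto simp: tri_def)
    then have "x = 4 * n - 1 \<or> 4 * n \<le> x" by auto
    then have "f x = 0" using n by (auto simp: f_def word_row_def len)
    ultimately show ?thesis by simp
  qed
  have B: "cum f (4 * n) = 0" "area f (\<lambda>x. signed_abs (even x) (f x)) (4 * n) =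
     4 * int (word_degree \<pi>) - 2 * int n * int n"
    using word_row_area[of \<pi>] w unfolding f_def[symmetric] len by (auto simp: balanced_def algebra_simps)
  have l: "4 * n = Suc (4 * n - 1)" using n by simp
  have fz: "f (4 * n - 1) = 0" using n by (simp add: f_def word_row_def)
  have cz: "cum f (4 * n - 1) = 0" using B(1) fz cum_Suc[of f "4 * n - 1", folded l] by simp
  have "area f (\<lambda>x. signed_abs (even x) (f x)) (4 * n) =
      area f (\<lambda>x. signed_abs (even x) (f x)) (4 * n - 1)"
    using area_Suc[of f "\<lambda>x. signed_abs (even x) (f x)" "4 * n - 1", folded l] B(1) cz fz
    by (simp add: signed_abs_def)
  then have "level_area n v 0 = 4 * int (word_degree \<pi>) - 2 * int n * int n"
    using B(2) by (simp add: level_area_def f)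
  then show ?thesis
    using level_identity[OF fl w(1,2), of 0] w
    by (simp add: balanced_def algebra_simps atLeast0LessThan)
qed

section \<open>Graphs of maximal degree two\<close>

definition end_of :: "('a \<times> 'a) set \<Rightarrow> 'a \<Rightarrow> bool" where
  "end_of E s \<longleftrightarrow> (\<forall>a b. (s, a) \<in> E \<longrightarrow> (s, b) \<in> E \<longrightarrow> a = b)"

text \<open>A dart is an edge with a direction. In a graph of maximal degree two a walk that never turns back is
  determined by its first dart, so paths and cycles can be studied as orbits of this relation.\<close>

definition dart_step :: "('a \<times> 'a) set \<Rightarrow> (('a \<times> 'a) \<times> ('a \<times> 'a)) set" where
  "dart_step E = {((u, w), (w, z)) | u w z. (u, w) \<in> E \<and> (w, z) \<in> E \<and> u \<noteq> z}"

definition epath :: "('a \<times> 'a) set \<Rightarrow> 'a list \<Rightarrow> bool" where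
  "epath E p \<longleftrightarrow> 2 \<le> length p \<and> distinct p \<and> (\<forall>i. Suc i < length p \<longrightarrow> (p ! i, p ! Suc i) \<in> E)"

locale degree2 =
  fixes E :: "('a \<times> 'a) set"
  assumes fin: "finite E"
    and symE: "(u, w) \<in> E \<Longrightarrow> (w, u) \<in> E"
    and irreflE: "(u, u) \<notin> E"
    and deg: "(w, a) \<in> E \<Longrightarrow> (w, b) \<in> E \<Longrightarrow> (w, c) \<in> E \<Longrightarrow> a = b \<or> b = c \<or> a = c"
begin

abbreviation N where "N \<equiv> dart_step E"
abbreviation rev_dart :: "'a \<times> 'a \<Rightarrow> 'a \<times> 'a" where "rev_dart \<equiv> prod.swap"

lemma stepD:
  assumes "(d, d') \<in> N"
  obtains u w z where "d = (u, w)" "d' = (w, z)" "(u, w) \<in> E" "(w, z) \<in> E" "u \<noteq> z"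
  using assms unfolding dart_step_def by blast

lemma step_det: "(d, d1) \<in> N \<Longrightarrow> (d, d2) \<in> N \<Longrightarrow> d1 = d2"
  by (elim stepD) (use symE deg in \<open>blast\<close>)

lemma step_rev: "(d, d') \<in> N \<Longrightarrow> (rev_dart d', rev_dart d) \<in> N"
  by (elim stepD) (use symE in \<open>auto simp: dart_step_def\<close>)

lemma steps_rev: "(d, d') \<in> N\<^sup>* \<Longrightarrow> (rev_dart d', rev_dart d) \<in> N\<^sup>*"
  by (induction rule: rtrancl_induct) (auto intro: converse_rtrancl_into_rtrancl dest: step_rev)

text \<open>A walk that traverses its first edge again in the opposite direction would be symmetric about its
  middle. There a dart would be its own reversal, or would be followed by its reversal.\<close>

lemma no_reversal:
  assumes "d \<in> E"
  shows "(d, rev_dart d) \<notin> N\<^sup>*"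
proof -
  have "(d, rev_dart d) \<notin> N ^^ k" if "d \<in> E" for k d
    using that
  proof (induction k arbitrary: d rule: less_induct)
    case (less k)
    show ?case
    proof
      assume k: "(d, rev_dart d) \<in> N ^^ k"
      consider "k = 0" | "k = 1" | j where "k = Suc (Suc j)" by (metis One_nat_def not0_implies_Suc)
      then show False
      proof cases
        case 1
        then have "d = rev_dart d" using k by simp
        then have "fst d = snd d" by (metis fst_swap)
        then show False using less.prems irreflE by (metis prod.collapse)
      next
        case 2
        then have "(d, rev_dart d) \<in> N" using k by simp
        then show False by (elim stepD) auto
      next
        case (3 j)
        (* cut off the first dart and the last one: the walk in between again ends in its own reversal *)
        obtain d1 where d1: "(d, d1) \<in> N" "(d1, rev_dart d) \<in> N ^^ Suc j"
          using k 3 by (metis relpow_Suc_E2)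
        obtain d2 where d2: "(d1, d2) \<in> N ^^ j" "(d2, rev_dart d) \<in> N"
          using d1(2) by auto
        have "d1 = rev_dart d2" using step_det[OF d1(1)] step_rev[OF d2(2)] by simp
        then have "d2 = rev_dart d1" by simp
        moreover have "d1 \<in> E" using d1(1) by (auto elim: stepD)
        ultimately show False using less.IH[of j d1] 3 d2(1) by simp
      qed
    qed
  qed
  then show ?thesis using assms by (auto simp: rtrancl_power)
qed

definition cls where "cls d = {d'. (d, d') \<in> N\<^sup>* \<or> (d', d) \<in> N\<^sup>*}"

lemma steps_linear:
  assumes "(d, d1) \<in> N\<^sup>*" "(d, d2) \<in> N\<^sup>*"
  shows "(d1, d2) \<in> N\<^sup>* \<or> (d2, d1) \<in> N\<^sup>*"
  using assms(1)
proof (induction rule: rtrancl_induct)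
  case base
  then show ?case using assms(2) by simp
next
  case (step x y)
  then show ?case
    by (metis converse_rtranclE rtrancl.rtrancl_into_rtrancl step_det)
qed

lemma steps_linear':
  assumes "(d1, d) \<in> N\<^sup>*" "(d2, d) \<in> N\<^sup>*"
  shows "(d1, d2) \<in> N\<^sup>* \<or> (d2, d1) \<in> N\<^sup>*"
  using steps_linear[OF steps_rev[OF assms(1)] steps_rev[OF assms(2)]] steps_rev
  by (metis swap_swap)

lemma cls_eq: "(d, d') \<in> N\<^sup>* \<Longrightarrow> cls d = cls d'"
  unfolding cls_def by (rule Collect_cong) (meson steps_linear steps_linear' rtrancl_trans)

lemma cls_rev_ne: "d \<in> E \<Longrightarrow> cls d \<noteq> cls (rev_dart d)"
proof
  assume d: "d \<in> E" and "cls d = cls (rev_dart d)"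
  moreover have "d \<in> cls d" by (simp add: cls_def)
  ultimately have "(rev_dart d, d) \<in> N\<^sup>* \<or> (d, rev_dart d) \<in> N\<^sup>*"
    by (simp add: cls_def)
  moreover have "rev_dart d \<in> E" using d symE by (cases d) auto
  ultimately show False using no_reversal[OF d] no_reversal[of "rev_dart d"] by simp
qed

lemma end_first: "end_of E s \<Longrightarrow> (d, (s, a)) \<in> N\<^sup>* \<Longrightarrow> d = (s, a)"
  by (erule rtranclE) (auto elim!: stepD simp: end_of_def dest: symE)

lemma end_last: "end_of E s \<Longrightarrow> ((a, s), d) \<in> N\<^sup>* \<Longrightarrow> d = (a, s)"
  by (erule converse_rtranclE) (auto elim!: stepD simp: end_of_def dest: symE)

lemma end_cls:
  assumes "end_of E s" "(s, a) \<in> cls d"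
  shows "((s, a), d) \<in> N\<^sup>*"
proof -
  have "(d, (s, a)) \<in> N\<^sup>* \<or> ((s, a), d) \<in> N\<^sup>*" using assms(2) by (simp add: cls_def)
  then show ?thesis using end_first[OF assms(1), of d a] by auto
qed

text \<open>By \<open>cls_rev_ne\<close> a component has exactly two directions, and one of them has to be chosen. A direction
  is good if it does not leave a vertex of \<open>B\<close>. At least one of the two is good, because by \<open>BA\<close> no path
  has both ends in \<open>B\<close>; and if the component has ends in \<open>A\<close> and \<open>B\<close>, only the direction from \<open>A\<close> to \<open>B\<close>
  is good.\<close>

theorem orientation_exists:
  assumes ends: "\<And>s. s \<in> A \<union> B \<Longrightarrow> end_of E s" and disj: "A \<inter> B = {}"
    and AB: "\<And>s a. s \<in> A \<Longrightarrow> (s, a) \<in> E \<Longrightarrow> \<exists>t\<in>B. \<exists>b. ((s, a), (b, t)) \<in> N\<^sup>*"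
    and BA: "\<And>t b. t \<in> B \<Longrightarrow> (t, b) \<in> E \<Longrightarrow> \<exists>s\<in>A. \<exists>a. ((t, b), (a, s)) \<in> N\<^sup>*"
  obtains R where "R \<subseteq> E" "\<And>u w. (u, w) \<in> E \<Longrightarrow> (u, w) \<in> R \<longleftrightarrow> (w, u) \<notin> R"
    "\<And>d d'. (d, d') \<in> N \<Longrightarrow> d \<in> R \<longleftrightarrow> d' \<in> R"
    "\<And>s a. s \<in> A \<Longrightarrow> (s, a) \<in> E \<Longrightarrow> (s, a) \<in> R"
    "\<And>t b. t \<in> B \<Longrightarrow> (t, b) \<in> E \<Longrightarrow> (b, t) \<in> R"
proof -
  (* the unordered pair of the two directions is the same for a dart and for its reversal,
     so the choice is consistent *)
  define good where "good C \<longleftrightarrow> \<not> (\<exists>t\<in>B. \<exists>b. (t, b) \<in> C)" for C :: "('a \<times> 'a) set"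
  define pick where "pick d = (SOME C. C \<in> {cls d, cls (rev_dart d)} \<and> good C)" for d
  define R where "R = {d \<in> E. cls d = pick d}"
  have pick_rev: "pick (rev_dart d) = pick d" for d
    unfolding pick_def by (simp add: insert_commute)
  have ex: "good (cls d) \<or> good (cls (rev_dart d))" if d: "d \<in> E" for d
  proof (rule ccontr)
    assume "\<not> ?thesis"
    then obtain t b t' b' where t: "t \<in> B" "(t, b) \<in> cls d" and t': "t' \<in> B" "(t', b') \<in> cls (rev_dart d)"
      unfolding good_def by blast
    have "((t, b), d) \<in> N\<^sup>*" using end_cls[OF ends t(2)] t(1) by simp
    moreover have "((t', b'), rev_dart d) \<in> N\<^sup>*" using end_cls[OF ends t'(2)] t'(1) by simp
    then have "(d, (b', t')) \<in> N\<^sup>*" using steps_rev by fastforce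
    ultimately have 1: "((t, b), (b', t')) \<in> N\<^sup>*" by (rule rtrancl_trans)
    have "(t, b) \<in> E"
      using \<open>((t, b), d) \<in> N\<^sup>*\<close> d by (auto elim!: converse_rtranclE stepD)
    from BA[OF t(1) this] obtain s a where s: "s \<in> A" "((t, b), (a, s)) \<in> N\<^sup>*" by blast
    have "(a, s) = (b', t')"
      using steps_linear[OF 1 s(2)] end_last[of s a] end_last[of t' b'] ends s t' by auto
    then show False using s t' disj by blast
  qed
  have pickP: "pick d \<in> {cls d, cls (rev_dart d)} \<and> good (pick d)" if "d \<in> E" for d
    unfolding pick_def by (rule someI_ex) (use ex[OF that] in blast)
  have swapE: "rev_dart d \<in> E" if "d \<in> E" for d
    using that symE[of "fst d" "snd d"] by (simp add: prod.swap_def)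
  have R_bad: "rev_dart d \<in> R" if "d \<in> E" "\<not> good (cls d)" for d
  proof -
    have "pick d = cls (rev_dart d)" using pickP[OF that(1)] that(2) by (metis insertE singletonD)
    then show ?thesis using swapE[OF that(1)] by (simp add: R_def pick_rev)
  qed
  show ?thesis
  proof
    show "R \<subseteq> E" by (auto simp: R_def)
    fix u w assume e: "(u, w) \<in> E"
    show "(u, w) \<in> R \<longleftrightarrow> (w, u) \<notin> R"
    proof -
      have m: "(u, w) \<in> R \<longleftrightarrow> cls (u, w) = pick (u, w)" "(w, u) \<in> R \<longleftrightarrow> cls (w, u) = pick (u, w)"
        using pick_rev[of "(u, w)"] e symE[OF e] by (simp_all add: R_def)
      have "cls (u, w) \<noteq> cls (w, u)" "pick (u, w) = cls (u, w) \<or> pick (u, w) = cls (w, u)"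
        using pickP[OF e] cls_rev_ne[OF e] by simp_all
      then show ?thesis unfolding m by metis
    qed
  next
    fix d d' assume s: "(d, d') \<in> N"
    have E: "d \<in> E" "d' \<in> E" using s by (auto elim: stepD)
    have c: "cls d = cls d'" "cls (rev_dart d) = cls (rev_dart d')"
      using cls_eq[OF r_into_rtrancl[OF s]] cls_eq[OF r_into_rtrancl[OF step_rev[OF s]]]
      by simp_all
    then have "pick d = pick d'" by (simp add: pick_def)
    then show "d \<in> R \<longleftrightarrow> d' \<in> R" using E c by (simp add: R_def)
  next
    fix s a assume s: "s \<in> A" "(s, a) \<in> E"
    from AB[OF this] obtain t b where t: "t \<in> B" "((s, a), (b, t)) \<in> N\<^sup>*" by blast
    have "((t, b), (a, s)) \<in> N\<^sup>*" using steps_rev[OF t(2)] by simp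
    then have "\<not> good (cls (a, s))" using t(1) by (auto simp: good_def cls_def)
    then show "(s, a) \<in> R" using R_bad[of "(a, s)"] symE[OF s(2)] by simp
  next
    fix t b assume t: "t \<in> B" "(t, b) \<in> E"
    then have "\<not> good (cls (t, b))" by (auto simp: good_def cls_def)
    then show "(b, t) \<in> R" using R_bad[of "(t, b)"] t by simp
  qed
qed

lemma path_steps:
  assumes "epath E p" "Suc k < length p"
  shows "((p ! 0, p ! 1), (p ! k, p ! Suc k)) \<in> N\<^sup>*"
  using assms(2)
proof (induction k)
  case 0
  then show ?case by simp
next
  case (Suc k)
  have "p ! k \<noteq> p ! Suc (Suc k)"
    using assms(1) Suc.prems by (auto simp: epath_def nth_eq_iff_index_eq)
  then have "((p ! k, p ! Suc k), (p ! Suc k, p ! Suc (Suc k))) \<in> N"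
    using assms(1) Suc.prems by (auto simp: epath_def dart_step_def)
  with Suc show ?case by (meson Suc_lessD rtrancl.rtrancl_into_rtrancl)
qed

lemma path_last_step:
  assumes "epath E p"
  shows "((hd p, p ! 1), (p ! (length p - 2), last p)) \<in> N\<^sup>*"
proof -
  have l: "2 \<le> length p" using assms by (simp add: epath_def)
  then have "Suc (length p - 2) = length p - 1" "p \<noteq> []" by auto
  then show ?thesis using path_steps[OF assms, of "length p - 2"] l
    by (simp add: hd_conv_nth last_conv_nth)
qed

lemma path_rev:
  assumes "epath E p"
  shows "epath E (rev p)"
proof -
  have "(rev p ! i, rev p ! Suc i) \<in> E" if "Suc i < length p" for i
  proof -
    define j where "j = length p - Suc (Suc i)"
    have "length p - Suc i = Suc j" "Suc j < length p" using that by (auto simp: j_def)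
    moreover from this have "(p ! j, p ! Suc j) \<in> E" using assms by (simp add: epath_def)
    ultimately show ?thesis using that symE by (simp add: rev_nth j_def[symmetric])
  qed
  then show ?thesis using assms by (simp add: epath_def)
qed

text \<open>If the new vertex were on the path, it would have a third neighbour, or a second one in case it is
  the first vertex.\<close>

lemma path_extend:
  assumes p: "epath E p" and e: "end_of E (hd p)"
    and z: "(last p, z) \<in> E" "z \<noteq> p ! (length p - 2)"
  shows "epath E (p @ [z])"
proof -
  have l: "2 \<le> length p" and d: "distinct p" and ed: "\<And>i. Suc i < length p \<Longrightarrow> (p ! i, p ! Suc i) \<in> E"
    using p by (auto simp: epath_def)
  have ne: "p \<noteq> []" using l by auto
  have L: "last p = p ! (length p - 1)" using ne by (simp add: last_conv_nth)
  have pen: "(p ! (length p - 2), last p) \<in> E"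
    using ed[of "length p - 2"] l L by (simp add: numeral_2_eq_2 Suc_diff_Suc)
  have "z \<notin> set p"
  proof
    assume "z \<in> set p"
    then obtain k where k: "k < length p" "z = p ! k" by (auto simp: in_set_conv_nth)
    have km: "k \<noteq> length p - 2" using z k by auto
    have kl: "k \<noteq> length p - 1" using z k L irreflE by auto
    have kk: "Suc k < length p - 1" using k km kl by auto
    have zl: "(p ! k, last p) \<in> E" using z k symE by auto
    have zs: "(p ! k, p ! Suc k) \<in> E" using ed[of k] kk by auto
    have n1: "p ! Suc k \<noteq> last p" using d kk L by (auto simp: nth_eq_iff_index_eq)
    show False
    proof (cases k)
      case 0
      then have "p ! k = hd p" using ne by (simp add: hd_conv_nth)
      then show False using e zl zs n1 by (auto simp: end_of_def)
    next
      case (Suc j)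
      have zp: "(p ! k, p ! j) \<in> E" using ed[of j] kk Suc symE by auto
      have "p ! j \<noteq> p ! Suc k" "p ! j \<noteq> last p"
        using d kk L Suc by (auto simp: nth_eq_iff_index_eq)
      then show False using deg[OF zl zs zp] n1 by auto
    qed
  qed
  moreover have "((p @ [z]) ! i, (p @ [z]) ! Suc i) \<in> E" if "Suc i < length (p @ [z])" for i
  proof (cases "Suc i < length p")
    case True
    then show ?thesis using ed[of i] by (simp add: nth_append)
  next
    case False
    then have "i = length p - 1" "Suc i = length p" using that by auto
    then show ?thesis using z L by (simp add: nth_append)
  qed
  ultimately show ?thesis using l d unfolding epath_def by simp
qed

lemma maximal_path:
  assumes sa: "(s, a) \<in> E" and e: "end_of E s"
  obtains p where "epath E p" "hd p = s" "p ! 1 = a" "end_of E (last p)"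
proof -
  (* take a longest path that starts with the given dart *)
  define Q where "Q p \<longleftrightarrow> epath E p \<and> hd p = s \<and> p ! 1 = a" for p
  have "Q [s, a]" using sa irreflE by (auto simp: Q_def epath_def less_Suc_eq)
  moreover have "length p \<le> card (snd ` E \<union> {s})" if "Q p" for p
  proof -
    have "set p \<subseteq> snd ` E \<union> {s}"
    proof
      fix x assume "x \<in> set p"
      then obtain k where k: "k < length p" "x = p ! k" by (auto simp: in_set_conv_nth)
      show "x \<in> snd ` E \<union> {s}"
      proof (cases k)
        case 0
        then have "x = hd p" using k by (cases p) auto
        then show ?thesis using that by (simp add: Q_def)
      next
        case (Suc j)
        then have "(p ! j, x) \<in> E" using that k by (auto simp: Q_def epath_def)
        then show ?thesis by force
      qed
    qed
    moreover have "distinct p" using that by (simp add: Q_def epath_def)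
    ultimately show ?thesis using fin by (metis card_mono distinct_card finite_Un finite_imageI
        finite.emptyI finite_insert)
  qed
  ultimately obtain p where p: "Q p" "\<And>q. Q q \<Longrightarrow> length q \<le> length p"
    using ex_has_greatest_nat[of Q "[s, a]" length "card (snd ` E \<union> {s})"] by force
  have l: "2 \<le> length p" "p \<noteq> []" using p(1) by (auto simp: Q_def epath_def)
  have "z = p ! (length p - 2)" if "(last p, z) \<in> E" for z
  proof (rule ccontr)
    assume "z \<noteq> p ! (length p - 2)"
    then have "epath E (p @ [z])" using path_extend that p(1) e by (auto simp: Q_def)
    then have "Q (p @ [z])" using p(1) l by (auto simp: Q_def nth_append)
    then show False using p(2) by fastforce
  qed
  then have "end_of E (last p)" unfolding end_of_def by metis
  then show thesis using that p(1) by (auto simp: Q_def)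
qed

text \<open>A path between two ends is a whole component.\<close>

lemma path_closed:
  assumes p: "epath E p" and e: "end_of E (hd p)" "end_of E (last p)"
    and u: "u \<in> set p" "(u, w) \<in> E"
  shows "w \<in> set p"
proof -
  have ed: "\<And>i. Suc i < length p \<Longrightarrow> (p ! i, p ! Suc i) \<in> E" and l: "2 \<le> length p" and d: "distinct p"
    using p by (auto simp: epath_def)
  have ne: "p \<noteq> []" using l by auto
  obtain k where k: "k < length p" "u = p ! k" using u by (auto simp: in_set_conv_nth)
  consider "k = 0" | "k = length p - 1" | j where "k = Suc j" "Suc k < length p"
    using k by (cases k) (auto, linarith)
  then show ?thesis
  proof cases
    case 1
    then have "u = hd p" "(u, p ! 1) \<in> E" using k ne ed[of 0] l by (auto simp: hd_conv_nth)
    then have "w = p ! 1" using e(1) u by (auto simp: end_of_def)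
    then show ?thesis using l by simp
  next
    case 2
    have "Suc (length p - 2) = length p - 1" using l by auto
    then have "(p ! (length p - 2), u) \<in> E" using ed[of "length p - 2"] 2 k l by simp
    then have "w = p ! (length p - 2)" using e(2) u symE 2 k ne unfolding end_of_def by (metis last_conv_nth)
    then show ?thesis using l by simp
  next
    case (3 j)
    have "(u, p ! j) \<in> E" "(u, p ! Suc k) \<in> E" using ed[of j] ed[of k] 3 k symE by auto
    moreover have "p ! j \<noteq> p ! Suc k" using d 3 by (simp add: nth_eq_iff_index_eq)
    ultimately have "w = p ! j \<or> w = p ! Suc k" using deg u(2) by blast
    then show ?thesis using 3 k by auto
  qed
qed

lemma path_ends:
  assumes p: "epath E p" and u: "u \<in> set p" "end_of E u"
  shows "u = hd p \<or> u = last p"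
proof (rule ccontr)
  assume n: "\<not> ?thesis"
  have ed: "\<And>i. Suc i < length p \<Longrightarrow> (p ! i, p ! Suc i) \<in> E" and l: "2 \<le> length p" and d: "distinct p"
    using p by (auto simp: epath_def)
  have ne: "p \<noteq> []" using l by auto
  obtain k where k: "k < length p" "u = p ! k" using u by (auto simp: in_set_conv_nth)
  have "k \<noteq> 0" "k \<noteq> length p - 1" using n k ne by (metis hd_conv_nth) (use n k ne in \<open>metis last_conv_nth\<close>)
  then obtain j where j: "k = Suc j" "Suc k < length p" using k by (cases k) auto
  then have "(u, p ! j) \<in> E" "(u, p ! Suc k) \<in> E" using ed[of j] ed[of k] k symE by auto
  moreover have "p ! j \<noteq> p ! Suc k" using d j by (simp add: nth_eq_iff_index_eq)
  ultimately show False using u(2) by (auto simp: end_of_def)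
qed

lemma path_first:
  assumes "epath E p" shows "(hd p, p ! 1) \<in> E"
proof -
  have "2 \<le> length p" and ed: "\<And>i. Suc i < length p \<Longrightarrow> (p ! i, p ! Suc i) \<in> E"
    using assms by (auto simp: epath_def)
  then have "p \<noteq> []" "Suc 0 < length p" by auto
  then show ?thesis using ed[of 0] by (simp add: hd_conv_nth)
qed

lemma path_end_unique:
  assumes p: "epath E p" "epath E q" "hd p = hd q"
    and e: "end_of E (hd p)" "end_of E (last p)" "end_of E (last q)"
  shows "last p = last q"
proof -
  have eq: "p ! 1 = q ! 1" using path_first[OF p(1)] path_first[OF p(2)] e(1) p(3) by (auto simp: end_of_def)
  note pp = path_last_step[OF p(1)] and qq = path_last_step[OF p(2), folded p(3) eq]
  from steps_linear[OF pp qq] show ?thesis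
    using end_last[OF e(2)] end_last[OF e(3)] by (metis prod.inject)
qed

lemma path_last:
  assumes "epath E p" shows "(p ! (length p - 2), last p) \<in> E"
proof -
  have l: "2 \<le> length p" and ed: "\<And>i. Suc i < length p \<Longrightarrow> (p ! i, p ! Suc i) \<in> E"
    using assms by (auto simp: epath_def)
  have "Suc (length p - 2) = length p - 1" "Suc (length p - 2) < length p" "p \<noteq> []" using l by auto
  then show ?thesis using ed[of "length p - 2"] by (metis last_conv_nth)
qed

end

section \<open>Heights and link patterns\<close>

definition height :: "nat list \<Rightarrow> nat \<Rightarrow> int" where
  "height w k = int (count_list (take k w) 0) - int (count_list (take k w) 1)"

text \<open>Read \<open>0\<close> and \<open>1\<close> as brackets and count positions from 1: the height returns at \<open>j\<close> for the first time
  to its value before \<open>i\<close>.\<close>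

definition matched :: "nat list \<Rightarrow> nat \<Rightarrow> nat \<Rightarrow> bool" where
  "matched w i j \<longleftrightarrow> 1 \<le> i \<and> i < j \<and> j \<le> length w \<and> height w (i - 1) = height w j \<and>
     (\<forall>k. i \<le> k \<longrightarrow> k < j \<longrightarrow> height w j < height w k)"

lemma dyck_balanced: "w \<in> dyck_words n \<Longrightarrow> balanced n w"
  by (simp add: dyck_words_def balanced_def)

lemma balanced_letter: "balanced n w \<Longrightarrow> k < 2 * n \<Longrightarrow> w ! k = 0 \<or> w ! k = 1"
  unfolding balanced_def using nth_mem[of k w] by (metis insertE singletonD subsetD)

lemma height_0 [simp]: "height w 0 = 0"
  by (simp add: height_def)

lemma height_Suc:
  assumes "balanced n w" "k < 2 * n"
  shows "height w (Suc k) = height w k + (if w ! k = 0 then 1 else -1)"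
  using balanced_letter[OF assms] assms
  by (auto simp: height_def take_Suc_conv_app_nth balanced_def)

lemma height_end: "balanced n w \<Longrightarrow> height w (2 * n) = 0"
  by (simp add: height_def balanced_def)

lemma height_nonneg: "w \<in> dyck_words n \<Longrightarrow> k \<le> 2 * n \<Longrightarrow> 0 \<le> height w k"
  by (simp add: height_def dyck_words_def)

context
  fixes n :: nat and w :: "nat list"
  assumes w: "w \<in> dyck_words n"
begin

lemma balanced_w: "balanced n w" using w by (rule dyck_balanced)

lemma length_w: "length w = 2 * n" using balanced_w by (simp add: balanced_def)

lemma matched_letters:
  assumes "matched w i j" shows "w ! (i - 1) = 0" "w ! (j - 1) = 1"
proof -
  have m: "1 \<le> i" "i < j" "j \<le> 2 * n" "height w (i - 1) = height w j"
    and k: "\<And>k. i \<le> k \<Longrightarrow> k < j \<Longrightarrow> height w j < height w k"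
    using assms by (auto simp: matched_def length_w)
  have "height w (i - 1) < height w i" using k[of i] m by simp
  moreover have "Suc (i - 1) = i" using m by simp
  ultimately show "w ! (i - 1) = 0"
    using height_Suc[OF balanced_w, of "i - 1"] m by (auto split: if_splits)
  have "height w j < height w (j - 1)" using k[of "j - 1"] m by simp
  moreover have "Suc (j - 1) = j" using m by simp
  ultimately show "w ! (j - 1) = 1"
    using height_Suc[OF balanced_w, of "j - 1"] balanced_letter[OF balanced_w, of "j - 1"] m by (auto split: if_splits)
qed

lemma matched_right_unique: "matched w i j \<Longrightarrow> matched w i j' \<Longrightarrow> j = j'"
  unfolding matched_def by (metis less_irrefl less_or_eq_imp_le linorder_neqE_nat)

lemma matched_left_unique:
  assumes "matched w i j" "matched w i' j" shows "i = i'"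
proof (rule ccontr)
  assume "i \<noteq> i'"
  moreover have False if "matched w a j" "matched w b j" "a < b" for a b
  proof -
    have "a \<le> b - 1" "b - 1 < j" using that by (auto simp: matched_def)
    then have "height w j < height w (b - 1)" using that(1) by (auto simp: matched_def)
    then show False using that(2) by (simp add: matched_def)
  qed
  ultimately show False using assms by (meson linorder_neqE_nat)
qed

lemma matched_not_both: "matched w i j \<Longrightarrow> \<not> matched w j l"
  using matched_letters by fastforce

text \<open>The partner of an opening bracket is the first later position at which the height has come down
  far enough; that of a closing bracket is found with the last earlier position. Heights change in
  steps of one, so the required values are attained.\<close>

lemma matched_exists:
  assumes "1 \<le> k" "k \<le> 2 * n"
  shows "\<exists>l. matched w k l \<or> matched w l k"
proof -
  have kk: "Suc (k - 1) = k" "k - 1 < 2 * n" using assms by auto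
  show ?thesis
  proof (cases "w ! (k - 1) = 0")
    case True
    then have up: "height w k = height w (k - 1) + 1" using height_Suc[OF balanced_w kk(2)] kk by simp
    define P where "P j \<longleftrightarrow> k < j \<and> height w j \<le> height w (k - 1)" for j
    have z: "height w (2 * n) = 0" using balanced_w by (rule height_end)
    have "0 \<le> height w (k - 1)" using w kk by (intro height_nonneg[of _ n]) auto
    then have "k \<noteq> 2 * n" using z up by auto
    then have "P (2 * n)" using z \<open>0 \<le> _\<close> assms by (auto simp: P_def)
    define j where "j = (LEAST j. P j)"
    have j: "P j" "j \<le> 2 * n" using \<open>P (2 * n)\<close> by (auto simp: j_def intro: LeastI Least_le)
    have before: "height w (k - 1) < height w i" if "k \<le> i" "i < j" for i
    proof (cases "i = k")
      case False
      then have "\<not> P i" using that not_less_Least j_def by blast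
      then show ?thesis using that False by (auto simp: P_def)
    qed (use up in simp)
    have "height w j \<ge> height w (j - 1) - 1"
      using height_Suc[OF balanced_w, of "j - 1"] j by (cases j) (auto simp: P_def split: if_splits)
    moreover have "height w (k - 1) < height w (j - 1)" using before[of "j - 1"] j by (auto simp: P_def)
    ultimately have "height w j = height w (k - 1)" using j by (auto simp: P_def)
    then have "matched w k j" using before j assms by (auto simp: matched_def P_def length_w)
    then show ?thesis by blast
  next
    case False
    then have down: "height w k = height w (k - 1) - 1" using height_Suc[OF balanced_w kk(2)] kk by simp
    define P where "P m \<longleftrightarrow> m < k \<and> height w m \<le> height w k" for m
    have "P 0" using assms height_nonneg[OF w, of k] by (auto simp: P_def)
    define m where "m = (GREATEST m. P m)"
    have b: "\<And>x. P x \<Longrightarrow> x \<le> k" by (auto simp: P_def)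
    have m: "P m" using GreatestI_nat[of P 0 k] \<open>P 0\<close> b by (simp add: m_def)
    have after: "height w k < height w i" if "m < i" "i < k" for i
    proof -
      have "\<not> P i" using Greatest_le_nat[of P i k] b that(1) by (auto simp: m_def)
      then show ?thesis using that by (auto simp: P_def)
    qed
    have "m \<noteq> k - 1" using m down by (auto simp: P_def)
    then have mk: "Suc m < k" using m by (auto simp: P_def)
    have "height w (Suc m) \<le> height w m + 1" using height_Suc[OF balanced_w, of m] mk assms by auto
    moreover have "height w k < height w (Suc m)" using after[of "Suc m"] mk by simp
    ultimately have "height w m = height w k" using m by (auto simp: P_def)
    then have "matched w (Suc m) k" using after mk assms by (auto simp: matched_def length_w)
    then show ?thesis by blast
  qed
qed

lemma matching_is_link_pattern: "is_link_pattern_of n w {{i, j} | i j. matched w i j}"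
proof -
  let ?M = "{{i, j} | i j. matched w i j}"
  have "\<Union> ?M = {1..2 * n}"
  proof
    show "\<Union> ?M \<subseteq> {1..2 * n}" by (auto simp: matched_def length_w)
    show "{1..2 * n} \<subseteq> \<Union> ?M"
    proof
      fix k assume "k \<in> {1..2 * n}"
      then obtain l where "matched w k l \<or> matched w l k" using matched_exists[of k] by auto
      then show "k \<in> \<Union> ?M" by blast
    qed
  qed
  moreover have "disjoint ?M"
  proof (rule disjointI)
    fix a b assume "a \<in> ?M" "b \<in> ?M" "a \<noteq> b"
    then obtain i j k l where "a = {i, j}" "b = {k, l}" "matched w i j" "matched w k l"
      "{i, j} \<noteq> {k, l}" by blast
    then have m: "a = {i, j}" "b = {k, l}" "matched w i j" "matched w k l" "{i, j} \<noteq> {k, l}"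
      by blast+
    then have "i \<noteq> k" "j \<noteq> l" "i \<noteq> l" "j \<noteq> k"
      using matched_right_unique[of i j l] matched_left_unique[of i j k]
        matched_not_both[of k i j] matched_not_both[of i j l] by auto
    then show "a \<inter> b = {}" unfolding m(1,2) by simp
  qed
  ultimately have 1: "partition_on {1..2 * n} ?M"
    unfolding partition_on_def by blast
  have le: "matched w i j" if "{i, j} \<in> ?M" "i < j" for i j
    using that by (auto simp: doubleton_eq_iff matched_def)
  have 2: "card b = 2" if "b \<in> ?M" for b
    using that by (auto simp: matched_def)
  have 3: "\<not> ({i, j} \<in> ?M \<and> {k, l} \<in> ?M)" if "i < k \<and> k < j \<and> j < l" for i k j l
  proof
    assume a: "{i, j} \<in> ?M \<and> {k, l} \<in> ?M"
    have m: "matched w i j" "matched w k l"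
      using le[OF conjunct1[OF a]] le[OF conjunct2[OF a]] that by simp_all
    have "height w j < height w (k - 1)" using m(1) that by (auto simp: matched_def)
    moreover have "height w l < height w j" using m(2) that by (auto simp: matched_def)
    ultimately show False using m(2) by (auto simp: matched_def)
  qed
  have 4: "w ! (i - 1) = 0 \<and> w ! (j - 1) = 1" if "i < j \<and> {i, j} \<in> ?M" for i j
    using matched_letters[OF le[OF conjunct2[OF that] conjunct1[OF that]]] by blast
  show ?thesis
    unfolding is_link_pattern_of_def by (intro conjI allI impI ballI) (fact 1 2 3 4[THEN conjunct1] 4[THEN conjunct2])+
qed

text \<open>The positions strictly between \<open>i\<close> and \<open>j\<close> are paired among themselves, and these pairs have the
  property by induction. Walking through them from the left shows that the height never drops below
  its value at \<open>i\<close>, walking from the right that it never drops below its value at \<open>j - 1\<close>. So these two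
  values agree.\<close>

lemma link_pattern_matched:
  assumes M: "is_link_pattern_of n w M"
  shows "{i, j} \<in> M \<Longrightarrow> i < j \<Longrightarrow> matched w i j"
proof (induction "j - i" arbitrary: i j rule: less_induct)
  case less
  have part: "partition_on {1..2 * n} M" and c2: "\<And>b. b \<in> M \<Longrightarrow> card b = 2"
    and cross: "\<And>i k j l. i < k \<Longrightarrow> k < j \<Longrightarrow> j < l \<Longrightarrow> {i, j} \<in> M \<Longrightarrow> {k, l} \<in> M \<Longrightarrow> False"
    and letters: "\<And>i j. i < j \<Longrightarrow> {i, j} \<in> M \<Longrightarrow> w ! (i - 1) = 0 \<and> w ! (j - 1) = 1"
    using M unfolding is_link_pattern_of_def by blast+
  note outer = less.hyps
  have ij: "1 \<le> i" "i < j" "j \<le> 2 * n"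
    using less.prems part unfolding partition_on_def by fastforce+
  have step: "height w (Suc k) = height w k + (if w ! k = 0 then 1 else -1)" if "k < j" for k
    using height_Suc[OF balanced_w, of k] that ij by simp
  have inside: "\<exists>l. i < l \<and> l < j \<and> l \<noteq> k \<and> {k, l} \<in> M" if k: "i < k" "k < j" for k
  proof -
    have "k \<in> \<Union> M" using part k ij by (auto simp: partition_on_def)
    then obtain b where b: "b \<in> M" "k \<in> b" by blast
    obtain x y where "b = {x, y}" "x \<noteq> y" using c2[OF b(1)] by (auto simp: card_2_iff)
    then obtain l where l: "b = {k, l}" "l \<noteq> k" using b(2) by (metis insertE insert_commute singletonD)
    have "b \<inter> {i, j} = {}"
      using part b less.prems(1) k unfolding partition_on_def disjoint_def
      by (metis insertE singletonD less_irrefl)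
    then have "l \<noteq> i" "l \<noteq> j" using l by auto
    moreover have "\<not> l < i" using cross[of l i k j] k b less.prems(1) l by (auto simp: insert_commute)
    moreover have "\<not> j < l" using cross[of i k j l] k b less.prems(1) l by auto
    ultimately show ?thesis using l b by (intro exI[of _ l]) auto
  qed
  have low: "i \<le> k \<Longrightarrow> k < j \<Longrightarrow> height w i \<le> height w k" for k
  proof (induction k rule: less_induct)
    case (less k')
    show ?case
    proof (cases "k' = i")
      case False
      then have k': "i < k'" "k' < j" using less.prems by auto
      obtain l where l: "i < l" "l < j" "l \<noteq> k'" "{k', l} \<in> M" using inside[OF k'] by blast
      show ?thesis
      proof (cases "l < k'")
        case True
        have "matched w l k'"
          using outer[of k' l] True l k' by (simp add: insert_commute)
        then have "height w k' = height w (l - 1)" by (simp add: matched_def)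
        then show ?thesis using less.IH[of "l - 1"] True l k' by auto
      next
        case False
        then have "w ! (k' - 1) = 0" using letters[of k' l] l by auto
        then have "height w k' = height w (k' - 1) + 1" using step[of "k' - 1"] k' by auto
        moreover have "height w i \<le> height w (k' - 1)" using less.IH[of "k' - 1"] k' by linarith
        ultimately show ?thesis by linarith
      qed
    qed simp
  qed
  have high: "i \<le> k \<Longrightarrow> k < j \<Longrightarrow> height w (j - 1) \<le> height w k" for k
  proof (induction "j - k" arbitrary: k rule: less_induct)
    case (less k')
    show ?case
    proof (cases "Suc k' = j")
      case False
      then have k': "i < Suc k'" "Suc k' < j" using less.prems by auto
      obtain l where l: "i < l" "l < j" "l \<noteq> Suc k'" "{Suc k', l} \<in> M" using inside[OF k'] by blast
      show ?thesis
      proof (cases "l < Suc k'")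
        case True
        then have "w ! k' = 1" using letters[of l "Suc k'"] l by (simp add: insert_commute)
        then have "height w (Suc k') = height w k' - 1" using step[of k'] k' by auto
        moreover have "j - Suc k' < j - k'" using k' by linarith
        ultimately show ?thesis using less.hyps[of "Suc k'"] k' by linarith
      next
        case False
        have "matched w (Suc k') l"
          using outer[of l "Suc k'"] False l k' by simp
        then have "height w k' = height w l" by (simp add: matched_def)
        moreover have "j - l < j - k'" using False l k' by linarith
        ultimately show ?thesis using less.hyps[of l] l by linarith
      qed
    qed auto
  qed
  have up: "height w i = height w (i - 1) + 1"
    using step[of "i - 1"] letters[OF ij(2) less.prems(1)] ij by simp
  have down: "height w j = height w (j - 1) - 1"
    using step[of "j - 1"] letters[OF ij(2) less.prems(1)] ij by simp
  have "height w i = height w (j - 1)" using low[of "j - 1"] high[of i] ij by auto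
  then have eq: "height w (i - 1) = height w j" using up down by simp
  have "height w j < height w k" if "i \<le> k" "k < j" for k
    using low[OF that] up eq by simp
  then show ?case using ij eq by (simp add: matched_def length_w)
qed

text \<open>Existence and uniqueness of the link pattern, which make the definite description meaningful.\<close>

theorem link_pattern_eq: "link_pattern n w = {{i, j} | i j. matched w i j}" (is "_ = ?M")
proof -
  have "M = ?M" if M: "is_link_pattern_of n w M" for M
  proof
    have c2: "card b = 2" if "b \<in> M" for b using M that by (simp add: is_link_pattern_of_def)
    show sub: "M \<subseteq> ?M"
    proof
      fix b assume b: "b \<in> M"
      then obtain x y where xy: "b = {x, y}" "x \<noteq> y" using c2[OF b] by (auto simp: card_2_iff)
      then have "b = {min x y, max x y}" "min x y < max x y" by (auto simp: min_def max_def)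
      then show "b \<in> ?M" using link_pattern_matched[OF M] b by (metis (mono_tags, lifting) mem_Collect_eq)
    qed
    show "?M \<subseteq> M"
    proof
      fix a assume a: "a \<in> ?M"
      have P: "partition_on {1..2 * n} M" "partition_on {1..2 * n} ?M"
        using M matching_is_link_pattern by (auto simp: is_link_pattern_of_def)
      obtain x where x: "x \<in> a" using a by blast
      then have "x \<in> \<Union> M"
        using UnionI[OF a x] partition_onD1[OF P(1)] partition_onD1[OF P(2)] by simp
      then obtain b where b: "b \<in> M" "x \<in> b" by blast
      have "b \<in> ?M" by (rule subsetD[OF sub b(1)])
      then have "a = b"
        using disjointD[OF partition_onD2[OF P(2)] a, of b] x b(2) by blast
      then show "a \<in> M" using b by simp
    qed
  qed
  then show ?thesis
    unfolding link_pattern_def by (intro the_equality matching_is_link_pattern)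
qed

end

section \<open>Puzzles as flows\<close>

definition flow_graph :: "nat \<Rightarrow> (nat \<Rightarrow> nat \<Rightarrow> int) \<Rightarrow> (nat \<Rightarrow> nat \<Rightarrow> int) \<Rightarrow> point set set" where
  "flow_graph n v h =
     {vedge_below (int x, int y) | x y. tri n x y \<and> v x y \<noteq> 0} \<union>
     {hedge_right (int x - 1, int y) | x y. tri n x y \<and> y < x \<and> h x y \<noteq> 0}"

definition bottom_label :: "int \<Rightarrow> nat" where
  "bottom_label a = (if a = 1 then 0 else if a = -1 then 1 else 2)"
definition left_label :: "int \<Rightarrow> nat" where
  "left_label a = (if a = 1 then 1 else if a = -1 then 2 else 0)"
definition right_label :: "int \<Rightarrow> nat" where
  "right_label a = (if a = 1 then 0 else if a = -1 then 2 else 1)"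

text \<open>The dictionary between puzzles and flows. Ghost edges are included: they are given by the labels on
  the left and right sides of the big triangle.\<close>

definition encodes :: "nat \<Rightarrow> (unit_edge \<Rightarrow> nat) \<Rightarrow> (nat \<Rightarrow> nat \<Rightarrow> int) \<Rightarrow> (nat \<Rightarrow> nat \<Rightarrow> int) \<Rightarrow> bool" where
  "encodes n P v h \<longleftrightarrow>
     (\<forall>j k. j + k < 2 * n \<longrightarrow> P (BottomU j k) = bottom_label (v (j + 2 * k) j) \<and>
        P (LeftU j k) = left_label (h (j + 2 * k) j) \<and>
        P (RightU j k) = right_label (h (j + 2 * k + 1) j) \<and>
        v (j + 2 * k) j \<in> {-1, 0, 1} \<and> h (j + 2 * k) j \<in> {-1, 0, 1} \<and>
        h (j + 2 * k + 1) j \<in> {-1, 0, 1}) \<and>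
     (\<forall>x y. odd (x + y) \<longrightarrow> v x y = 0)"

lemma up_piece:
  assumes "s \<in> {-1, 0, 1}" "l \<in> {-1, 0, 1}" "r \<in> {-1, 0, 1}"
  shows "puzzle_piece (left_label l) (bottom_label s) (right_label r) \<longleftrightarrow>
    vertex_ok s 0 l r \<and> excess True s 0 l r = 0"
  using assms
  by (auto simp: puzzle_piece_def left_label_def bottom_label_def right_label_def vertex_ok_def
      excess_def Let_def)

lemma down_piece:
  assumes "n \<in> {-1, 0, 1}" "l \<in> {-1, 0, 1}" "r \<in> {-1, 0, 1}"
  shows "puzzle_piece (bottom_label n) (right_label l) (left_label r) \<longleftrightarrow>
    vertex_ok 0 n l r \<and> excess False 0 n l r = 0"
  using assms
  by (auto simp: puzzle_piece_def left_label_def bottom_label_def right_label_def vertex_ok_def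
      excess_def Let_def)

lemma tri_cases:
  assumes "tri n x y"
  obtains (A) j k where "x = j + 2 * k" "y = j" "j + k < 2 * n"
  | (B) j k where "x = j + 2 * k + 1" "y = j" "j + k + 1 < 2 * n"
proof (cases "even (x - y)")
  case True
  then obtain k where "x - y = 2 * k" by blast
  then show thesis using A[of y k] assms by (auto simp: tri_def)
next
  case False
  then obtain k where "x - y = 2 * k + 1" by (rule oddE)
  then show thesis using B[of y k] assms by (auto simp: tri_def)
qed

lemma Phi_encodes:
  assumes e: "encodes n P v h"
  shows "Phi n P = flow_graph n v h"
proof -
  have l: "bottom_label a \<in> {0, 1} \<longleftrightarrow> a \<noteq> 0" "left_label a \<in> {1, 2} \<longleftrightarrow> a \<noteq> 0"
    "right_label a \<in> {0, 2} \<longleftrightarrow> a \<noteq> 0" if "a \<in> {-1, 0, 1}" for a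
    using that by (auto simp: bottom_label_def left_label_def right_label_def)
  have lab: "P (BottomU j k) \<in> {0, 1} \<longleftrightarrow> v (j + 2 * k) j \<noteq> 0"
    "P (LeftU j k) \<in> {1, 2} \<longleftrightarrow> h (j + 2 * k) j \<noteq> 0"
    "P (RightU j k) \<in> {0, 2} \<longleftrightarrow> h (j + 2 * k + 1) j \<noteq> 0" if "j + k < 2 * n" for j k
    using e that l unfolding encodes_def by metis+
  have odd: "v x y = 0" if "odd (x + y)" for x y using e that unfolding encodes_def by blast
  have 1: "{vedge_below (int j + 2 * int k, int j) | j k.
        (j, k) \<in> up_triangles n \<and> P (BottomU j k) \<in> {0, 1}}
      = {vedge_below (int x, int y) | x y. tri n x y \<and> v x y \<noteq> 0}" (is "?L = ?R")
  proof
    show "?L \<subseteq> ?R"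
    proof
      fix e assume "e \<in> ?L"
      then obtain j k where "e = vedge_below (int j + 2 * int k, int j)" "j + k < 2 * n"
        "v (j + 2 * k) j \<noteq> 0" using lab by (auto simp: up_triangles_def)
      then show "e \<in> ?R" by (intro CollectI exI[of _ "j + 2 * k"] exI[of _ j]) (auto simp: tri_def)
    qed
    show "?R \<subseteq> ?L"
    proof
      fix e assume "e \<in> ?R"
      then obtain x y where e: "e = vedge_below (int x, int y)" "tri n x y" "v x y \<noteq> 0" by blast
      from e(2) show "e \<in> ?L"
      proof (cases rule: tri_cases)
        case (A j k)
        then show ?thesis using e lab(1)[of j k]
          by (intro CollectI exI[of _ j] exI[of _ k]) (auto simp: up_triangles_def)
      next
        case (B j k)
        then show ?thesis using odd[of x y] e by simp
      qed
    qed
  qed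
  have 2: "{hedge_right (int j + 2 * int k, int j) | j k.
        (j, k) \<in> down_triangles n \<and> P (LeftD j k) \<in> {0, 2}}
     \<union> {hedge_right (int j + 2 * int k - 1, int j) | j k.
        (j, k) \<in> up_triangles n \<and> 1 \<le> k \<and> P (LeftU j k) \<in> {1, 2}}
      = {hedge_right (int x - 1, int y) | x y. tri n x y \<and> y < x \<and> h x y \<noteq> 0}" (is "?L1 \<union> ?L2 = ?R")
  proof
    have "?L1 \<subseteq> ?R"
    proof
      fix e assume "e \<in> ?L1"
      then obtain j k where e: "e = hedge_right (int j + 2 * int k, int j)"
        "(j, k) \<in> down_triangles n" "P (LeftD j k) \<in> {0, 2}" by blast
      then have "j + k + 1 < 2 * n" "h (j + 2 * k + 1) j \<noteq> 0"
        using lab(3)[of j k] by (simp_all add: down_triangles_def)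
      with e(1) show "e \<in> ?R" by (intro CollectI exI[of _ "j + 2 * k + 1"] exI[of _ j]) (auto simp: tri_def)
    qed
    moreover have "?L2 \<subseteq> ?R"
    proof
      fix e assume "e \<in> ?L2"
      then obtain j k where e: "e = hedge_right (int j + 2 * int k - 1, int j)"
        "(j, k) \<in> up_triangles n" "1 \<le> k" "P (LeftU j k) \<in> {1, 2}" by blast
      then have "j + k < 2 * n" "h (j + 2 * k) j \<noteq> 0"
        using lab(2)[of j k] by (simp_all add: up_triangles_def)
      with e(1,3) show "e \<in> ?R" by (intro CollectI exI[of _ "j + 2 * k"] exI[of _ j]) (auto simp: tri_def)
    qed
    ultimately show "?L1 \<union> ?L2 \<subseteq> ?R" by blast
    show "?R \<subseteq> ?L1 \<union> ?L2"
    proof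
      fix e assume "e \<in> ?R"
      then obtain x y where e: "e = hedge_right (int x - 1, int y)" "tri n x y" "y < x" "h x y \<noteq> 0" by blast
      from e(2) show "e \<in> ?L1 \<union> ?L2"
      proof (cases rule: tri_cases)
        case (A j k)
        then have "e \<in> ?L2" using e lab(2)[of j k]
          by (intro CollectI exI[of _ j] exI[of _ k]) (auto simp: up_triangles_def)
        then show ?thesis by blast
      next
        case (B j k)
        then have "e \<in> ?L1" using e lab(3)[of j k]
          by (intro CollectI exI[of _ j] exI[of _ k]) (auto simp: down_triangles_def)
        then show ?thesis by blast
      qed
    qed
  qed
  show ?thesis unfolding Phi_def flow_graph_def 1 Un_assoc 2 ..
qed

text \<open>The upward and downward triangles in row \<open>y\<close> are the vertices of row \<open>y\<close> in alternating order, and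
  neighbouring triangles share the edge of the flow between them.\<close>

lemma KT_iff_flow:
  assumes e: "encodes n P v h" and P: "P \<in> unit_edges n \<rightarrow>\<^sub>E {0, 1, 2}"
    and out: "\<And>x y. \<not> tri n x y \<Longrightarrow> v x y = 0"
    and w: "balanced n \<sigma>" "balanced n \<tau>" "balanced n \<pi>"
  shows "P \<in> KT n \<sigma> \<tau> \<pi> \<longleftrightarrow>
    flow n \<sigma> \<tau> \<pi> v h \<and> (\<forall>x y. tri n x y \<longrightarrow> vertex_excess v h x y = 0)"
proof -
  have lab: "P (BottomU j k) = bottom_label (v (j + 2 * k) j)"
        "P (LeftU j k) = left_label (h (j + 2 * k) j)"
        "P (RightU j k) = right_label (h (j + 2 * k + 1) j)"
        "v (j + 2 * k) j \<in> {-1, 0, 1}" "h (j + 2 * k) j \<in> {-1, 0, 1}"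
        "h (j + 2 * k + 1) j \<in> {-1, 0, 1}" if "j + k < 2 * n" for j k
    using e that unfolding encodes_def by blast+
  have odd: "v x y = 0" if "odd (x + y)" for x y using e that unfolding encodes_def by blast
  have up: "puzzle_piece (P (LeftU j k)) (P (BottomU j k)) (P (RightU j k)) \<longleftrightarrow>
      vertex_ok (v (j + 2 * k) j) (v (j + 2 * k) (Suc j)) (h (j + 2 * k) j) (h (Suc (j + 2 * k)) j) \<and>
      vertex_excess v h (j + 2 * k) j = 0" if "j + k < 2 * n" for j k
  proof -
    have "v (j + 2 * k) (Suc j) = 0" "even (j + 2 * k + j)" by (auto intro: odd)
    then show ?thesis using up_piece[OF lab(4-6)[OF that]] lab(1-3)[OF that]
      by (simp add: vertex_excess_def)
  qed
  have down: "puzzle_piece (P (TopD j k)) (P (LeftD j k)) (P (RightD j k)) \<longleftrightarrow>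
      vertex_ok (v (j + 2 * k + 1) j) (v (j + 2 * k + 1) (Suc j)) (h (j + 2 * k + 1) j) (h (Suc (j + 2 * k + 1)) j) \<and>
      vertex_excess v h (j + 2 * k + 1) j = 0" if "j + k + 1 < 2 * n" for j k
  proof -
    have z: "v (j + 2 * k + 1) j = 0" "odd (j + 2 * k + 1 + j)" by (auto intro: odd)
    have ix: "Suc j + 2 * k = j + 2 * k + 1" "j + 2 * (k + 1) = Suc (j + 2 * k + 1)" by auto
    have b: "Suc j + k < 2 * n" "j + (k + 1) < 2 * n" "j + k < 2 * n" using that by auto
    have "P (TopD j k) = bottom_label (v (j + 2 * k + 1) (Suc j))" "v (j + 2 * k + 1) (Suc j) \<in> {-1, 0, 1}"
      "P (RightD j k) = left_label (h (Suc (j + 2 * k + 1)) j)" "h (Suc (j + 2 * k + 1)) j \<in> {-1, 0, 1}"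
      using lab(1,4)[OF b(1)] lab(2,5)[OF b(2)] unfolding ix by simp_all
    then show ?thesis using down_piece[of "v (j + 2 * k + 1) (Suc j)" "h (j + 2 * k + 1) j" "h (Suc (j + 2 * k + 1)) j"]
        lab(3,6)[OF b(3)] z unfolding vertex_excess_def by simp
  qed
  let ?ok = "\<lambda>x y. vertex_ok (v x y) (v x (Suc y)) (h x y) (h (Suc x) y) \<and> vertex_excess v h x y = 0"
  have pieces: "(\<forall>(j, k) \<in> up_triangles n. puzzle_piece (P (LeftU j k)) (P (BottomU j k)) (P (RightU j k))) \<and>
     (\<forall>(j, k) \<in> down_triangles n. puzzle_piece (P (TopD j k)) (P (LeftD j k)) (P (RightD j k)))
     \<longleftrightarrow> (\<forall>x y. tri n x y \<longrightarrow> ?ok x y)" (is "?L \<longleftrightarrow> ?R")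
  proof
    assume L: ?L
    show ?R
    proof (intro allI impI)
      fix x y assume "tri n x y"
      then show "?ok x y"
      proof (cases rule: tri_cases)
        case (A j k)
        then show ?thesis using L up[of j k] by (auto simp: up_triangles_def)
      next
        case (B j k)
        then show ?thesis using L down[of j k] by (auto simp: down_triangles_def)
      qed
    qed
  next
    assume R: ?R
    have "tri n (j + 2 * k) j" if "j + k < 2 * n" for j k using that by (auto simp: tri_def)
    moreover have "tri n (j + 2 * k + 1) j" if "j + k + 1 < 2 * n" for j k using that by (auto simp: tri_def)
    ultimately show ?L using R up down unfolding up_triangles_def down_triangles_def by blast
  qed
  have bin: "w ! j \<in> {0, 1}" if "balanced n w" "j < 2 * n" for w j
    using balanced_letter[OF that] by blast
  have left: "P (LeftU j 0) = \<sigma> ! j \<longleftrightarrow> h j j = of_bool (\<sigma> ! j = 1)" if j: "j < 2 * n" for j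
    using lab(2,5)[of j 0] j bin[OF w(1) j] by (auto simp: left_label_def)
  have right: "P (RightU j (2 * n - 1 - j)) = \<tau> ! (2 * n - 1 - j) \<longleftrightarrow>
      h (4 * n - 1 - j) j = of_bool (\<tau> ! (2 * n - 1 - j) = 0)" if j: "j < 2 * n" for j
  proof -
    have "j + 2 * (2 * n - 1 - j) + 1 = 4 * n - 1 - j" using j by simp
    then show ?thesis
      using lab(3,6)[of j "2 * n - 1 - j"] j bin[OF w(2), of "2 * n - 1 - j"] by (auto simp: right_label_def)
  qed
  have bottom: "(\<forall>k < 2 * n. P (BottomU 0 k) = \<pi> ! k) \<longleftrightarrow>
    (\<forall>x. tri n x 0 \<longrightarrow> v x 0 = (if odd x then 0 else if \<pi> ! (x div 2) = 0 then 1 else -1))"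
    (is "?L \<longleftrightarrow> ?R")
  proof -
    have k: "P (BottomU 0 k) = \<pi> ! k \<longleftrightarrow> v (2 * k) 0 = (if \<pi> ! k = 0 then 1 else -1)" if "k < 2 * n" for k
      using lab(1,4)[of 0 k] that bin[OF w(3) that] by (auto simp: bottom_label_def)
    show ?thesis
    proof
      assume L: ?L
      show ?R
      proof (intro allI impI)
        fix x assume "tri n x 0"
        then show "v x 0 = (if odd x then 0 else if \<pi> ! (x div 2) = 0 then 1 else -1)"
        proof (cases rule: tri_cases)
          case (A j k) then show ?thesis using k[of k] L by auto
        next
          case (B j k) then show ?thesis using odd[of x 0] by auto
        qed
      qed
    next
      assume R: ?R
      show ?L
      proof (intro allI impI)
        fix k' assume "k' < 2 * n"
        then show "P (BottomU 0 k') = \<pi> ! k'" using k[of k'] R[rule_format, of "2 * k'"] by (auto simp: tri_def)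
      qed
    qed
  qed
  have K: "P \<in> KT n \<sigma> \<tau> \<pi> \<longleftrightarrow> (\<forall>j < 2 * n. h j j = of_bool (\<sigma> ! j = 1)) \<and>
     (\<forall>j < 2 * n. h (4 * n - 1 - j) j = of_bool (\<tau> ! (2 * n - 1 - j) = 0)) \<and>
     (\<forall>k < 2 * n. P (BottomU 0 k) = \<pi> ! k) \<and>
     (\<forall>x y. tri n x y \<longrightarrow> ?ok x y)"
    unfolding KT_def mem_Collect_eq pieces[symmetric] using P left right by auto
  show ?thesis
    unfolding K bottom flow_def using out by auto
qed

definition puzzle_of :: "nat \<Rightarrow> (nat \<Rightarrow> nat \<Rightarrow> int) \<Rightarrow> (nat \<Rightarrow> nat \<Rightarrow> int) \<Rightarrow> unit_edge \<Rightarrow> nat" where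
  "puzzle_of n v h = restrict (\<lambda>e. case e of
     BottomU j k \<Rightarrow> bottom_label (v (j + 2 * k) j)
   | LeftU j k \<Rightarrow> left_label (h (j + 2 * k) j)
   | RightU j k \<Rightarrow> right_label (h (j + 2 * k + 1) j)) (unit_edges n)"

lemma unit_edges_iff [simp]:
  "BottomU j k \<in> unit_edges n \<longleftrightarrow> j + k < 2 * n"
  "LeftU j k \<in> unit_edges n \<longleftrightarrow> j + k < 2 * n"
  "RightU j k \<in> unit_edges n \<longleftrightarrow> j + k < 2 * n"
  by (auto simp: unit_edges_def up_triangles_def)

theorem flow_to_puzzle:
  assumes f: "flow n \<sigma> \<tau> \<pi> v h" and ex: "\<And>x y. tri n x y \<Longrightarrow> vertex_excess v h x y = 0"
    and w: "balanced n \<sigma>" "balanced n \<tau>" "balanced n \<pi>"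
  shows "puzzle_of n v h \<in> KT n \<sigma> \<tau> \<pi> \<and> Phi n (puzzle_of n v h) = flow_graph n v h"
proof -
  have ok: "vertex_ok (v x y) (v x (Suc y)) (h x y) (h (Suc x) y)" if "tri n x y" for x y
    using f that by (simp add: flow_def)
  have out: "v x y = 0" if "\<not> tri n x y" for x y using f that by (simp add: flow_def)
  have odd: "v x y = 0" if "odd (x + y)" for x y
  proof (cases "tri n x y")
    case True
    have "\<bar>v x y\<bar> \<le> vertex_excess v h x y"
      using that unfolding vertex_excess_def excess_def Let_def by auto
    then show ?thesis using ex[OF True] by linarith
  qed (rule out)
  have rng: "v (j + 2 * k) j \<in> {-1, 0, 1}" "h (j + 2 * k) j \<in> {-1, 0, 1}" "h (j + 2 * k + 1) j \<in> {-1, 0, 1}"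
    if "j + k < 2 * n" for j k
    using ok[of "j + 2 * k" j] that by (auto simp: vertex_ok_def tri_def)
  have e: "encodes n (puzzle_of n v h) v h"
    unfolding encodes_def using rng odd by (auto simp: puzzle_of_def)
  have P: "puzzle_of n v h \<in> unit_edges n \<rightarrow>\<^sub>E {0, 1, 2}"
    by (auto simp: puzzle_of_def bottom_label_def left_label_def right_label_def split: unit_edge.splits)
  show ?thesis
    using KT_iff_flow[OF e P out w] Phi_encodes[OF e] f ex by blast
qed

definition puzzle_vert :: "nat \<Rightarrow> (unit_edge \<Rightarrow> nat) \<Rightarrow> nat \<Rightarrow> nat \<Rightarrow> int" where
  "puzzle_vert n P x y = (if tri n x y \<and> even (x + y) then
     (let a = P (BottomU y ((x - y) div 2)) in if a = 0 then 1 else if a = 1 then -1 else 0) else 0)"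

definition puzzle_hor :: "(unit_edge \<Rightarrow> nat) \<Rightarrow> nat \<Rightarrow> nat \<Rightarrow> int" where
  "puzzle_hor P x y = (if even (x + y)
     then (let a = P (LeftU y ((x - y) div 2)) in if a = 1 then 1 else if a = 2 then -1 else 0)
     else (let a = P (RightU y ((x - y) div 2)) in if a = 0 then 1 else if a = 2 then -1 else 0))"

theorem puzzle_to_flow:
  assumes K: "P \<in> KT n \<sigma> \<tau> \<pi>"
    and w: "balanced n \<sigma>" "balanced n \<tau>" "balanced n \<pi>"
  shows "encodes n P (puzzle_vert n P) (puzzle_hor P)"
    and "flow n \<sigma> \<tau> \<pi> (puzzle_vert n P) (puzzle_hor P)"
    and "tri n x y \<Longrightarrow> vertex_excess (puzzle_vert n P) (puzzle_hor P) x y = 0"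
proof -
  have P: "P \<in> unit_edges n \<rightarrow>\<^sub>E {0, 1, 2}" using K by (simp add: KT_def)
  have r: "P (BottomU j k) \<in> {0, 1, 2}" "P (LeftU j k) \<in> {0, 1, 2}" "P (RightU j k) \<in> {0, 1, 2}"
    if "j + k < 2 * n" for j k
    using PiE_mem[OF P, of "BottomU j k"] PiE_mem[OF P, of "LeftU j k"] PiE_mem[OF P, of "RightU j k"]
      that by simp_all
  have t: "tri n (j + 2 * k) j" if "j + k < 2 * n" for j k using that by (auto simp: tri_def)
  show e: "encodes n P (puzzle_vert n P) (puzzle_hor P)"
    unfolding encodes_def
  proof (intro conjI allI impI)
    fix j k assume jk: "j + k < 2 * n"
    show "P (BottomU j k) = bottom_label (puzzle_vert n P (j + 2 * k) j)"
      "P (LeftU j k) = left_label (puzzle_hor P (j + 2 * k) j)"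
      "P (RightU j k) = right_label (puzzle_hor P (j + 2 * k + 1) j)"
      "puzzle_vert n P (j + 2 * k) j \<in> {-1, 0, 1}"
      "puzzle_hor P (j + 2 * k) j \<in> {-1, 0, 1}" "puzzle_hor P (j + 2 * k + 1) j \<in> {-1, 0, 1}"
      using r[OF jk] t[OF jk]
      by (auto simp: puzzle_vert_def puzzle_hor_def Let_def bottom_label_def left_label_def right_label_def)
  next
    fix x y :: nat assume "odd (x + y)"
    then show "puzzle_vert n P x y = 0" by (simp add: puzzle_vert_def)
  qed
  have "puzzle_vert n P x y = 0" if "\<not> tri n x y" for x y using that by (simp add: puzzle_vert_def)
  from KT_iff_flow[OF e P this w] K
  show "flow n \<sigma> \<tau> \<pi> (puzzle_vert n P) (puzzle_hor P)"
    "tri n x y \<Longrightarrow> vertex_excess (puzzle_vert n P) (puzzle_hor P) x y = 0" by blast+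
qed

section \<open>Graphs on the triangle as relations\<close>

definition edge_rel :: "point set set \<Rightarrow> (point \<times> point) set" where
  "edge_rel G = {(p, q). {p, q} \<in> G \<and> p \<noteq> q}"

definition nbrs :: "point \<Rightarrow> point set" where
  "nbrs p = {(fst p, snd p - 1), (fst p, snd p + 1), (fst p - 1, snd p), (fst p + 1, snd p)}"

definition box :: "nat \<Rightarrow> point set" where
  "box n = {-1..4 * int n} \<times> {-1..4 * int n}"

lemma triangle_edges_cases:
  assumes "e \<in> triangle_edges n"
  obtains p q where "e = {p, q}" "q \<in> nbrs p" "p \<in> nbrs q" "p \<noteq> q" "p \<in> box n" "q \<in> box n"
proof -
  consider x y x' y' where "e = {(x, y), (x', y')}" "(x, y) \<in> triangle n" "(x', y') \<in> triangle n"
      "\<bar>x - x'\<bar> + \<bar>y - y'\<bar> = 1"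
    | i where "i \<in> {1..2 * n}" "e = external_edge i"
    using assms unfolding triangle_edges_def by blast
  then show thesis
  proof cases
    case 1
    then have "x' = x \<and> y' = y - 1 \<or> x' = x \<and> y' = y + 1 \<or> x' = x - 1 \<and> y' = y \<or> x' = x + 1 \<and> y' = y"
      by linarith
    then show thesis using 1 that[of "(x, y)" "(x', y')"]
      by (auto simp: nbrs_def box_def triangle_def)
  next
    case 2
    then show thesis using that[of "(2 * int i - 2, -1)" "(2 * int i - 2, 0)"]
      by (auto simp: nbrs_def box_def external_edge_def vedge_below_def)
  qed
qed

lemma edge_rel_triangle:
  assumes "G \<subseteq> triangle_edges n" "(p, q) \<in> edge_rel G"
  shows "q \<in> nbrs p" "p \<in> box n" "q \<in> box n"
proof -
  have "{p, q} \<in> triangle_edges n" using assms by (auto simp: edge_rel_def)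
  then obtain p' q' where "{p, q} = {p', q'}" "q' \<in> nbrs p'" "p' \<in> nbrs q'" "p' \<in> box n" "q' \<in> box n"
    by (rule triangle_edges_cases)
  then show "q \<in> nbrs p" "p \<in> box n" "q \<in> box n" by (auto simp: doubleton_eq_iff)
qed

lemma vertex_degree_card:
  assumes "G \<subseteq> triangle_edges n"
  shows "vertex_degree G p = card (edge_rel G `` {p})"
proof -
  have "{e \<in> G. p \<in> e} = (\<lambda>q. {p, q}) ` (edge_rel G `` {p})"
  proof
    show "{e \<in> G. p \<in> e} \<subseteq> (\<lambda>q. {p, q}) ` (edge_rel G `` {p})"
    proof
      fix e assume e: "e \<in> {e \<in> G. p \<in> e}"
      then have "e \<in> triangle_edges n" using assms by blast
      then obtain a b where "e = {a, b}" "a \<noteq> b" by (rule triangle_edges_cases)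
      then have "e = {p, if p = a then b else a}" "p \<noteq> (if p = a then b else a)" using e by auto
      then obtain q where "e = {p, q}" "p \<noteq> q" by blast
      then show "e \<in> (\<lambda>q. {p, q}) ` (edge_rel G `` {p})" using e by (auto simp: edge_rel_def)
    qed
  qed (auto simp: edge_rel_def)
  moreover have "inj_on (\<lambda>q. {p, q}) (edge_rel G `` {p})"
    by (auto simp: inj_on_def doubleton_eq_iff)
  ultimately show ?thesis unfolding vertex_degree_def by (simp add: card_image)
qed

lemma edge_rel_card4:
  assumes "G \<subseteq> triangle_edges n"
  shows "finite (edge_rel G `` {p})"
    "card (edge_rel G `` {p}) = of_bool ((p, (fst p, snd p - 1)) \<in> edge_rel G) +
      of_bool ((p, (fst p, snd p + 1)) \<in> edge_rel G) + of_bool ((p, (fst p - 1, snd p)) \<in> edge_rel G)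
      + of_bool ((p, (fst p + 1, snd p)) \<in> edge_rel G)"
proof -
  have fn: "finite (nbrs p)" by (simp add: nbrs_def)
  have s: "edge_rel G `` {p} = nbrs p \<inter> {q. (p, q) \<in> edge_rel G}"
    using edge_rel_triangle(1)[OF assms] by blast
  then show f: "finite (edge_rel G `` {p})" using fn by simp
  have "card (edge_rel G `` {p}) = (\<Sum>q\<in>nbrs p. of_bool ((p, q) \<in> edge_rel G))"
    unfolding s by (simp add: fn)
  also have "\<dots> = of_bool ((p, (fst p, snd p - 1)) \<in> edge_rel G) +
      of_bool ((p, (fst p, snd p + 1)) \<in> edge_rel G) + of_bool ((p, (fst p - 1, snd p)) \<in> edge_rel G)
      + of_bool ((p, (fst p + 1, snd p)) \<in> edge_rel G)"
    unfolding nbrs_def by (simp add: prod_eq_iff del: sum_of_bool_eq)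
  finally show "card (edge_rel G `` {p}) = \<dots>" .
qed

lemma degree2_edge_rel:
  assumes G: "G \<subseteq> triangle_edges n" and deg: "\<And>p. card (edge_rel G `` {p}) \<le> 2"
  shows "degree2 (edge_rel G)"
proof
  have "edge_rel G \<subseteq> box n \<times> box n" using edge_rel_triangle[OF G] by auto
  then show "finite (edge_rel G)" by (rule finite_subset) (simp add: box_def)
  show "(w, u) \<in> edge_rel G" if "(u, w) \<in> edge_rel G" for u w
    using that by (auto simp: edge_rel_def insert_commute)
  show "(u, u) \<notin> edge_rel G" for u by (simp add: edge_rel_def)
  fix w a b c assume *: "(w, a) \<in> edge_rel G" "(w, b) \<in> edge_rel G" "(w, c) \<in> edge_rel G"
  show "a = b \<or> b = c \<or> a = c"
  proof (rule ccontr)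
    assume "\<not> ?thesis"
    then have "card {a, b, c} = 3" by simp
    moreover have "card {a, b, c} \<le> card (edge_rel G `` {w})"
      using * by (intro card_mono edge_rel_card4(1)[OF G]) auto
    ultimately show False using deg[of w] by simp
  qed
qed

lemma end_of_card:
  assumes G: "G \<subseteq> triangle_edges n" and "(p, q) \<in> edge_rel G"
  shows "end_of (edge_rel G) p \<longleftrightarrow> vertex_degree G p = 1"
proof
  assume "end_of (edge_rel G) p"
  then have "edge_rel G `` {p} = {q}" using assms(2) unfolding end_of_def by blast
  then show "vertex_degree G p = 1" by (simp add: vertex_degree_card[OF G])
next
  assume "vertex_degree G p = 1"
  then obtain r where "edge_rel G `` {p} = {r}"
    unfolding vertex_degree_card[OF G] by (auto simp: card_1_singleton_iff)
  then show "end_of (edge_rel G) p" unfolding end_of_def by (metis Image_singleton_iff singletonD)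
qed

lemma graph_path_epath:
  "2 \<le> length p \<Longrightarrow> graph_path G p \<longleftrightarrow> epath (edge_rel G) p"
  by (auto simp: graph_path_def epath_def edge_rel_def successively_conv_nth nth_eq_iff_index_eq)

lemma tri_triangle: "(int x, int y) \<in> triangle n \<longleftrightarrow> tri n x y"
  by (auto simp: triangle_def tri_def)

lemma vert_edge_iff:
  "{(a, b - 1), (a, b)} \<in> flow_graph n v h \<longleftrightarrow> (\<exists>x y. a = int x \<and> b = int y \<and> tri n x y \<and> v x y \<noteq> 0)"
  by (auto simp: flow_graph_def vedge_below_def hedge_right_def doubleton_eq_iff)

lemma hor_edge_iff:
  "{(a - 1, b), (a, b)} \<in> flow_graph n v h \<longleftrightarrow>
     (\<exists>x y. a = int x \<and> b = int y \<and> tri n x y \<and> y < x \<and> h x y \<noteq> 0)"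
  by (auto simp: flow_graph_def vedge_below_def hedge_right_def doubleton_eq_iff)

lemma flow_graph_nbr: "{p, q} \<in> flow_graph n v h \<Longrightarrow> q \<in> nbrs p"
  by (auto simp: flow_graph_def vedge_below_def hedge_right_def doubleton_eq_iff nbrs_def)

lemma vedge_flow_graph: "vedge_below (int x, int y) \<in> flow_graph n v h \<longleftrightarrow> tri n x y \<and> v x y \<noteq> 0"
  using vert_edge_iff[of "int x" "int y" n v h] by (auto simp: vedge_below_def)

lemma hedge_flow_graph:
  "hedge_right (int x - 1, int y) \<in> flow_graph n v h \<longleftrightarrow> tri n x y \<and> y < x \<and> h x y \<noteq> 0"
  using hor_edge_iff[of "int x" "int y" n v h] by (auto simp: hedge_right_def)

text \<open>All edges of the triangle form the graph of a suitable pair of arrays, so that the membership rules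
  for \<open>flow_graph\<close> apply to them as well.\<close>

lemma triangle_edges_eq:
  "triangle_edges n = flow_graph n (\<lambda>x y. of_bool (y = 0 \<longrightarrow> even x)) (\<lambda>_ _. 1)" (is "_ = ?G")
proof
  show "triangle_edges n \<subseteq> ?G"
  proof
    fix e assume "e \<in> triangle_edges n"
    then consider a b a' b' where "e = {(a, b), (a', b')}" "(a, b) \<in> triangle n" "(a', b') \<in> triangle n"
        "\<bar>a - a'\<bar> + \<bar>b - b'\<bar> = 1"
      | i where "i \<in> {1..2 * n}" "e = external_edge i"
      unfolding triangle_edges_def by blast
    then show "e \<in> ?G"
    proof cases
      case 1
      have V: "{(a, b - 1), (a, b)} \<in> ?G" if "(a, b - 1) \<in> triangle n" "(a, b) \<in> triangle n" for a b
      proof -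
        have "a = int (nat a)" "b = int (nat b)" "tri n (nat a) (nat b)" "nat b \<noteq> 0"
          using that by (auto simp: triangle_def tri_def)
        then show ?thesis unfolding vert_edge_iff by (intro exI[of _ "nat a"] exI[of _ "nat b"]) simp
      qed
      have H: "{(a - 1, b), (a, b)} \<in> ?G" if "(a - 1, b) \<in> triangle n" "(a, b) \<in> triangle n" for a b
      proof -
        have "a = int (nat a)" "b = int (nat b)" "tri n (nat a) (nat b)" "nat b < nat a"
          using that by (auto simp: triangle_def tri_def)
        then show ?thesis unfolding hor_edge_iff by (intro exI[of _ "nat a"] exI[of _ "nat b"]) simp
      qed
      have "a' = a \<and> b' = b - 1 \<or> a' = a \<and> b = b' - 1 \<or> a' = a - 1 \<and> b' = b \<or> a = a' - 1 \<and> b' = b"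
        using 1(4) by linarith
      then show ?thesis
        using V[of a b] V[of a' b'] H[of a b] H[of a' b'] 1(2,3) unfolding 1(1)
        by (elim disjE conjE) (simp_all add: insert_commute)
    next
      case 2
      have e: "e = vedge_below (int (2 * (i - 1)), int 0)" using 2 by (auto simp: external_edge_def)
      have "tri n (2 * (i - 1)) 0" using 2 by (auto simp: tri_def)
      then show ?thesis unfolding e vedge_flow_graph by simp
    qed
  qed
  show "?G \<subseteq> triangle_edges n"
  proof
    fix e assume "e \<in> ?G"
    then consider x y where "e = vedge_below (int x, int y)" "tri n x y" "y = 0 \<longrightarrow> even x"
      | x y where "e = hedge_right (int x - 1, int y)" "tri n x y" "y < x"
      unfolding flow_graph_def by fastforce
    then show "e \<in> triangle_edges n"
    proof cases
      case 1
      show ?thesis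
      proof (cases y)
        case 0
        then obtain k where k: "x = 2 * k" using 1 by blast
        then have "e = external_edge (Suc k)" "Suc k \<in> {1..2 * n}"
          using 1 0 by (auto simp: external_edge_def tri_def)
        then show ?thesis unfolding triangle_edges_def by blast
      next
        case (Suc y')
        then have "e = {(int x, int y'), (int x, int y)}" using 1 by (auto simp: vedge_below_def)
        moreover have "(int x, int y') \<in> triangle n" "(int x, int y) \<in> triangle n"
          unfolding tri_triangle using 1 Suc by (auto simp: tri_def)
        moreover have "\<bar>int x - int x\<bar> + \<bar>int y' - int y\<bar> = 1" using Suc by simp
        ultimately show ?thesis unfolding triangle_edges_def by blast
      qed
    next
      case 2
      then have "e = {(int (x - 1), int y), (int x, int y)}" by (auto simp: hedge_right_def)
      moreover have "(int (x - 1), int y) \<in> triangle n" "(int x, int y) \<in> triangle n"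
        unfolding tri_triangle using 2 by (auto simp: tri_def)
      moreover have "\<bar>int (x - 1) - int x\<bar> + \<bar>int y - int y\<bar> = 1" using 2 by auto
      ultimately show ?thesis unfolding triangle_edges_def by blast
    qed
  qed
qed

definition arcs :: "nat \<Rightarrow> (nat \<Rightarrow> nat \<Rightarrow> int) \<Rightarrow> (nat \<Rightarrow> nat \<Rightarrow> int) \<Rightarrow> (point \<times> point) set" where
  "arcs n v h =
    {((int x, int y - 1), (int x, int y)) | x y. tri n x y \<and> v x y = 1} \<union>
    {((int x, int y), (int x, int y - 1)) | x y. tri n x y \<and> v x y = -1} \<union>
    {((int x - 1, int y), (int x, int y)) | x y. tri n x y \<and> y < x \<and> h x y = 1} \<union>
    {((int x, int y), (int x - 1, int y)) | x y. tri n x y \<and> y < x \<and> h x y = -1}"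

text \<open>The flow into the vertex \<open>(x, y)\<close> from its neighbour \<open>q\<close>, without the ghost edges.\<close>

definition inflow :: "nat \<Rightarrow> (nat \<Rightarrow> nat \<Rightarrow> int) \<Rightarrow> (nat \<Rightarrow> nat \<Rightarrow> int) \<Rightarrow> nat \<Rightarrow> nat \<Rightarrow> point \<Rightarrow> int" where
  "inflow n v h x y q =
    (if q = (int x, int y - 1) then v x y
     else if q = (int x, int y + 1) then - v x (Suc y)
     else if q = (int x - 1, int y) then (if y < x then h x y else 0)
     else if q = (int x + 1, int y) then (if tri n (Suc x) y then - h (Suc x) y else 0) else 0)"

lemma inflow_val:
  "inflow n v h x y q \<noteq> 0 \<Longrightarrow> inflow n v h x y q = v x y \<or>
      inflow n v h x y q = - v x (Suc y) \<or>
      y < x \<and> inflow n v h x y q = h x y \<or>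
      tri n (Suc x) y \<and> inflow n v h x y q = - h (Suc x) y"
  unfolding inflow_def by (auto split: if_splits)

lemma inflow_simps:
  "inflow n v h x y (int x, int y - 1) = v x y"
  "inflow n v h x y (int x, int y + 1) = - v x (Suc y)"
  "inflow n v h x y (int x - 1, int y) = (if y < x then h x y else 0)"
  "inflow n v h x y (int x + 1, int y) = (if tri n (Suc x) y then - h (Suc x) y else 0)"
  by (auto simp: inflow_def)

abbreviation flow_rel where "flow_rel n v h \<equiv> edge_rel (flow_graph n v h)"

context
  fixes n :: nat and \<sigma> \<tau> \<pi> :: "nat list" and v h :: "nat \<Rightarrow> nat \<Rightarrow> int"
  assumes fl: "flow n \<sigma> \<tau> \<pi> v h"
begin

lemma flow_vertex: "tri n x y \<Longrightarrow> vertex_ok (v x y) (v x (Suc y)) (h x y) (h (Suc x) y)"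
  using fl by (simp add: flow_def)

lemma flow_out: "\<not> tri n x y \<Longrightarrow> v x y = 0"
  using fl by (simp add: flow_def)

lemma flow_graph_triangle: "flow_graph n v h \<subseteq> triangle_edges n"
proof
  fix e assume "e \<in> flow_graph n v h"
  then consider x y where "e = vedge_below (int x, int y)" "tri n x y" "v x y \<noteq> 0"
    | x y where "e = hedge_right (int x - 1, int y)" "tri n x y" "y < x"
    unfolding flow_graph_def by blast
  then show "e \<in> triangle_edges n"
  proof cases
    case 1
    then have "y = 0 \<longrightarrow> even x" using fl unfolding flow_def by metis
    then show ?thesis using 1 by (simp add: triangle_edges_eq vedge_flow_graph)
  next
    case 2
    then show ?thesis by (simp add: triangle_edges_eq hedge_flow_graph)
  qed
qed

lemma inflow_edge:
  assumes "tri n x y"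
  shows "((int x, int y), q) \<in> flow_rel n v h \<longleftrightarrow> inflow n v h x y q \<noteq> 0"
proof (cases "q \<in> nbrs (int x, int y)")
  case True
  then consider "q = (int x, int y - 1)" | "q = (int x, int y + 1)" | "q = (int x - 1, int y)"
    | "q = (int x + 1, int y)" by (auto simp: nbrs_def)
  then show ?thesis
  proof cases
    case 1
    then show ?thesis using vert_edge_iff[of "int x" "int y" n v h] assms
      by (auto simp: edge_rel_def inflow_def insert_commute)
  next
    case 2
    have "{(int x, int y), (int x, int y + 1)} \<in> flow_graph n v h \<longleftrightarrow> v x (Suc y) \<noteq> 0"
    proof -
      have "{(int x, int (Suc y) - 1), (int x, int (Suc y))} \<in> flow_graph n v h \<longleftrightarrow>
          tri n x (Suc y) \<and> v x (Suc y) \<noteq> 0"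
        using vert_edge_iff[of "int x" "int (Suc y)" n v h] by (auto simp del: of_nat_Suc)
      then show ?thesis using flow_out[of x "Suc y"] by (auto simp: add.commute)
    qed
    then show ?thesis using 2 by (auto simp: edge_rel_def inflow_def)
  next
    case 3
    then show ?thesis using hor_edge_iff[of "int x" "int y" n v h] assms
      by (auto simp: edge_rel_def inflow_def insert_commute)
  next
    case 4
    have "{(int x, int y), (int x + 1, int y)} \<in> flow_graph n v h \<longleftrightarrow> tri n (Suc x) y \<and> h (Suc x) y \<noteq> 0"
    proof -
      have "{(int (Suc x) - 1, int y), (int (Suc x), int y)} \<in> flow_graph n v h \<longleftrightarrow>
          tri n (Suc x) y \<and> y < Suc x \<and> h (Suc x) y \<noteq> 0"
        using hor_edge_iff[of "int (Suc x)" "int y" n v h] by (auto simp del: of_nat_Suc)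
      then show ?thesis using assms by (auto simp: add.commute tri_def)
    qed
    then show ?thesis using 4 by (auto simp: edge_rel_def inflow_def)
  qed
next
  case False
  then show ?thesis using flow_graph_nbr[of "(int x, int y)" q n v h]
    by (auto simp: edge_rel_def inflow_def nbrs_def)
qed

lemma inflow_arc:
  assumes "tri n x y"
  shows "((int x, int y), q) \<in> arcs n v h \<longleftrightarrow> inflow n v h x y q = -1"
    and "(q, (int x, int y)) \<in> arcs n v h \<longleftrightarrow> inflow n v h x y q = 1"
proof -
  have i1: "a = int b + 1 \<longleftrightarrow> a = int (Suc b)" "int b + 1 = int c \<longleftrightarrow> c = Suc b"
    "int b = int c - 1 \<longleftrightarrow> c = Suc b" for a b c by auto
  have t: "v x (Suc y) = 1 \<Longrightarrow> tri n x (Suc y)" "v x (Suc y) = -1 \<Longrightarrow> tri n x (Suc y)" "y \<le> x"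
    using assms flow_out[of x "Suc y"] by (auto simp: tri_def)
  obtain a b where q: "q = (a, b)" by (cases q)
  show "((int x, int y), q) \<in> arcs n v h \<longleftrightarrow> inflow n v h x y q = -1"
    using assms t unfolding arcs_def inflow_def q
    by (auto simp: i1)
  show "(q, (int x, int y)) \<in> arcs n v h \<longleftrightarrow> inflow n v h x y q = 1"
    using assms t unfolding arcs_def inflow_def q
    by (auto simp: i1)
qed

end

section \<open>Levels of paths\<close>

text \<open>The stream function of the flow. The face to the left of column \<open>x\<close> between the rows \<open>y - 1\<close> and \<open>y\<close>
  gets the flux through a path that starts outside at the bottom left, runs to the right below row \<open>0\<close>
  and then upwards.\<close>

definition face :: "(nat \<Rightarrow> nat \<Rightarrow> int) \<Rightarrow> (nat \<Rightarrow> nat \<Rightarrow> int) \<Rightarrow> nat \<Rightarrow> nat \<Rightarrow> int" where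
  "face v h x y = (\<Sum>i<x. v i 0) - (\<Sum>j<y. h x j)"

text \<open>Two edges meet at a vertex, so the four faces around it take only two values, which differ by one;
  the level is the smaller one. For the lower end of an external edge the two faces next to this edge
  are used.\<close>

definition level :: "(nat \<Rightarrow> nat \<Rightarrow> int) \<Rightarrow> (nat \<Rightarrow> nat \<Rightarrow> int) \<Rightarrow> point \<Rightarrow> int" where
  "level v h p = (let x = nat (fst p); y = nat (snd p) in
     if snd p < 0 then min (face v h x 0) (face v h (Suc x) 0)
     else min (min (face v h x y) (face v h (Suc x) y)) (min (face v h x (Suc y)) (face v h (Suc x) (Suc y))))"

lemma face_up: "face v h x (Suc y) = face v h x y - h x y"
  by (simp add: face_def)

context
  fixes n :: nat and \<sigma> \<tau> \<pi> :: "nat list" and v h :: "nat \<Rightarrow> nat \<Rightarrow> int"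
  assumes fl: "flow n \<sigma> \<tau> \<pi> v h"
begin

lemma sym_E: "(p, q) \<in> flow_rel n v h \<Longrightarrow> (q, p) \<in> flow_rel n v h"
  by (auto simp: edge_rel_def insert_commute)

lemma outer_point:
  assumes e: "(p, q) \<in> flow_rel n v h" and p: "\<nexists>x y. p = (int x, int y) \<and> tri n x y"
  obtains x where "tri n x 0" "p = (int x, -1)" "q = (int x, 0)" "v x 0 \<noteq> 0"
proof -
  from e have "{p, q} \<in> flow_graph n v h" by (simp add: edge_rel_def)
  then consider x y where "{p, q} = {(int x, int y - 1), (int x, int y)}" "tri n x y" "v x y \<noteq> 0"
    | x y where "{p, q} = {(int x - 1, int y), (int x, int y)}" "tri n x y" "y < x"
    unfolding flow_graph_def vedge_below_def hedge_right_def by fastforce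
  then show thesis
  proof cases
    case 1
    have pq: "p = (int x, int y - 1)" "q = (int x, int y)" using 1(1,2) p by (auto simp: doubleton_eq_iff)
    have "y = 0"
    proof (rule ccontr)
      assume "y \<noteq> 0"
      then have "p = (int x, int (y - 1))" "tri n x (y - 1)" using pq 1(2) by (auto simp: tri_def)
      then show False using p by blast
    qed
    then show thesis using that[of x] pq 1 by simp
  next
    case 2
    have pq: "p = (int x - 1, int y)" using 2(1,2) p by (auto simp: doubleton_eq_iff)
    then have "p = (int (x - 1), int y)" "tri n (x - 1) y" using 2 by (auto simp: tri_def)
    then show thesis using p by blast
  qed
qed

lemma inflow_opposite:
  assumes t: "tri n x y" and q: "q \<noteq> q'" "inflow n v h x y q \<noteq> 0" "inflow n v h x y q' \<noteq> 0"
  shows "inflow n v h x y q' = - inflow n v h x y q"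
proof -
  have ok: "vertex_ok (v x y) (v x (Suc y)) (h x y) (h (Suc x) y)" using flow_vertex[OF fl t] .
  have c: "v x y + h x y = v x (Suc y) + h (Suc x) y"
    "\<bar>v x y\<bar> + \<bar>v x (Suc y)\<bar> + \<bar>h x y\<bar> + \<bar>h (Suc x) y\<bar> = 2"
    using ok by (auto simp: vertex_ok_def)
  have val: "q = (int x, int y - 1) \<and> inflow n v h x y q = v x y \<or>
      q = (int x, int y + 1) \<and> inflow n v h x y q = - v x (Suc y) \<or>
      q = (int x - 1, int y) \<and> inflow n v h x y q = h x y \<or>
      q = (int x + 1, int y) \<and> inflow n v h x y q = - h (Suc x) y"
    if "inflow n v h x y q \<noteq> 0" for q
    using that unfolding inflow_def by (auto split: if_splits)
  have o: "v x y \<noteq> 0 \<Longrightarrow> v x (Suc y) \<noteq> 0 \<Longrightarrow> v x (Suc y) = v x y"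
    "v x y \<noteq> 0 \<Longrightarrow> h x y \<noteq> 0 \<Longrightarrow> h x y = - v x y"
    "v x y \<noteq> 0 \<Longrightarrow> h (Suc x) y \<noteq> 0 \<Longrightarrow> h (Suc x) y = v x y"
    "v x (Suc y) \<noteq> 0 \<Longrightarrow> h x y \<noteq> 0 \<Longrightarrow> h x y = v x (Suc y)"
    "v x (Suc y) \<noteq> 0 \<Longrightarrow> h (Suc x) y \<noteq> 0 \<Longrightarrow> h (Suc x) y = - v x (Suc y)"
    "h x y \<noteq> 0 \<Longrightarrow> h (Suc x) y \<noteq> 0 \<Longrightarrow> h (Suc x) y = h x y"
    using c by linarith+
  show ?thesis
    using val[OF q(2)] val[OF q(3)] q
    by (elim disjE conjE) (metis o minus_minus neg_equal_0_iff_equal)+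
qed

lemma inflow_range: "tri n x y \<Longrightarrow> inflow n v h x y q \<in> {-1, 0, 1}"
  using flow_vertex[OF fl] by (auto simp: inflow_def vertex_ok_def)

lemma arcs_antisym:
  assumes "(u, w) \<in> flow_rel n v h"
  shows "(u, w) \<in> arcs n v h \<longleftrightarrow> (w, u) \<notin> arcs n v h"
proof -
  have *: "((int x, int y), q) \<in> arcs n v h \<longleftrightarrow> (q, (int x, int y)) \<notin> arcs n v h"
    if "tri n x y" "((int x, int y), q) \<in> flow_rel n v h" for x y q
    using inflow_arc[OF fl that(1), of q] inflow_edge[OF fl that(1), of q] that(2) inflow_range[OF that(1), of q]
    by auto
  show ?thesis
  proof (cases "\<exists>x y. u = (int x, int y) \<and> tri n x y")
    case True
    then show ?thesis using * assms by blast
  next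
    case False
    then obtain x where x: "tri n x 0" "u = (int x, -1)" "w = (int x, 0)"
      using outer_point[OF assms] by blast
    then show ?thesis using *[of x 0 u] sym_E[OF assms] by auto
  qed
qed

lemma arcs_step:
  assumes "(u, w) \<in> flow_rel n v h" "(w, z) \<in> flow_rel n v h" "u \<noteq> z"
  shows "(u, w) \<in> arcs n v h \<longleftrightarrow> (w, z) \<in> arcs n v h"
proof (cases "\<exists>x y. w = (int x, int y) \<and> tri n x y")
  case True
  then obtain x y where w: "w = (int x, int y)" and t: "tri n x y" by blast
  have "inflow n v h x y u \<noteq> 0" "inflow n v h x y z \<noteq> 0"
    using inflow_edge[OF fl t] assms sym_E w by blast+
  then have "inflow n v h x y z = - inflow n v h x y u" using inflow_opposite[OF t] assms(3) by blast
  then show ?thesis unfolding w using inflow_arc[OF fl t] by auto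
next
  case False
  then show ?thesis using outer_point[OF assms(2) False] outer_point[OF sym_E[OF assms(1)] False] assms(3)
    by (metis prod.inject)
qed

lemma degree_tri:
  assumes t: "tri n x y"
  shows "int (card ((flow_rel n v h) `` {(int x, int y)})) = \<bar>v x y\<bar> + \<bar>v x (Suc y)\<bar> +
    (if y < x then \<bar>h x y\<bar> else 0) + (if tri n (Suc x) y then \<bar>h (Suc x) y\<bar> else 0)"
proof -
  have r: "v x y \<in> {-1, 0, 1}" "v x (Suc y) \<in> {-1, 0, 1}" "h x y \<in> {-1, 0, 1}" "h (Suc x) y \<in> {-1, 0, 1}"
    using flow_vertex[OF fl t] by (auto simp: vertex_ok_def)
  have b: "int (of_bool (a \<noteq> 0)) = \<bar>a\<bar>" if "a \<in> {-1, 0, 1}" for a :: int using that by auto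
  have i: "((int x, int y), q) \<in> flow_rel n v h \<longleftrightarrow> inflow n v h x y q \<noteq> 0" for q
    by (rule inflow_edge[OF fl t])
  have c: "card ((flow_rel n v h) `` {(int x, int y)}) = of_bool (v x y \<noteq> 0) + of_bool (v x (Suc y) \<noteq> 0)
      + of_bool (y < x \<and> h x y \<noteq> 0) + of_bool (tri n (Suc x) y \<and> h (Suc x) y \<noteq> 0)"
    unfolding edge_rel_card4(2)[OF flow_graph_triangle[OF fl]] fst_conv snd_conv i inflow_simps
    by simp
  show ?thesis
    unfolding c of_nat_add using b[OF r(1)] b[OF r(2)] b[OF r(3)] b[OF r(4)] by auto
qed

lemma degree2_flow: "degree2 (flow_rel n v h)"
proof (rule degree2_edge_rel[OF flow_graph_triangle[OF fl]])
  fix p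
  show "card ((flow_rel n v h) `` {p}) \<le> 2"
  proof (cases "\<exists>x y. p = (int x, int y) \<and> tri n x y")
    case True
    then obtain x y where p: "p = (int x, int y)" "tri n x y" by blast
    have "\<bar>v x y\<bar> + \<bar>v x (Suc y)\<bar> + \<bar>h x y\<bar> + \<bar>h (Suc x) y\<bar> = 2"
      using flow_vertex[OF fl p(2)] by (simp add: vertex_ok_def)
    moreover have "0 \<le> \<bar>h x y\<bar>" "0 \<le> \<bar>h (Suc x) y\<bar>" by simp_all
    ultimately show ?thesis using degree_tri[OF p(2)] unfolding p(1) by (simp split: if_splits)
  next
    case False
    have "(flow_rel n v h) `` {p} \<subseteq> {(fst p, 0)}"
    proof
      fix q assume "q \<in> flow_rel n v h `` {p}"
      then have "(p, q) \<in> flow_rel n v h" by simp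
      then obtain x where "p = (int x, -1)" "q = (int x, 0)" by (rule outer_point[OF _ False])
      then show "q \<in> {(fst p, 0)}" by simp
    qed
    then have "card ((flow_rel n v h) `` {p}) \<le> card {(fst p, 0::int)}" by (rule card_mono[rotated]) simp
    then show ?thesis by simp
  qed
qed

text \<open>The flux does not depend on the path because the flow is conserved at the vertices of the column.\<close>

lemma face_right: "y = 0 \<or> tri n x (y - 1) \<Longrightarrow> face v h (Suc x) y = face v h x y + v x y"
proof (induction y)
  case 0
  then show ?case by (simp add: face_def)
next
  case (Suc y)
  then have t: "tri n x y" by simp
  then have "y = 0 \<or> tri n x (y - 1)" by (auto simp: tri_def)
  then have "face v h (Suc x) y = face v h x y + v x y" by (rule Suc.IH)
  moreover have "v x y + h x y = v x (Suc y) + h (Suc x) y"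
    using flow_vertex[OF fl t] by (simp add: vertex_ok_def)
  ultimately show ?case by (simp add: face_up)
qed

lemma level_vertex:
  assumes t: "tri n x y"
  shows "level v h (int x, int y) =
      min (min (face v h x y) (face v h x y + v x y)) (min (face v h x y - h x y) (face v h x y + v x y - h (Suc x) y))"
    and "v x y \<noteq> 0 \<Longrightarrow> level v h (int x, int y) = min (face v h x y) (face v h (Suc x) y)"
    and "v x (Suc y) \<noteq> 0 \<Longrightarrow> level v h (int x, int y) = min (face v h x (Suc y)) (face v h (Suc x) (Suc y))"
    and "h x y \<noteq> 0 \<Longrightarrow> level v h (int x, int y) = min (face v h x y) (face v h x (Suc y))"
    and "h (Suc x) y \<noteq> 0 \<Longrightarrow> level v h (int x, int y) = min (face v h (Suc x) y) (face v h (Suc x) (Suc y))"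
proof -
  have "y = 0 \<or> tri n x (y - 1)" using t by (auto simp: tri_def)
  then have f: "face v h (Suc x) y = face v h x y + v x y" by (rule face_right)
  have c: "v x y + h x y = v x (Suc y) + h (Suc x) y"
    "\<bar>v x y\<bar> + \<bar>v x (Suc y)\<bar> + \<bar>h x y\<bar> + \<bar>h (Suc x) y\<bar> = 2"
    using flow_vertex[OF fl t] by (simp_all add: vertex_ok_def)
  show L: "level v h (int x, int y) =
      min (min (face v h x y) (face v h x y + v x y)) (min (face v h x y - h x y) (face v h x y + v x y - h (Suc x) y))"
    by (simp add: level_def Let_def f face_up)
  show "v x y \<noteq> 0 \<Longrightarrow> level v h (int x, int y) = min (face v h x y) (face v h (Suc x) y)"
    "v x (Suc y) \<noteq> 0 \<Longrightarrow> level v h (int x, int y) = min (face v h x (Suc y)) (face v h (Suc x) (Suc y))"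
    "h x y \<noteq> 0 \<Longrightarrow> level v h (int x, int y) = min (face v h x y) (face v h x (Suc y))"
    "h (Suc x) y \<noteq> 0 \<Longrightarrow> level v h (int x, int y) = min (face v h (Suc x) y) (face v h (Suc x) (Suc y))"
    using c unfolding L face_up f min_def by (simp_all split: if_splits; linarith)+
qed

text \<open>Both levels are the minimum over the two faces that are separated by the edge.\<close>

lemma level_edge:
  assumes e: "(p, q) \<in> flow_rel n v h"
  shows "level v h p = level v h q"
proof -
  from e have "{p, q} \<in> flow_graph n v h" by (simp add: edge_rel_def)
  then consider x y where "{p, q} = {(int x, int y - 1), (int x, int y)}" "tri n x y" "v x y \<noteq> 0"
    | x y where "{p, q} = {(int x - 1, int y), (int x, int y)}" "tri n x y" "y < x" "h x y \<noteq> 0"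
    unfolding flow_graph_def vedge_below_def hedge_right_def by fastforce
  then show ?thesis
  proof cases
    case 1
    have "level v h (int x, int y - 1) = level v h (int x, int y)"
    proof (cases y)
      case 0
      then show ?thesis using level_vertex(2)[OF 1(2,3)] by (simp add: level_def)
    next
      case (Suc y')
      have "tri n x y'" using 1 Suc by (simp add: tri_def)
      then show ?thesis
        using level_vertex(2)[OF 1(2,3)] level_vertex(3)[of x y'] 1(3) Suc by simp
    qed
    then show ?thesis using 1(1) by (auto simp: doubleton_eq_iff)
  next
    case 2
    obtain x' where x: "x = Suc x'" using 2(3) by (cases x) auto
    have "tri n x' y" using 2 x by (simp add: tri_def)
    then have "level v h (int x - 1, int y) = level v h (int x, int y)"
      using level_vertex(4)[OF 2(2,4)] level_vertex(5)[of x' y] 2(4) x by simp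
    then show ?thesis using 2(1) by (auto simp: doubleton_eq_iff)
  qed
qed

lemma bottom_face:
  assumes b: "balanced n \<pi>" and k: "k < 2 * n"
  shows "face v h (2 * k) 0 = height \<pi> k" "face v h (Suc (2 * k)) 0 = height \<pi> (Suc k)"
proof -
  have v: "v x 0 = (if odd x then 0 else if \<pi> ! (x div 2) = 0 then 1 else -1)" if "x \<le> 4 * n - 2" "1 \<le> n" for x
    using fl that by (auto simp: flow_def tri_def)
  have 1: "face v h (2 * j) 0 = height \<pi> j" if "j < 2 * n" for j
    using that
  proof (induction j)
    case 0
    then show ?case by (simp add: face_def)
  next
    case (Suc j)
    have "v (2 * j) 0 = (if \<pi> ! j = 0 then 1 else -1)" "v (Suc (2 * j)) 0 = 0"
      using v[of "2 * j"] v[of "Suc (2 * j)"] Suc.prems by auto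
    then show ?case using Suc height_Suc[OF b, of j] by (simp add: face_def)
  qed
  show "face v h (2 * k) 0 = height \<pi> k" using 1 k .
  have "v (2 * k) 0 = (if \<pi> ! k = 0 then 1 else -1)" using v[of "2 * k"] k by auto
  then show "face v h (Suc (2 * k)) 0 = height \<pi> (Suc k)"
    using 1[OF k] height_Suc[OF b k] by (simp add: face_def)
qed

text \<open>Along the left side the stream function starts at \<open>0\<close> and drops by one at every path that enters.\<close>

lemma face_left_boundary: "y < 2 * n \<Longrightarrow> face v h y y \<le> 0"
proof (induction y)
  case 0
  then show ?case by (simp add: face_def)
next
  case (Suc y)
  have t: "tri n y y" using Suc.prems by (simp add: tri_def)
  have "v y (Suc y) = 0" by (rule flow_out[OF fl]) (simp add: tri_def)
  then have "face v h (Suc y) (Suc y) = face v h y y - h y y" using face_right[of "Suc y" y] t by (simp add: face_up)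
  moreover have "h y y \<ge> 0" using fl Suc.prems by (auto simp: flow_def)
  ultimately show ?case using Suc by simp
qed

lemma face_right_boundary:
  assumes b: "balanced n \<pi>" and n: "1 \<le> n"
  shows "y < 2 * n \<Longrightarrow> face v h (4 * n - 1 - y) y \<le> 0"
proof (induction y)
  case 0
  have "face v h (4 * n - 1) 0 = 0"
  proof -
    have "face v h (2 * (2 * n - 1)) 0 = height \<pi> (2 * n - 1)" "face v h (Suc (2 * (2 * n - 1))) 0 = height \<pi> (Suc (2 * n - 1))"
      using bottom_face[OF b, of "2 * n - 1"] n by auto
    moreover have "Suc (2 * (2 * n - 1)) = 4 * n - 1" "Suc (2 * n - 1) = 2 * n" using n by auto
    ultimately show ?thesis using height_end[OF b] by simp
  qed
  then show ?case by simp
next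
  case (Suc y)
  define x where "x = 4 * n - 1 - Suc y"
  have x: "4 * n - 1 - y = Suc x" using Suc.prems by (simp add: x_def)
  have t: "tri n x y" using Suc.prems by (auto simp: tri_def x_def)
  have "v x (Suc y) = 0" by (rule flow_out[OF fl]) (use Suc.prems in \<open>auto simp: tri_def x_def\<close>)
  then have "face v h x (Suc y) = face v h (Suc x) y - h (Suc x) y" using face_right[of "Suc y" x] t by (simp add: face_up)
  moreover have "h (Suc x) y \<ge> 0" using fl Suc.prems x[symmetric] by (auto simp: flow_def)
  ultimately show ?case using Suc x by (simp add: x_def)
qed

end

section \<open>Where the paths of a flow lead\<close>

lemma word_degree_append:
  "word_degree (xs @ ys) = word_degree xs + word_degree ys + count_list xs 1 * count_list ys 0"
  by (induction xs) (auto simp: word_degree_Cons)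

lemma swap_letters:
  assumes "a < b" "b < length w" "w ! a = 1" "w ! b = 0"
  shows "word_degree (w[a := 0, b := 1]) < word_degree w"
    and "count_list (w[a := 0, b := 1]) c = count_list w c"
    and "set (w[a := 0, b := 1]) \<subseteq> set w"
proof -
  define xs ys zs where "xs = take a w" and "ys = take (b - Suc a) (drop (Suc a) w)" and "zs = drop (Suc b) w"
  have "drop (Suc a) w = ys @ w ! b # zs"
  proof -
    have "b - Suc a < length (drop (Suc a) w)" using assms by simp
    from id_take_nth_drop[OF this] show ?thesis
      using assms(1,2) by (simp add: ys_def zs_def)
  qed
  then have w: "w = xs @ 1 # ys @ 0 # zs"
    using id_take_nth_drop[of a w] assms by (simp add: xs_def)
  have l: "length xs = a" "length ys = b - Suc a" using assms by (auto simp: xs_def ys_def)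
  have "w[a := 0] = xs @ 0 # ys @ 0 # zs" using l w by (metis list_update_length)
  then have "w[a := 0, b := 1] = (xs @ 0 # ys @ 0 # zs)[b := 1]" by simp
  also have "\<dots> = ((xs @ 0 # ys) @ 0 # zs)[length (xs @ 0 # ys) := 1]" using l assms(1) by simp
  also have "\<dots> = xs @ 0 # ys @ 1 # zs" by (subst list_update_length) simp
  finally have w': "w[a := 0, b := 1] = xs @ 0 # ys @ 1 # zs" .
  show "word_degree (w[a := 0, b := 1]) < word_degree w"
    unfolding w' by (subst w) (simp add: word_degree_append word_degree_Cons)
  show "count_list (w[a := 0, b := 1]) c = count_list w c"
    unfolding w' by (subst w) simp
  show "set (w[a := 0, b := 1]) \<subseteq> set w"
    unfolding w' by (subst w) auto
qed

lemma dyck_first_last: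
  assumes w: "w \<in> dyck_words n" and n: "1 \<le> n"
  shows "w ! 0 = 0" "w ! (2 * n - 1) = 1"
proof -
  note b = dyck_balanced[OF w]
  have "0 \<le> height w 1" using height_nonneg[OF w, of 1] n by simp
  then show "w ! 0 = 0" using height_Suc[OF b, of 0] n by (auto split: if_splits)
  have "0 \<le> height w (2 * n - 1)" using height_nonneg[OF w, of "2 * n - 1"] by simp
  moreover have "Suc (2 * n - 1) = 2 * n" using n by simp
  ultimately show "w ! (2 * n - 1) = 1"
    using height_Suc[OF b, of "2 * n - 1"] height_end[OF b] balanced_letter[OF b, of "2 * n - 1"] n
    by (auto split: if_splits)
qed

lemma left_vertices_iff: "(int x, int y) \<in> left_vertices n \<longleftrightarrow> x = y \<and> y < 2 * n"
proof
  assume "x = y \<and> y < 2 * n"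
  then show "(int x, int y) \<in> left_vertices n"
    unfolding left_vertices_def left_vertex_def by (intro image_eqI[of _ _ "Suc y"]) auto
qed (auto simp: left_vertices_def left_vertex_def)

lemma right_vertices_iff: "(int x, int y) \<in> right_vertices n \<longleftrightarrow> y < 2 * n \<and> x + y + 2 = 4 * n"
proof
  assume "y < 2 * n \<and> x + y + 2 = 4 * n"
  then show "(int x, int y) \<in> right_vertices n"
    unfolding right_vertices_def right_vertex_def by (intro image_eqI[of _ _ "2 * n - y"]) auto
qed (auto simp: right_vertices_def right_vertex_def)

context
  fixes n :: nat and \<sigma> \<tau> \<pi> :: "nat list" and v h :: "nat \<Rightarrow> nat \<Rightarrow> int"
  assumes fl: "flow n \<sigma> \<tau> \<pi> v h" and n: "1 \<le> n"
    and w: "\<sigma> \<in> dyck_words n" "\<tau> \<in> dyck_words n" "\<pi> \<in> dyck_words n"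
    and wd: "word_degree \<sigma> + word_degree \<tau> = word_degree \<pi>"
begin

interpretation D: degree2 "edge_rel (flow_graph n v h)"
  by (rule degree2_flow[OF fl])

lemma balanced_words: "balanced n \<sigma>" "balanced n \<tau>" "balanced n \<pi>"
  using w by (auto intro: dyck_balanced)

lemma ghost_left: "y < 2 * n \<Longrightarrow> h y y = of_bool (\<sigma> ! y = 1)"
  and ghost_right: "y < 2 * n \<Longrightarrow> h (4 * n - 1 - y) y = of_bool (\<tau> ! (2 * n - 1 - y) = 0)"
  using fl by (auto simp: flow_def)

text \<open>The face above the ghost edge has a negative value. All the flow into this vertex comes through the
  ghost edge, so its other edge leaves it.\<close>

lemma ghost_vertex_left:
  assumes t: "tri n y y" and hy: "h y y \<noteq> 0"
  shows "level v h (int y, int y) < 0"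
    and "((int y, int y), q) \<in> flow_rel n v h \<Longrightarrow> ((int y, int y), q) \<in> arcs n v h \<and> (tri n (Suc y) y \<or> h (Suc y) y = 0)"
proof -
  have y: "y < 2 * n" using t by (auto simp: tri_def)
  have h1: "h y y = 1" using ghost_left[OF y] hy by auto
  show "level v h (int y, int y) < 0"
    using level_vertex(4)[OF fl t hy] face_left_boundary[OF fl y] face_up[of v h y y] h1 by simp
  assume "((int y, int y), q) \<in> flow_rel n v h"
  then have q: "inflow n v h y y q \<noteq> 0" using inflow_edge[OF fl t] by blast
  have c: "v y y + h y y = v y (Suc y) + h (Suc y) y"
    "\<bar>v y y\<bar> + \<bar>v y (Suc y)\<bar> + \<bar>h y y\<bar> + \<bar>h (Suc y) y\<bar> = 2"
    using flow_vertex[OF fl t] by (auto simp: vertex_ok_def)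
  have nz: "v y (Suc y) = 0" using flow_out[OF fl, of y "Suc y"] by (simp add: tri_def)
  have "inflow n v h y y q = v y y \<or> tri n (Suc y) y \<and> inflow n v h y y q = - h (Suc y) y"
    using inflow_val[OF q] q nz by auto
  then have "inflow n v h y y q = -1 \<and> (tri n (Suc y) y \<or> h (Suc y) y = 0)"
    using q c h1 nz by (elim disjE) (simp; linarith)+
  then show "((int y, int y), q) \<in> arcs n v h \<and> (tri n (Suc y) y \<or> h (Suc y) y = 0)"
    using inflow_arc(1)[OF fl t] by blast
qed

lemma ghost_vertex_right:
  assumes t: "tri n x y" and xy: "x + y + 2 = 4 * n" and hx: "h (Suc x) y \<noteq> 0"
  shows "level v h (int x, int y) < 0"
    and "((int x, int y), q) \<in> flow_rel n v h \<Longrightarrow> (q, (int x, int y)) \<in> arcs n v h \<and> (y < x \<or> h x y = 0)"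
proof -
  have y: "y < 2 * n" using t xy by (auto simp: tri_def)
  have sx: "Suc x = 4 * n - 1 - y" using xy by simp
  have h1: "h (Suc x) y = 1" using ghost_right[OF y] hx unfolding sx by auto
  show "level v h (int x, int y) < 0"
    using level_vertex(5)[OF fl t hx] face_right_boundary[OF fl balanced_words(3) n y] face_up[of v h "Suc x" y] h1
    unfolding sx by simp
  assume "((int x, int y), q) \<in> flow_rel n v h"
  then have q: "inflow n v h x y q \<noteq> 0" using inflow_edge[OF fl t] by blast
  have c: "v x y + h x y = v x (Suc y) + h (Suc x) y"
    "\<bar>v x y\<bar> + \<bar>v x (Suc y)\<bar> + \<bar>h x y\<bar> + \<bar>h (Suc x) y\<bar> = 2"
    using flow_vertex[OF fl t] by (auto simp: vertex_ok_def)
  have nz: "v x (Suc y) = 0" using flow_out[OF fl, of x "Suc y"] xy by (auto simp: tri_def)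
  have nt: "\<not> tri n (Suc x) y" using xy by (auto simp: tri_def)
  have "inflow n v h x y q = v x y \<or> y < x \<and> inflow n v h x y q = h x y"
    using inflow_val[OF q] q nz nt by auto
  then have "inflow n v h x y q = 1 \<and> (y < x \<or> h x y = 0)"
    using q c h1 nz by (elim disjE) (simp; linarith)+
  then show "(q, (int x, int y)) \<in> arcs n v h \<and> (y < x \<or> h x y = 0)"
    using inflow_arc(2)[OF fl t] by blast
qed

lemma ext_point: "1 \<le> i \<Longrightarrow> external_end i = (int (2 * (i - 1)), -1)"
  by (auto simp: external_end_def)

lemma flow_bottom: "k < 2 * n \<Longrightarrow> v (2 * k) 0 = (if \<pi> ! k = 0 then 1 else -1)"
  using fl by (auto simp: flow_def tri_def)

lemma ext_edge:
  assumes i: "1 \<le> i" "i \<le> 2 * n"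
  shows "(external_end i, (int (2 * (i - 1)), 0)) \<in> flow_rel n v h" "end_of (flow_rel n v h) (external_end i)"
    "\<pi> ! (i - 1) = 0 \<Longrightarrow> (external_end i, (int (2 * (i - 1)), 0)) \<in> arcs n v h"
    "\<pi> ! (i - 1) \<noteq> 0 \<Longrightarrow> ((int (2 * (i - 1)), 0), external_end i) \<in> arcs n v h"
    "\<pi> ! (i - 1) = 0 \<Longrightarrow> level v h (external_end i) = height \<pi> (i - 1)"
    "\<pi> ! (i - 1) \<noteq> 0 \<Longrightarrow> level v h (external_end i) = height \<pi> i"
    "0 \<le> level v h (external_end i)"
proof -
  let ?x = "2 * (i - 1)"
  have t: "tri n ?x 0" using i by (auto simp: tri_def)
  have vx: "v ?x 0 = (if \<pi> ! (i - 1) = 0 then 1 else -1)" using flow_bottom[of "i - 1"] i by simp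
  have inf: "inflow n v h ?x 0 (external_end i) = v ?x 0"
    unfolding ext_point[OF i(1)] using inflow_simps(1)[of n v h ?x 0] by simp
  have "((int ?x, int 0), external_end i) \<in> flow_rel n v h" using inflow_edge[OF fl t] inf vx by simp
  then show e: "(external_end i, (int ?x, 0)) \<in> flow_rel n v h" using sym_E[OF fl] by simp
  show "end_of (flow_rel n v h) (external_end i)"
    unfolding end_of_def
  proof (intro allI impI)
    have nt: "\<nexists>x y. external_end i = (int x, int y) \<and> tri n x y" by (auto simp: external_end_def)
    have "a = (int ?x, 0)" if "(external_end i, a) \<in> flow_rel n v h" for a
      using that nt by (rule outer_point[OF fl]) (auto simp: ext_point[OF i(1)])
    then show "a = b" if "(external_end i, a) \<in> flow_rel n v h" "(external_end i, b) \<in> flow_rel n v h" for a b using that by blast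
  qed
  show "\<pi> ! (i - 1) = 0 \<Longrightarrow> (external_end i, (int ?x, 0)) \<in> arcs n v h"
    using inflow_arc(2)[OF fl t, of "external_end i"] inf vx by simp
  show "\<pi> ! (i - 1) \<noteq> 0 \<Longrightarrow> ((int ?x, 0), external_end i) \<in> arcs n v h"
    using inflow_arc(1)[OF fl t, of "external_end i"] inf vx by simp
  have f: "face v h ?x 0 = height \<pi> (i - 1)" "face v h (Suc ?x) 0 = height \<pi> i"
    using bottom_face[OF fl balanced_words(3), of "i - 1"] i by auto
  have L: "level v h (external_end i) = min (height \<pi> (i - 1)) (height \<pi> i)"
    unfolding ext_point[OF i(1)] level_def Let_def fst_conv snd_conv nat_int f by simp
  have s: "height \<pi> i = height \<pi> (i - 1) + (if \<pi> ! (i - 1) = 0 then 1 else -1)"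
    using height_Suc[OF balanced_words(3), of "i - 1"] i by simp
  show "\<pi> ! (i - 1) = 0 \<Longrightarrow> level v h (external_end i) = height \<pi> (i - 1)"
    "\<pi> ! (i - 1) \<noteq> 0 \<Longrightarrow> level v h (external_end i) = height \<pi> i"
    using L s by auto
  show "0 \<le> level v h (external_end i)"
    unfolding L using height_nonneg[OF w(3), of "i - 1"] height_nonneg[OF w(3), of i] i by auto
qed

lemma endpoint_cases:
  assumes e: "(p, q) \<in> flow_rel n v h" and pend: "end_of (flow_rel n v h) p"
  obtains (bottom) i where "1 \<le> i" "i \<le> 2 * n" "p = external_end i"
  | (left) "p \<in> left_vertices n" "p \<notin> right_vertices n" "(p, q) \<in> arcs n v h" "level v h p < 0"
  | (right) "p \<in> right_vertices n" "p \<notin> left_vertices n" "(q, p) \<in> arcs n v h" "level v h p < 0"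
proof (cases "\<exists>x y. p = (int x, int y) \<and> tri n x y")
  case False
  then obtain x where x: "tri n x 0" "p = (int x, -1)" "v x 0 \<noteq> 0" using outer_point[OF fl e] by blast
  then have "even x" using fl unfolding flow_def by metis
  then obtain k where "x = 2 * k" by blast
  then show thesis using bottom[of "Suc k"] x by (auto simp: ext_point tri_def)
next
  case True
  then obtain x y where p: "p = (int x, int y)" and t: "tri n x y" by blast
  have "card ((flow_rel n v h) `` {p}) = 1"
    using end_of_card[OF flow_graph_triangle[OF fl] e] pend vertex_degree_card[OF flow_graph_triangle[OF fl]] by simp
  then have "1 = \<bar>v x y\<bar> + \<bar>v x (Suc y)\<bar> + (if y < x then \<bar>h x y\<bar> else 0) + (if tri n (Suc x) y then \<bar>h (Suc x) y\<bar> else 0)"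
    using degree_tri[OF fl t] p by simp
  moreover have "\<bar>v x y\<bar> + \<bar>v x (Suc y)\<bar> + \<bar>h x y\<bar> + \<bar>h (Suc x) y\<bar> = 2"
    using flow_vertex[OF fl t] by (simp add: vertex_ok_def)
  ultimately have "\<not> y < x \<and> h x y \<noteq> 0 \<or> \<not> tri n (Suc x) y \<and> h (Suc x) y \<noteq> 0"
    by (auto split: if_splits)
  then consider "\<not> y < x" "h x y \<noteq> 0" | "\<not> tri n (Suc x) y" "h (Suc x) y \<noteq> 0" by blast
  then show thesis
  proof cases
    case 1
    then have xy: "x = y" "y < 2 * n" using t by (auto simp: tri_def)
    note g = ghost_vertex_left[of y, OF t[unfolded xy(1)] 1(2)[unfolded xy(1)]]
    have pq: "(p, q) \<in> arcs n v h" "tri n (Suc x) y \<or> h (Suc x) y = 0" using g(2)[of q] e p xy by auto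
    have "p \<notin> right_vertices n"
    proof
      assume "p \<in> right_vertices n"
      then have "x + y + 2 = 4 * n" using right_vertices_iff p by simp
      then have "y = 2 * n - 1" "\<not> tri n (Suc x) y" "Suc x = 4 * n - 1 - y" using xy by (auto simp: tri_def)
      then show False using pq ghost_right[of y] dyck_first_last(1)[OF w(2) n] n by simp
    qed
    then show thesis using left pq(1) g(1) xy p left_vertices_iff by simp
  next
    case 2
    have xy: "x + y + 2 = 4 * n" "y < 2 * n" using t 2(1) by (auto simp: tri_def)
    note g = ghost_vertex_right[OF t xy(1) 2(2)]
    have pq: "(q, p) \<in> arcs n v h" "y < x \<or> h x y = 0" using g(2)[of q] e p by auto
    have "p \<notin> left_vertices n"
    proof
      assume "p \<in> left_vertices n"
      then have "x = y" using left_vertices_iff p by simp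
      then have "y = 2 * n - 1" using xy by auto
      then show False using pq \<open>x = y\<close> ghost_left[of y] dyck_first_last(2)[OF w(1) n] n by simp
    qed
    then show thesis using right pq(1) g(1) xy p right_vertices_iff by simp
  qed
qed

lemma path_arcs:
  assumes p: "epath (flow_rel n v h) p"
  shows "(hd p, p ! 1) \<in> arcs n v h \<longleftrightarrow> (p ! (length p - 2), last p) \<in> arcs n v h"
proof -
  have st: "(d \<in> arcs n v h) = (d' \<in> arcs n v h)" if "(d, d') \<in> dart_step (flow_rel n v h)" for d d'
    using that arcs_step[OF fl] by (elim D.stepD) auto
  have "(d \<in> arcs n v h) = (d' \<in> arcs n v h)" if "(d, d') \<in> (dart_step (flow_rel n v h))\<^sup>*" for d d'
    using that by (induction rule: rtrancl_induct) (use st in auto)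
  then show ?thesis using D.path_last_step[OF p] by blast
qed

lemma path_level:
  assumes p: "epath (flow_rel n v h) p" and u: "u \<in> set p"
  shows "level v h u = level v h (hd p)"
proof -
  have ed: "\<And>i. Suc i < length p \<Longrightarrow> (p ! i, p ! Suc i) \<in> flow_rel n v h" and ne: "p \<noteq> []"
    using p by (auto simp: epath_def)
  have same: "level v h (p ! k) = level v h (p ! 0)" if "k < length p" for k
    using that
  proof (induction k)
    case (Suc k)
    then show ?case using level_edge[OF fl ed[OF Suc.prems]] by simp
  qed simp
  obtain k where "k < length p" "u = p ! k" using u by (auto simp: in_set_conv_nth)
  then show ?thesis using same[of k] hd_conv_nth[OF ne] by simp
qed

text \<open>Suppose \<open>j < i\<close> and reverse the path. The result is a flow with bottom word \<open>\<pi>'\<close>, which is \<open>\<pi>\<close> with a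
  \<open>1\<close> and a later \<open>0\<close> exchanged, so its degree is smaller than \<open>d(\<pi>) = d(\<sigma>) + d(\<tau>)\<close>. This contradicts
  \<open>excess_identity\<close>, since an excess is never negative.\<close>

lemma no_leftward_path:
  assumes p: "epath (flow_rel n v h) p" "hd p = external_end i" "last p = external_end j"
    and i: "1 \<le> i" "i \<le> 2 * n" "\<pi> ! (i - 1) = 0" and j: "1 \<le> j" "j \<le> 2 * n" "\<pi> ! (j - 1) = 1"
  shows "i < j"
proof (rule ccontr)
  assume "\<not> i < j"
  then have ji: "j < i" using i j by (cases "i = j") auto
  have ends: "end_of (flow_rel n v h) (hd p)" "end_of (flow_rel n v h) (last p)" using ext_edge(2) p i j by auto
  (* the vertices on the path form a component, so the edges at a vertex are all reversed or all kept;
     ghost edges are kept, because the vertices next to them have negative level *)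
  define C where "C x y \<longleftrightarrow> (int x, int y) \<in> set p" for x y
  have closed: "u \<in> set p \<longleftrightarrow> z \<in> set p" if "(u, z) \<in> flow_rel n v h" for u z
    using D.path_closed[OF p(1) ends] that sym_E[OF fl that] by blast
  have lvp: "0 \<le> level v h u" if "u \<in> set p" for u
    using path_level[OF p(1) that] ext_edge(7)[OF i(1,2)] p(2) by simp
  define v' where "v' x y = (if C x y then - v x y else v x y)" for x y
  define h' where "h' x y = (if tri n x y \<and> y < x \<and> C x y then - h x y else h x y)" for x y
  define \<pi>' where "\<pi>' = \<pi>[j - 1 := 0, i - 1 := 1]"
  have ok: "vertex_ok (v' x y) (v' x (Suc y)) (h' x y) (h' (Suc x) y)" if t: "tri n x y" for x y
  proof -
    have i1: "((int x, int y), q) \<in> flow_rel n v h \<longleftrightarrow> inflow n v h x y q \<noteq> 0" for q by (rule inflow_edge[OF fl t])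
    have up: "v' x (Suc y) = (if C x y then - v x (Suc y) else v x (Suc y))"
    proof (cases "v x (Suc y) = 0")
      case False
      then have "((int x, int y), (int x, int y + 1)) \<in> flow_rel n v h" using i1 inflow_simps(2) by simp
      from closed[OF this] have "C x y \<longleftrightarrow> C x (Suc y)" by (simp add: C_def add.commute)
      then show ?thesis by (simp add: v'_def)
    qed (simp add: v'_def)
    have left: "h' x y = (if C x y then - h x y else h x y)"
    proof (cases "h x y = 0 \<or> y < x")
      case True
      then show ?thesis using t by (auto simp: h'_def)
    next
      case False
      then have "x = y" using t by (auto simp: tri_def)
      then have "\<not> C x y" using ghost_vertex_left(1)[of y] t False lvp[of "(int y, int y)"] by (auto simp: C_def)
      then show ?thesis by (simp add: h'_def)
    qed
    have right: "h' (Suc x) y = (if C x y then - h (Suc x) y else h (Suc x) y)"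
    proof (cases "h (Suc x) y = 0")
      case False
      show ?thesis
      proof (cases "tri n (Suc x) y")
        case True
        then have "((int x, int y), (int x + 1, int y)) \<in> flow_rel n v h" using i1 inflow_simps(4) False by simp
        from closed[OF this] have "C x y \<longleftrightarrow> C (Suc x) y" by (simp add: C_def add.commute)
        then show ?thesis using True t by (simp add: h'_def tri_def)
      next
        case nt: False
        then have "x + y + 2 = 4 * n" using t by (auto simp: tri_def)
        from ghost_vertex_right(1)[OF t this False] lvp[of "(int x, int y)"] have "\<not> C x y" by (auto simp: C_def)
        then show ?thesis using nt by (simp add: h'_def)
      qed
    qed (simp add: h'_def)
    show ?thesis
      using flow_vertex[OF fl t] unfolding up left right by (auto simp: v'_def vertex_ok_def)
  qed
  have bottomC: "C (2 * k) 0 \<longleftrightarrow> k = i - 1 \<or> k = j - 1" if k: "k < 2 * n" for k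
  proof -
    have e: "external_end (Suc k) = external_end i \<longleftrightarrow> k = i - 1"
      "external_end (Suc k) = external_end j \<longleftrightarrow> k = j - 1"
      using i j by (auto simp: external_end_def)
    have "p \<noteq> []" using p(1) by (auto simp: epath_def)
    then have m: "hd p \<in> set p" "last p \<in> set p" by simp_all
    have "C (2 * k) 0 \<longleftrightarrow> external_end (Suc k) \<in> set p"
      using closed[OF ext_edge(1)[of "Suc k"]] k by (simp add: C_def)
    also have "\<dots> \<longleftrightarrow> external_end (Suc k) = hd p \<or> external_end (Suc k) = last p"
      using D.path_ends[OF p(1), of "external_end (Suc k)"] ext_edge(2)[of "Suc k"] k m by auto
    finally show ?thesis unfolding p e .
  qed
  have len: "length \<pi> = 2 * n" using balanced_words(3) by (simp add: balanced_def)
  have "flow n \<sigma> \<tau> \<pi>' v' h'"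
    unfolding flow_def
  proof (intro conjI allI impI)
    fix x y assume "\<not> tri n x y"
    then show "v' x y = 0" using flow_out[OF fl] by (simp add: v'_def)
  next
    fix x assume t: "tri n x 0"
    show "v' x 0 = (if odd x then 0 else if \<pi>' ! (x div 2) = 0 then 1 else - 1)"
    proof (cases "odd x")
      case True
      then have "v x 0 = 0" using fl t unfolding flow_def by simp
      then show ?thesis using True by (simp add: v'_def)
    next
      case False
      then obtain k where k: "x = 2 * k" by blast
      have kn: "k < 2 * n" using t k by (auto simp: tri_def)
      have "\<pi>' ! k = (if k = i - 1 then 1 else if k = j - 1 then 0 else \<pi> ! k)"
        using kn len by (simp add: \<pi>'_def nth_list_update)
      then show ?thesis using flow_bottom[OF kn] bottomC[OF kn] i j ji by (auto simp: v'_def k)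
    qed
  next
    fix y assume "y < 2 * n"
    then show "h' y y = of_bool (\<sigma> ! y = 1)" "h' (4 * n - 1 - y) y = of_bool (\<tau> ! (2 * n - 1 - y) = 0)"
      using ghost_left[of y] ghost_right[of y] by (auto simp: h'_def tri_def)
  qed (rule ok)
  moreover have sw: "word_degree \<pi>' < word_degree \<pi>" "balanced n \<pi>'"
  proof -
    have a: "j - 1 < i - 1" "i - 1 < length \<pi>" using ji i j len by auto
    note s = swap_letters[OF a j(3) i(3), folded \<pi>'_def]
    show "word_degree \<pi>' < word_degree \<pi>" by (rule s(1))
    show "balanced n \<pi>'" using balanced_words(3) s(2,3) by (auto simp: balanced_def \<pi>'_def)
  qed
  ultimately have id: "2 * int (word_degree \<pi>') = 2 * (int (word_degree \<sigma>) + int (word_degree \<tau>))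
    + (\<Sum>j<2 * n. \<Sum>x=j..<4 * n - 1 - j. vertex_excess v' h' x j)"
    using excess_identity[OF n] balanced_words by blast
  define S where "S = (\<Sum>j<2 * n. \<Sum>x=j..<4 * n - 1 - j. vertex_excess v' h' x j)"
  have "0 \<le> S" unfolding S_def by (intro sum_nonneg) (simp add: vertex_excess_def excess_nonneg)
  moreover have "int (word_degree \<sigma>) + int (word_degree \<tau>) = int (word_degree \<pi>)"
    using wd by (metis of_nat_add)
  moreover have "int (word_degree \<pi>') < int (word_degree \<pi>)" using sw(1) by simp
  ultimately show False using id[folded S_def] by presburger
qed

text \<open>Follow the path backwards from a letter \<open>1\<close>. Its level is nonnegative, so it cannot have entered from
  the left; it starts at a letter \<open>0\<close> of the same level, and levels of external edges are heights.\<close>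

lemma source_of_sink:
  assumes j: "1 \<le> j" "j \<le> 2 * n" "\<pi> ! (j - 1) = 1"
  obtains i p where "1 \<le> i" "i < j" "\<pi> ! (i - 1) = 0" "height \<pi> (i - 1) = height \<pi> j"
    "epath (flow_rel n v h) p" "hd p = external_end i" "last p = external_end j"
proof -
  from D.maximal_path[OF ext_edge(1,2)[OF j(1,2)]] obtain q where
    q: "epath (flow_rel n v h) q" "hd q = external_end j" "end_of (flow_rel n v h) (last q)" "q ! 1 = (int (2 * (j - 1)), 0)" by metis
  define p where "p = rev q"
  have p: "epath (flow_rel n v h) p" using D.path_rev q(1) by (simp add: p_def)
  have ne: "q \<noteq> []" "2 \<le> length q" using q(1) by (auto simp: epath_def)
  have pe: "hd p = last q" "last p = external_end j" "p ! (length p - 2) = q ! 1"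
    using ne q(2) by (auto simp: p_def hd_rev last_rev rev_nth)
  have "(p ! (length p - 2), last p) \<in> arcs n v h" using ext_edge(4)[OF j(1,2)] j(3) pe q(4) by simp
  then have out: "(hd p, p ! 1) \<in> arcs n v h" using path_arcs[OF p] by simp
  have "last p \<in> set p" using ne by (intro last_in_set) (simp add: p_def)
  then have lvl: "level v h (hd p) = height \<pi> j" using path_level[OF p] pe ext_edge(6)[OF j(1,2)] j(3) by simp
  have nn: "0 \<le> level v h (hd p)" using lvl height_nonneg[OF w(3) j(2)] by simp
  from D.path_first[OF p] q(3)[folded pe(1)] show thesis
  proof (cases rule: endpoint_cases)
    case (bottom i)
    have z: "\<pi> ! (i - 1) = 0"
    proof (rule ccontr)
      assume nz: "\<pi> ! (i - 1) \<noteq> 0"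
      have "p ! 1 = (int (2 * (i - 1)), 0)"
        using D.path_first[OF p] ext_edge(1,2)[OF bottom(1,2)] bottom(3) unfolding end_of_def by metis
      then show False using ext_edge(4)[OF bottom(1,2) nz] out bottom(3) arcs_antisym[OF fl D.path_first[OF p]] by simp
    qed
    have "i < j" using no_leftward_path[OF p bottom(3) pe(2) bottom(1,2) z j] .
    then show thesis using that[OF bottom(1) _ z _ p bottom(3) pe(2)] lvl ext_edge(5)[OF bottom(1,2) z] bottom(3) by simp
  qed (use nn in auto)
qed

text \<open>Let \<open>i'\<close> be the source of the path to \<open>j\<close>. It has the same height as \<open>i\<close>, and there is no such position
  between \<open>i\<close> and \<open>j\<close>, so \<open>i' \<le> i\<close>. If \<open>i' < i\<close>, then by induction the path from \<open>i'\<close> leads to the partner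
  of \<open>i'\<close>, which is not \<open>j\<close>.\<close>

theorem linked:
  assumes "matched \<pi> i j"
  shows "\<exists>p. epath (flow_rel n v h) p \<and> hd p = external_end i \<and> last p = external_end j"
  using assms
proof (induction i arbitrary: j rule: less_induct)
  case (less i)
  have ij: "1 \<le> i" "i < j" "j \<le> 2 * n" "height \<pi> (i - 1) = height \<pi> j"
    and between: "\<And>k. i \<le> k \<Longrightarrow> k < j \<Longrightarrow> height \<pi> j < height \<pi> k"
    using less.prems length_w[OF w(3)] by (auto simp: matched_def)
  have j: "1 \<le> j" "\<pi> ! (j - 1) = 1" using ij matched_letters[OF w(3) less.prems] by auto
  obtain i' p where s: "1 \<le> i'" "i' < j" "\<pi> ! (i' - 1) = 0" "height \<pi> (i' - 1) = height \<pi> j"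
    "epath (flow_rel n v h) p" "hd p = external_end i'" "last p = external_end j"
    using source_of_sink[OF j(1) ij(3) j(2)] by metis
  have "i' \<le> i"
  proof (rule ccontr)
    assume "\<not> i' \<le> i"
    then have "i \<le> i' - 1" "i' - 1 < j" using s(2) by linarith+
    then show False using between[of "i' - 1"] s(4) by simp
  qed
  moreover have "\<not> i' < i"
  proof
    assume lt: "i' < i"
    obtain l where "matched \<pi> i' l \<or> matched \<pi> l i'" using matched_exists[OF w(3), of i'] s ij by auto
    then have l: "matched \<pi> i' l" using matched_letters(2)[OF w(3), of l i'] s by auto
    obtain q where q: "epath (flow_rel n v h) q" "hd q = external_end i'" "last q = external_end l"
      using less.IH[OF lt l] by blast
    have le: "1 \<le> l" "l \<le> 2 * n" using l length_w[OF w(3)] by (auto simp: matched_def)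
    have "external_end j = external_end l"
      using D.path_end_unique[OF s(5) q(1)] s q ext_edge(2) ij j le by simp
    then have "j = l" by (simp add: external_end_def)
    then show False using matched_left_unique[OF w(3) less.prems, of i'] l lt by simp
  qed
  ultimately have "i' = i" by simp
  then show ?case using s by blast
qed

text \<open>Both ends of a path have the same level, so a negative level excludes external edges; and the
  orientation excludes two ends on the same side.\<close>

theorem left_right:
  assumes p: "epath (flow_rel n v h) p" and e: "end_of (flow_rel n v h) (hd p)" "end_of (flow_rel n v h) (last p)"
  shows "hd p \<in> left_vertices n \<Longrightarrow> last p \<in> right_vertices n"
    and "hd p \<in> right_vertices n \<Longrightarrow> last p \<in> left_vertices n"
proof -
  have f: "(hd p, p ! 1) \<in> flow_rel n v h" and l: "(last p, p ! (length p - 2)) \<in> flow_rel n v h"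
    using D.path_first[OF p] sym_E[OF fl D.path_last[OF p]] by auto
  have notext: "external_end i \<notin> left_vertices n" "external_end i \<notin> right_vertices n" for i
    by (auto simp: external_end_def left_vertices_def left_vertex_def right_vertices_def right_vertex_def)
  have lve: "level v h (last p) = level v h (hd p)" by (rule path_level[OF p], rule last_in_set) (use p in \<open>auto simp: epath_def\<close>)
  have nn: "0 \<le> level v h (external_end i)" if "1 \<le> i" "i \<le> 2 * n" for i using ext_edge(7) that .
  note anti = arcs_antisym[OF fl f] arcs_antisym[OF fl l] path_arcs[OF p]
  show "last p \<in> right_vertices n" if h: "hd p \<in> left_vertices n"
    using l e(2)
  proof (cases rule: endpoint_cases)
    case (bottom i)
    from f e(1) show ?thesis
      by (cases rule: endpoint_cases) (use h notext lve nn[OF bottom(1,2)] bottom(3) in auto)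
  next
    case left
    from f e(1) show ?thesis
      by (cases rule: endpoint_cases) (use h notext left anti in auto)
  qed
  show "last p \<in> left_vertices n" if h: "hd p \<in> right_vertices n"
    using l e(2)
  proof (cases rule: endpoint_cases)
    case (bottom i)
    from f e(1) show ?thesis
      by (cases rule: endpoint_cases) (use h notext lve nn[OF bottom(1,2)] bottom(3) in auto)
  next
    case right
    from f e(1) show ?thesis
      by (cases rule: endpoint_cases) (use h notext right anti in auto)
  qed
qed

end

section \<open>Flows of excess zero are TFPLs\<close>

lemma left_vertex_nat: "1 \<le> i \<Longrightarrow> left_vertex i = (int (i - 1), int (i - 1))"
  by (auto simp: left_vertex_def)

lemma right_vertex_nat:
  "1 \<le> i \<Longrightarrow> i \<le> 2 * n \<Longrightarrow> right_vertex n i = (int (4 * n - 2 - (2 * n - i)), int (2 * n - i))"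
  by (auto simp: right_vertex_def)

lemma inner_vertices_iff: 
  "p \<in> inner_vertices n \<longleftrightarrow> (\<exists>x y. p = (int x, int y) \<and> tri n x y \<and> y < x \<and> tri n (Suc x) y)"
proof
  assume p: "p \<in> inner_vertices n"
  then have "p \<in> triangle n" by (simp add: inner_vertices_def)
  then have e: "p = (int (nat (fst p)), int (nat (snd p)))" "tri n (nat (fst p)) (nat (snd p))"
    by (auto simp: triangle_def tri_def)
  obtain x y where xy: "p = (int x, int y)" "tri n x y" using e by blast
  have "p \<notin> left_vertices n" "p \<notin> right_vertices n" using p by (auto simp: inner_vertices_def)
  then have "\<not> (x = y \<and> y < 2 * n)" "\<not> (y < 2 * n \<and> x + y + 2 = 4 * n)"
    using left_vertices_iff right_vertices_iff xy(1) by blast+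
  then show "\<exists>x y. p = (int x, int y) \<and> tri n x y \<and> y < x \<and> tri n (Suc x) y"
    using xy by (intro exI[of _ x] exI[of _ y]) (auto simp: tri_def)
next
  assume "\<exists>x y. p = (int x, int y) \<and> tri n x y \<and> y < x \<and> tri n (Suc x) y"
  then obtain x y where xy: "p = (int x, int y)" "tri n x y" "y < x" "tri n (Suc x) y" by blast
  have "p \<notin> left_vertices n" "p \<notin> right_vertices n"
    unfolding xy(1) left_vertices_iff right_vertices_iff using xy by (auto simp: tri_def)
  then show "p \<in> inner_vertices n" using xy tri_triangle by (simp add: inner_vertices_def)
qed

text \<open>The first letter \<open>1\<close> of a level of a puzzle never gets closer to the left end when passing to the next
  level, and \<open>\<pi>\<close> starts with \<open>0\<close>. Symmetrically, the last \<open>0\<close> never gets closer to the right end, and \<open>\<pi>\<close>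
  ends with \<open>1\<close>. This is why the horizontal edges at the left and right vertices are present.\<close>

lemma boundary_vertical:
  assumes fl: "flow n \<sigma> \<tau> \<pi> v h" and ex: "\<And>x y. tri n x y \<Longrightarrow> vertex_excess v h x y = 0"
    and odd: "\<And>x y. odd (x + y) \<Longrightarrow> v x y = 0"
    and n: "1 \<le> n" and \<pi>: "\<pi> \<in> dyck_words n"
  shows "y < 2 * n \<Longrightarrow> v y y \<noteq> -1" and "y < 2 * n \<Longrightarrow> v (4 * n - 2 - y) y \<noteq> 1"
proof -
  note ok = flow_vertex[OF fl]
  have fb: "v (2 * k) 0 = (if \<pi> ! k = 0 then 1 else -1)" if "k < 2 * n" for k
    using fl that by (auto simp: flow_def tri_def)
  show "y < 2 * n \<Longrightarrow> v y y \<noteq> -1"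
  proof (induction y)
    case 0
    then show ?case using fb[of 0] dyck_first_last(1)[OF \<pi> n] by simp
  next
    case (Suc y)
    have t: "tri n y y" "tri n (Suc y) y" using Suc.prems by (auto simp: tri_def)
    have z: "v (Suc y) y = 0" "v y (Suc y) = 0" by (auto intro: odd)
    have g: "h y y = 0 \<or> h y y = 1" using fl Suc.prems by (auto simp: flow_def)
    have IH: "v y y \<noteq> -1" using Suc by simp
    show ?case
    proof
      assume "v (Suc y) (Suc y) = -1"
      then have "h (Suc y) y = 0 \<or> h (Suc y) y = -1"
        using ok[OF t(2)] z by (auto simp: vertex_ok_def)
      then show False using ok[OF t(1)] z g IH by (auto simp: vertex_ok_def)
    qed
  qed
  show "y < 2 * n \<Longrightarrow> v (4 * n - 2 - y) y \<noteq> 1"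
  proof (induction y)
    case 0
    have "4 * n - 2 = 2 * (2 * n - 1)" by simp
    then show ?case using fb[of "2 * n - 1"] dyck_first_last(2)[OF \<pi> n] n by simp
  next
    case (Suc y)
    define x where "x = 4 * n - 2 - Suc y"
    have x: "4 * n - 2 - y = Suc x" "Suc (Suc x) = 4 * n - 1 - y" using Suc.prems by (auto simp: x_def)
    have t: "tri n x y" "tri n (Suc x) y" using Suc.prems by (auto simp: tri_def x_def)
    have "even (x + Suc y)" using Suc.prems by (auto simp: x_def)
    then have z: "v x y = 0" "v (Suc x) (Suc y) = 0" by (auto intro: odd)
    have "h (4 * n - 1 - y) y = 0 \<or> h (4 * n - 1 - y) y = 1" using fl Suc.prems by (auto simp: flow_def)
    then have g: "h (Suc (Suc x)) y = 0 \<or> h (Suc (Suc x)) y = 1" using x by simp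
    have IH: "v (Suc x) y \<noteq> 1" using Suc x by simp
    have "v x (Suc y) \<noteq> 1"
    proof
      assume "v x (Suc y) = 1"
      then have "h (Suc x) y = 0 \<or> h (Suc x) y = -1"
        using ok[OF t(1)] z by (auto simp: vertex_ok_def)
      then show False using ok[OF t(2)] z g IH by (auto simp: vertex_ok_def)
    qed
    then show ?case by (simp add: x_def)
  qed
qed

lemma flow_graph_TFPL:
  assumes fl: "flow n \<sigma> \<tau> \<pi> v h" and ex: "\<And>x y. tri n x y \<Longrightarrow> vertex_excess v h x y = 0"
    and odd: "\<And>x y. odd (x + y) \<Longrightarrow> v x y = 0"
    and n: "1 \<le> n" and w: "\<sigma> \<in> dyck_words n" "\<tau> \<in> dyck_words n" "\<pi> \<in> dyck_words n"
    and wd: "word_degree \<sigma> + word_degree \<tau> = word_degree \<pi>"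
  shows "flow_graph n v h \<in> TFPL n \<sigma> \<tau> \<pi>"
proof -
  let ?G = "flow_graph n v h"
  note GT = flow_graph_triangle[OF fl]
  have bv: "v y y \<noteq> -1" "v (4 * n - 2 - y) y \<noteq> 1" if "y < 2 * n" for y
    using boundary_vertical[OF fl ex odd n w(3)] that by blast+
  have b: "balanced n \<sigma>" "balanced n \<tau>" using w by (auto intro: dyck_balanced)
  have gl: "h y y = of_bool (\<sigma> ! y = 1)" and gr: "h (4 * n - 1 - y) y = of_bool (\<tau> ! (2 * n - 1 - y) = 0)"
    if "y < 2 * n" for y using fl that by (auto simp: flow_def)
  have left: "h (Suc y) y \<noteq> 0 \<and> (v y y = 0 \<longleftrightarrow> \<sigma> ! y = 1)" if y: "y < 2 * n" for y
  proof -
    have t: "tri n y y" using y by (auto simp: tri_def)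
    have "v y (Suc y) = 0" by (auto intro: odd)
    then show ?thesis using flow_vertex[OF fl t] bv(1)[OF y] gl[OF y] by (auto simp: vertex_ok_def split: if_splits)
  qed
  have right: "h (4 * n - 2 - y) y \<noteq> 0 \<and> (v (4 * n - 2 - y) y = 0 \<longleftrightarrow> \<tau> ! (2 * n - 1 - y) = 0)" if y: "y < 2 * n" for y
  proof -
    have t: "tri n (4 * n - 2 - y) y" and s: "Suc (4 * n - 2 - y) = 4 * n - 1 - y" using y by (auto simp: tri_def)
    have "odd (4 * n - 2 - y + Suc y)" using y by auto
    then have "v (4 * n - 2 - y) (Suc y) = 0" by (rule odd)
    then show ?thesis using flow_vertex[OF fl t, unfolded s] bv(2)[OF y] gr[OF y] by (auto simp: vertex_ok_def split: if_splits)
  qed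
  have vl: "vedge_below (left_vertex i) \<in> ?G \<longleftrightarrow> \<sigma> ! (i - 1) \<noteq> 1" if i: "i \<in> {1..2 * n}" for i
  proof -
    have i': "1 \<le> i" "i - 1 < 2 * n" using i by auto
    moreover have "tri n (i - 1) (i - 1)" using i' by (auto simp: tri_def)
    ultimately show ?thesis using left[of "i - 1"] unfolding left_vertex_nat[OF i'(1)] vedge_flow_graph by blast
  qed
  have vr: "vedge_below (right_vertex n i) \<in> ?G \<longleftrightarrow> \<tau> ! (i - 1) \<noteq> 0" if i: "i \<in> {1..2 * n}" for i
  proof -
    have i': "1 \<le> i" "i \<le> 2 * n" "2 * n - i < 2 * n" "2 * n - 1 - (2 * n - i) = i - 1" using i by auto
    have "tri n (4 * n - 2 - (2 * n - i)) (2 * n - i)" using i' by (auto simp: tri_def)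
    then show ?thesis using right[OF i'(3)] unfolding right_vertex_nat[OF i'(1,2)] vedge_flow_graph i'(4) by metis
  qed
  have "imposed_edges n \<sigma> \<tau> \<subseteq> ?G"
  proof -
    have "external_edge i \<in> ?G" if "i \<in> {1..2 * n}" for i
    proof -
      have e: "external_edge i = vedge_below (int (2 * (i - 1)), int 0)" using that by (auto simp: external_edge_def)
      have "tri n (2 * (i - 1)) 0" using that by (auto simp: tri_def)
      moreover from this have "v (2 * (i - 1)) 0 \<noteq> 0" using fl by (auto simp: flow_def)
      ultimately show ?thesis unfolding e vedge_flow_graph by blast
    qed
    moreover have "hedge_right (int i, int i) \<in> ?G" if "i \<le> 2 * n - 2" for i
      using hedge_flow_graph[of "Suc i" i n v h] left[of i] that n by (auto simp: tri_def)
    moreover have "hedge_right (4 * int n - 3 - int i, int i) \<in> ?G" if "i \<le> 2 * n - 2" for i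
    proof -
      have "4 * int n - 3 - int i = int (4 * n - 2 - i) - 1" using that n by auto
      moreover have "tri n (4 * n - 2 - i) i" "i < 4 * n - 2 - i" "h (4 * n - 2 - i) i \<noteq> 0"
        using right[of i] that n by (auto simp: tri_def)
      ultimately show ?thesis by (simp only: hedge_flow_graph) simp
    qed
    moreover have "vedge_below (left_vertex i) \<in> ?G" if "i \<in> {1..2 * n}" "\<sigma> ! (i - 1) = 0" for i
      using vl that by simp
    moreover have "vedge_below (right_vertex n i) \<in> ?G" if "i \<in> {1..2 * n}" "\<tau> ! (i - 1) = 1" for i
      using vr that by simp
    ultimately show ?thesis unfolding imposed_edges_def by blast
  qed
  moreover have "?G \<inter> forbidden_edges n \<sigma> \<tau> = {}"
    unfolding forbidden_edges_def using vl vr by blast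
  moreover have "vertex_degree ?G p = 2" if pin: "p \<in> inner_vertices n" for p
  proof -
    obtain x y where p: "p = (int x, int y)" "tri n x y" "y < x" "tri n (Suc x) y"
      using pin unfolding inner_vertices_iff by blast
    have "\<bar>v x y\<bar> + \<bar>v x (Suc y)\<bar> + \<bar>h x y\<bar> + \<bar>h (Suc x) y\<bar> = 2"
      using flow_vertex[OF fl p(2)] by (simp add: vertex_ok_def)
    then show ?thesis using degree_tri[OF fl p(2)] p unfolding vertex_degree_card[OF GT] by simp
  qed
  moreover have "\<exists>p. graph_path ?G p \<and> hd p = external_end i \<and> last p = external_end j"
    if "{i, j} \<in> link_pattern n \<pi>" for i j
  proof -
    interpret D: degree2 "edge_rel ?G" by (rule degree2_flow[OF fl])
    have *: "\<exists>p. graph_path ?G p \<and> hd p = external_end i \<and> last p = external_end j" 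
      "\<exists>p. graph_path ?G p \<and> hd p = external_end j \<and> last p = external_end i" if m: "matched \<pi> i j" for i j
    proof -
      obtain p where p: "epath (edge_rel ?G) p" "hd p = external_end i" "last p = external_end j"
        using linked[OF fl n w wd m] by blast
      have l: "2 \<le> length p" using p by (simp add: epath_def)
      show "\<exists>p. graph_path ?G p \<and> hd p = external_end i \<and> last p = external_end j"
        using p graph_path_epath[OF l, of ?G] by blast
      have "graph_path ?G (rev p)" using D.path_rev[OF p(1)] graph_path_epath[of "rev p" ?G] l by simp
      moreover have "hd (rev p) = external_end j" "last (rev p) = external_end i"
        using p l by (auto simp: hd_rev last_rev)
      ultimately show "\<exists>p. graph_path ?G p \<and> hd p = external_end j \<and> last p = external_end i" by blast
    qed
    have "matched \<pi> i j \<or> matched \<pi> j i"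
      using that unfolding link_pattern_eq[OF w(3)] by (auto simp: doubleton_eq_iff)
    then show ?thesis using *[of i j] *[of j i] by blast
  qed
  moreover have "(hd p \<in> left_vertices n \<longrightarrow> last p \<in> right_vertices n) \<and>
      (hd p \<in> right_vertices n \<longrightarrow> last p \<in> left_vertices n)" if fp: "full_path ?G p" for p
  proof -
    interpret D: degree2 "edge_rel ?G" by (rule degree2_flow[OF fl])
    have l: "2 \<le> length p" using fp by (simp add: full_path_def)
    have e: "epath (edge_rel ?G) p" using fp graph_path_epath[OF l] by (simp add: full_path_def)
    have "end_of (edge_rel ?G) (hd p)"
      using end_of_card[OF GT D.path_first[OF e]] fp by (simp add: full_path_def)
    moreover have "end_of (edge_rel ?G) (last p)"
      using end_of_card[OF GT D.symE[OF D.path_last[OF e]]] fp by (simp add: full_path_def)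
    ultimately show ?thesis using left_right[OF fl n w wd e] by blast
  qed
  ultimately show ?thesis using GT unfolding TFPL_def mem_Collect_eq by blast
qed

section \<open>Injectivity\<close>

text \<open>Two consecutive steps to the left being excluded, an upward piece is determined by its bottom label
  and by the presence of the horizontal edge on its left.\<close>

lemma up_determined:
  assumes "vertex_ok s 0 l r" "excess True s 0 l r = 0" "vertex_ok s 0 l' r'" "excess True s 0 l' r' = 0"
    "l = 0 \<longleftrightarrow> l' = 0"
  shows "l = l' \<and> r = r'"
proof -
  have c: "s + l = r" "s + l' = r'" "\<bar>s\<bar> + \<bar>l\<bar> + \<bar>r\<bar> = 2" "\<bar>s\<bar> + \<bar>l'\<bar> + \<bar>r'\<bar> = 2"
    "s \<in> {-1, 0, 1}" "l \<in> {-1, 0, 1}" "l' \<in> {-1, 0, 1}"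
    using assms by (auto simp: vertex_ok_def)
  have "\<not> (l = -1 \<and> r = -1)" "\<not> (l' = -1 \<and> r' = -1)"
    using assms(2,4) by (auto simp: excess_def Let_def split: if_splits)
  then have "l = l'" using c assms(5) by auto
  then show ?thesis using c by simp
qed

text \<open>A downward piece is not determined by its left label and the graph: a path that comes down and turns
  to the right uses the same edges as one that comes from the right and turns up. But every horizontal
  edge also belongs to an upward piece, and these determine the row from the bottom labels; conservation
  then gives the labels of the next level.\<close>

theorem Phi_inj:
  assumes b: "balanced n \<sigma>" "balanced n \<tau>" "balanced n \<pi>"
  shows "inj_on (Phi n) (KT n \<sigma> \<tau> \<pi>)"
proof (rule inj_onI)
  fix P Q assume PQ: "P \<in> KT n \<sigma> \<tau> \<pi>" "Q \<in> KT n \<sigma> \<tau> \<pi>" and eq: "Phi n P = Phi n Q"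
  define v h v' h' where "v = puzzle_vert n P" and "h = puzzle_hor P"
    and "v' = puzzle_vert n Q" and "h' = puzzle_hor Q"
  note P = puzzle_to_flow[OF PQ(1) b, folded v_def h_def]
  note Q = puzzle_to_flow[OF PQ(2) b, folded v'_def h'_def]
  have G: "flow_graph n v h = flow_graph n v' h'"
    using Phi_encodes[OF P(1)] Phi_encodes[OF Q(1)] eq by simp
  have hz: "h x y = 0 \<longleftrightarrow> h' x y = 0" if "tri n x y" "y < x" for x y
    using hedge_flow_graph[of x y n v h] hedge_flow_graph[of x y n v' h'] G that by simp
  have odd: "v x y = 0" "v' x y = 0" if "odd (x + y)" for x y
    using P(1) Q(1) that unfolding encodes_def by blast+
  have hrow: "h (y + 2 * k) y = h' (y + 2 * k) y \<and> h (y + 2 * k + 1) y = h' (y + 2 * k + 1) y"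
    if v: "\<And>x. v x y = v' x y" and k: "y + k < 2 * n" for y k
  proof -
    let ?x = "y + 2 * k"
    have t: "tri n ?x y" using k by (auto simp: tri_def)
    have z: "v ?x (Suc y) = 0" "v' ?x (Suc y) = 0" by (auto intro: odd)
    have ok: "vertex_ok (v ?x y) 0 (h ?x y) (h (Suc ?x) y)" "vertex_ok (v ?x y) 0 (h' ?x y) (h' (Suc ?x) y)"
      using flow_vertex[OF P(2) t] flow_vertex[OF Q(2) t] z v[of ?x] by simp_all
    have ex: "excess True (v ?x y) 0 (h ?x y) (h (Suc ?x) y) = 0" "excess True (v ?x y) 0 (h' ?x y) (h' (Suc ?x) y) = 0"
      using P(3)[OF t] Q(3)[OF t] z v[of ?x] by (simp_all add: vertex_excess_def)
    have "h ?x y = 0 \<longleftrightarrow> h' ?x y = 0"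
    proof (cases "k = 0")
      case True
      then show ?thesis using P(2) Q(2) k by (simp add: flow_def)
    qed (use hz[OF t] in simp)
    then show ?thesis using up_determined[OF ok(1) ex(1) ok(2) ex(2)] by simp
  qed
  have vrow: "\<forall>x. v x y = v' x y" for y
  proof (induction y)
    case 0
    have "v x 0 = v' x 0" for x
    proof (cases "tri n x 0")
      case True
      then show ?thesis using P(2) Q(2) by (simp add: flow_def)
    next
      case False
      then show ?thesis using flow_out[OF P(2)] flow_out[OF Q(2)] by simp
    qed
    then show ?case by blast
  next
    case (Suc y)
    have "v x (Suc y) = v' x (Suc y)" for x
    proof (cases "tri n x (Suc y) \<and> even (x + Suc y)")
      case True
      then have t: "tri n x (Suc y)" and e: "even (x + Suc y)" by auto
      from t obtain k where k: "x = y + 2 * k + 1" "y + k + 1 < 2 * n"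
      proof (cases rule: tri_cases)
        case (A j k)
        then show thesis using that[of k] by auto
      next
        case (B j k)
        then show thesis using e by simp
      qed
      have t': "tri n x y" using t by (auto simp: tri_def)
      have "h x y = h' x y" using hrow[of y k] Suc k by simp
      moreover have "h (Suc x) y = h' (Suc x) y" using hrow[of y "Suc k"] Suc k by simp
      moreover have "v x y = v' x y" using Suc by simp
      ultimately show ?thesis
        using flow_vertex[OF P(2) t'] flow_vertex[OF Q(2) t'] by (simp add: vertex_ok_def)
    next
      case False
      then show ?thesis using odd[of x "Suc y"] flow_out[OF P(2), of x "Suc y"] flow_out[OF Q(2), of x "Suc y"] by auto
    qed
    then show ?case by blast
  qed
  have lab: "P e = Q e" if "e \<in> unit_edges n" for e
  proof (cases e)
    case (BottomU j k)
    then show ?thesis using that P(1) Q(1) vrow[of j] by (simp add: encodes_def)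
  next
    case (LeftU j k)
    then show ?thesis using that P(1) Q(1) hrow[of j k] vrow[of j] by (simp add: encodes_def)
  next
    case (RightU j k)
    then show ?thesis using that P(1) Q(1) hrow[of j k] vrow[of j] by (simp add: encodes_def)
  qed
  show "P = Q"
    using PQ lab by (intro PiE_ext[of P "unit_edges n" "\<lambda>_. {0, 1, 2}" Q]) (auto simp: KT_def)
qed

section \<open>Orienting a TFPL\<close>

lemma vertex_okI:
  fixes s n l r :: int
  assumes "s \<in> {-1, 0, 1}" "n \<in> {-1, 0, 1}" "l \<in> {-1, 0, 1}" "r \<in> {-1, 0, 1}"
    and "\<bar>s\<bar> + \<bar>n\<bar> + \<bar>l\<bar> + \<bar>r\<bar> = 2"
    and "s \<noteq> 0 \<Longrightarrow> n \<noteq> 0 \<Longrightarrow> s = n" "s \<noteq> 0 \<Longrightarrow> l \<noteq> 0 \<Longrightarrow> s = - l" "s \<noteq> 0 \<Longrightarrow> r \<noteq> 0 \<Longrightarrow> s = r"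
    and "n \<noteq> 0 \<Longrightarrow> l \<noteq> 0 \<Longrightarrow> n = l" "n \<noteq> 0 \<Longrightarrow> r \<noteq> 0 \<Longrightarrow> n = - r" "l \<noteq> 0 \<Longrightarrow> r \<noteq> 0 \<Longrightarrow> l = r"
  shows "vertex_ok s n l r"
proof -
  have "s + l = n + r"
    using assms by (cases "s = 0"; cases "n = 0"; cases "l = 0"; cases "r = 0") auto
  then show ?thesis using assms(1-5) by (simp add: vertex_ok_def)
qed

text \<open>The conditions on the paths say that the paths starting at external edges with letter \<open>0\<close> or at left
  vertices end at external edges with letter \<open>1\<close> or at right vertices, and conversely. This is what
  \<open>orientation_exists\<close> needs. Afterwards the edges in the chosen orientation are recorded as a flow,
  with the prescribed ghost edges.\<close>

theorem TFPL_flow: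
  assumes n: "1 \<le> n" and w: "\<sigma> \<in> dyck_words n" "\<tau> \<in> dyck_words n" "\<pi> \<in> dyck_words n"
    and G: "G \<in> TFPL n \<sigma> \<tau> \<pi>"
  obtains v h where "flow n \<sigma> \<tau> \<pi> v h" "flow_graph n v h = G"
proof -
  define E where "E = edge_rel G"
  have GT: "G \<subseteq> triangle_edges n" and imp: "imposed_edges n \<sigma> \<tau> \<subseteq> G"
    and forb: "G \<inter> forbidden_edges n \<sigma> \<tau> = {}"
    and inner: "\<And>p. p \<in> inner_vertices n \<Longrightarrow> vertex_degree G p = 2"
    and link: "\<And>i j. {i, j} \<in> link_pattern n \<pi> \<Longrightarrow>
        \<exists>p. graph_path G p \<and> hd p = external_end i \<and> last p = external_end j"
    and lr: "\<And>p. full_path G p \<Longrightarrow> hd p \<in> left_vertices n \<Longrightarrow> last p \<in> right_vertices n"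
    and rl: "\<And>p. full_path G p \<Longrightarrow> hd p \<in> right_vertices n \<Longrightarrow> last p \<in> left_vertices n"
    using G unfolding TFPL_def by blast+
  have b: "balanced n \<sigma>" "balanced n \<tau>" "balanced n \<pi>" using w by (auto intro: dyck_balanced)
  have tv: "\<exists>x y. a = int x \<and> c = int y \<and> tri n x y \<and> (y = 0 \<longrightarrow> even x)" if "{(a, c - 1), (a, c)} \<in> G" for a c
    using that GT unfolding triangle_edges_eq by (auto simp: vert_edge_iff dest!: subsetD)
  have th: "\<exists>x y. a = int x \<and> c = int y \<and> tri n x y \<and> y < x" if "{(a - 1, c), (a, c)} \<in> G" for a c
    using that GT unfolding triangle_edges_eq by (auto simp: hor_edge_iff dest!: subsetD)
  let ?S = "\<lambda>x y. ((int x, int y), (int x, int y - 1))" and ?N = "\<lambda>x y. ((int x, int y), (int x, int y + 1))"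
    and ?W = "\<lambda>x y. ((int x, int y), (int x - 1, int y))" and ?E = "\<lambda>x y. ((int x, int y), (int x + 1, int y))"
  have eS: "?S x y \<in> E \<longleftrightarrow> vedge_below (int x, int y) \<in> G" for x y
    by (auto simp: E_def edge_rel_def vedge_below_def insert_commute)
  have eN: "?N x y \<in> E \<longleftrightarrow> vedge_below (int x, int (Suc y)) \<in> G" for x y
    by (auto simp: E_def edge_rel_def vedge_below_def add.commute)
  have eW: "?W x y \<in> E \<longleftrightarrow> hedge_right (int x - 1, int y) \<in> G" for x y
    by (auto simp: E_def edge_rel_def hedge_right_def insert_commute)
  have eE: "?E x y \<in> E \<longleftrightarrow> hedge_right (int x, int y) \<in> G" for x y
    by (auto simp: E_def edge_rel_def hedge_right_def)
  have noN: "?N x y \<notin> E" if "\<not> tri n x (Suc y)" for x y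
    unfolding eN vedge_below_def fst_conv snd_conv
    using tv[of "int x" "int (Suc y)"] that by (metis of_nat_eq_iff)
  have noW: "?W x y \<notin> E" if "\<not> y < x" for x y
    unfolding eW hedge_right_def fst_conv snd_conv diff_add_cancel
    using th[of "int x" "int y"] that by (metis of_nat_eq_iff)
  have noE: "?E x y \<notin> E" if "\<not> tri n (Suc x) y" for x y
  proof -
    have "int x = int (Suc x) - 1" "int x + 1 = int (Suc x)" by simp_all
    then have "hedge_right (int x, int y) = {(int (Suc x) - 1, int y), (int (Suc x), int y)}"
      by (simp add: hedge_right_def add.commute)
    then show ?thesis using th[of "int (Suc x)" "int y"] that unfolding eE by (metis of_nat_eq_iff)
  qed
  have deg: "card (E `` {(int x, int y)}) = of_bool (?S x y \<in> E) + of_bool (?N x y \<in> E) + of_bool (?W x y \<in> E) + of_bool (?E x y \<in> E)" for x y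
    using edge_rel_card4(2)[OF GT, of "(int x, int y)"] unfolding E_def by simp
  have outside: "card (E `` {p}) \<le> 1" if p: "\<nexists>x y. p = (int x, int y) \<and> tri n x y" for p
  proof -
    obtain a c where pe: "p = (a, c)" by (cases p)
    have "(p, (a, c - 1)) \<notin> E" using tv[of a c] p pe by (auto simp: E_def edge_rel_def insert_commute)
    moreover have "(p, (a - 1, c)) \<notin> E" using th[of a c] p pe by (auto simp: E_def edge_rel_def insert_commute)
    moreover have "(p, (a + 1, c)) \<notin> E"
    proof
      assume "(p, (a + 1, c)) \<in> E"
      then have "{(a + 1 - 1, c), (a + 1, c)} \<in> G" using pe by (auto simp: E_def edge_rel_def)
      then obtain x y where "a + 1 = int x" "c = int y" "tri n x y" "y < x" using th by blast
      then have "p = (int (x - 1), int y)" "tri n (x - 1) y" using pe by (auto simp: tri_def)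
      then show False using p by blast
    qed
    ultimately show ?thesis
      using edge_rel_card4(2)[OF GT, of p] pe unfolding E_def by simp
  qed
  have S_left: "?S y y \<in> E \<longleftrightarrow> \<sigma> ! y = 0" if y: "y < 2 * n" for y
  proof -
    have e: "vedge_below (int y, int y) = vedge_below (left_vertex (Suc y))" and i: "Suc y \<in> {1..2 * n}"
      using y by (auto simp: left_vertex_def)
    show ?thesis
    proof (cases "\<sigma> ! y = 0")
      case True
      then have "vedge_below (left_vertex (Suc y)) \<in> imposed_edges n \<sigma> \<tau>"
        using i unfolding imposed_edges_def by fastforce
      then show ?thesis using True imp e by (auto simp: eS)
    next
      case False
      then have "\<sigma> ! y = 1" using balanced_letter[OF b(1) y] by simp
      then have "vedge_below (left_vertex (Suc y)) \<in> forbidden_edges n \<sigma> \<tau>"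
        using i unfolding forbidden_edges_def by fastforce
      then show ?thesis using False forb e by (auto simp: eS)
    qed
  qed
  have S_right: "?S (4 * n - 2 - y) y \<in> E \<longleftrightarrow> \<tau> ! (2 * n - 1 - y) = 1" if y: "y < 2 * n" for y
  proof -
    have i: "2 * n - y \<in> {1..2 * n}" and k: "2 * n - 1 - y = (2 * n - y) - 1"
      and yy: "2 * n - (2 * n - y) = y" using y by auto
    have e: "vedge_below (int (4 * n - 2 - y), int y) = vedge_below (right_vertex n (2 * n - y))"
      using right_vertex_nat[of "2 * n - y" n] i unfolding yy by simp
    show ?thesis
    proof (cases "\<tau> ! (2 * n - 1 - y) = 1")
      case True
      then have "vedge_below (right_vertex n (2 * n - y)) \<in> imposed_edges n \<sigma> \<tau>"
        unfolding imposed_edges_def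
        by (intro UnI2 CollectI exI[of _ "2 * n - y"] conjI refl i) (use True k in simp)
      then show ?thesis using True imp e by (auto simp: eS)
    next
      case False
      then have "\<tau> ! (2 * n - 1 - y) = 0" using balanced_letter[OF b(2), of "2 * n - 1 - y"] y by auto
      then have "vedge_below (right_vertex n (2 * n - y)) \<in> forbidden_edges n \<sigma> \<tau>"
        unfolding forbidden_edges_def
        by (intro UnI2 CollectI exI[of _ "2 * n - y"] conjI refl i) (use k in simp)
      then show ?thesis using False forb e by (auto simp: eS)
    qed
  qed
  have E_left: "?E y y \<in> E" if "y < 2 * n - 1" for y
  proof -
    have "hedge_right (int y, int y) \<in> imposed_edges n \<sigma> \<tau>"
      using that unfolding imposed_edges_def by auto
    then show ?thesis using imp by (auto simp: eE)
  qed
  have W_right: "?W (4 * n - 2 - y) y \<in> E" if "y < 2 * n - 1" for y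
  proof -
    have e: "int (4 * n - 2 - y) - 1 = 4 * int n - 3 - int y" and "y \<le> 2 * n - 2" using that by auto
    then have "hedge_right (int (4 * n - 2 - y) - 1, int y) \<in> imposed_edges n \<sigma> \<tau>"
      unfolding imposed_edges_def e by blast
    then show ?thesis unfolding eW using imp by blast
  qed
  have bnd: "y < 2 * n" "x = 4 * n - 2 - y" "\<not> tri n x (Suc y)" if "tri n x y" "\<not> tri n (Suc x) y" for x y
    using that by (auto simp: tri_def)
  have deg_le: "card (E `` {p}) \<le> 2" for p
  proof (cases "\<exists>x y. p = (int x, int y) \<and> tri n x y")
    case False
    then show ?thesis using outside[of p] by simp
  next
    case True
    then obtain x y where p: "p = (int x, int y)" "tri n x y" by blast
    consider "\<not> y < x" | "\<not> tri n (Suc x) y" | "y < x" "tri n (Suc x) y" by blast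
    then show ?thesis
    proof cases
      case 1
      then have "\<not> tri n x (Suc y)" by (auto simp: tri_def)
      then show ?thesis using deg[of x y] noN[of x y] noW[OF 1] p by simp
    next
      case 2
      then show ?thesis using deg[of x y] noN[OF bnd(3)[OF p(2) 2]] noE[OF 2] p by simp
    next
      case 3
      then have "p \<in> inner_vertices n" using p inner_vertices_iff by blast
      then show ?thesis using inner vertex_degree_card[OF GT] by (simp add: E_def)
    qed
  qed
  interpret D: degree2 E unfolding E_def by (rule degree2_edge_rel[OF GT]) (use deg_le in \<open>simp add: E_def\<close>)
  have end1: "end_of E p" if "card (E `` {p}) \<le> 1" for p
  proof -
    have "finite (E `` {p})" using edge_rel_card4(1)[OF GT] by (simp add: E_def)
    then show ?thesis using that unfolding end_of_def by (metis Image_singleton_iff card_le_Suc0_iff_eq One_nat_def)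
  qed
  have ext_end: "end_of E (external_end i)" for i
    by (rule end1, rule outside) (auto simp: external_end_def)
  have ext_edge: "(external_end i, (int (2 * (i - 1)), 0)) \<in> E" if "1 \<le> i" "i \<le> 2 * n" for i
  proof -
    have "external_edge i \<in> imposed_edges n \<sigma> \<tau>" using that unfolding imposed_edges_def by fastforce
    moreover have "external_edge i = {external_end i, (int (2 * (i - 1)), 0)}"
      using that by (auto simp: external_edge_def vedge_below_def external_end_def)
    ultimately show ?thesis using imp by (auto simp: E_def edge_rel_def external_end_def)
  qed
  have full: "full_path G p" if p: "epath E p" "end_of E (hd p)" "end_of E (last p)" for p
  proof -
    have "2 \<le> length p" using p by (simp add: epath_def)
    moreover have "graph_path G p" using graph_path_epath[OF calculation, of G] p by (simp add: E_def)
    moreover have "vertex_degree G (hd p) = 1"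
      using end_of_card[OF GT] D.path_first[OF p(1)] p(2) unfolding E_def by blast
    moreover have "vertex_degree G (last p) = 1"
      using end_of_card[OF GT] D.symE[OF D.path_last[OF p(1)]] p(3) unfolding E_def by blast
    ultimately show ?thesis by (simp add: full_path_def)
  qed
  have left_end: "y < 2 * n - 1 \<and> \<sigma> ! y = 1" if y: "y < 2 * n" "((int y, int y), q) \<in> E" "end_of E (int y, int y)" for y q
  proof -
    have nN: "\<not> tri n y (Suc y)" by (simp add: tri_def)
    have "y \<noteq> 2 * n - 1"
    proof
      assume a: "y = 2 * n - 1"
      then have "\<not> tri n (Suc y) y" by (auto simp: tri_def)
      moreover have "\<sigma> ! y \<noteq> 0" using a dyck_first_last(2)[OF w(1) n] by simp
      ultimately have "card (E `` {(int y, int y)}) = 0"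
        using deg[of y y] noN[OF nN] noW[of y y] noE[of y y] S_left[OF y(1)] by simp
      then have "E `` {(int y, int y)} = {}" using edge_rel_card4(1)[OF GT, of "(int y, int y)"] by (simp add: E_def)
      then show False using y(2) by auto
    qed
    then have l: "y < 2 * n - 1" using y(1) by simp
    have "\<sigma> ! y \<noteq> 0"
    proof
      assume "\<sigma> ! y = 0"
      then have "?S y y \<in> E" using S_left[OF y(1)] by simp
      with E_left[OF l] y(3) have "(int y + 1, int y) = (int y, int y - 1)" unfolding end_of_def by blast
      then show False by simp
    qed
    then show ?thesis using l balanced_letter[OF b(1) y(1)] by simp
  qed
  have right_end: "y < 2 * n - 1 \<and> \<tau> ! (2 * n - 1 - y) = 0"
    if y: "y < 2 * n" "((int (4 * n - 2 - y), int y), q) \<in> E" "end_of E (int (4 * n - 2 - y), int y)" for y q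
  proof -
    let ?x = "4 * n - 2 - y"
    have nE: "\<not> tri n (Suc ?x) y" "\<not> tri n ?x (Suc y)" using y by (auto simp: tri_def)
    have "y \<noteq> 2 * n - 1"
    proof
      assume a: "y = 2 * n - 1"
      then have "\<not> y < ?x" by auto
      moreover have "\<tau> ! (2 * n - 1 - y) \<noteq> 1" using a dyck_first_last(1)[OF w(2) n] by simp
      ultimately have "card (E `` {(int ?x, int y)}) = 0"
        using deg[of ?x y] noN[OF nE(2)] noW[of y ?x] noE[OF nE(1)] S_right[OF y(1)] by simp
      then have "E `` {(int ?x, int y)} = {}" using edge_rel_card4(1)[OF GT, of "(int ?x, int y)"] by (simp add: E_def)
      then show False using y(2) by blast
    qed
    then have l: "y < 2 * n - 1" using y(1) by simp
    have "\<tau> ! (2 * n - 1 - y) \<noteq> 1"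
    proof
      assume "\<tau> ! (2 * n - 1 - y) = 1"
      then have "?S ?x y \<in> E" using S_right[OF y(1)] by simp
      with W_right[OF l] y(3) have "(int ?x - 1, int y) = (int ?x, int y - 1)" unfolding end_of_def by blast
      then show False by simp
    qed
    then show ?thesis using l balanced_letter[OF b(2), of "2 * n - 1 - y"] y(1) by auto
  qed
  (* the apex is excluded from both sets: both of its edges are ghost edges *)
  define A where "A = {external_end i | i. 1 \<le> i \<and> i \<le> 2 * n \<and> \<pi> ! (i - 1) = 0} \<union>
    {(int y, int y) | y. y < 2 * n - 1 \<and> \<sigma> ! y = 1}"
  define B where "B = {external_end i | i. 1 \<le> i \<and> i \<le> 2 * n \<and> \<pi> ! (i - 1) = 1} \<union>
    {(int (4 * n - 2 - y), int y) | y. y < 2 * n - 1 \<and> \<tau> ! (2 * n - 1 - y) = 0}"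
  have ends: "end_of E s" if s: "s \<in> A \<union> B" for s
  proof -
    have "end_of E (int y, int y)" if "y < 2 * n - 1" "\<sigma> ! y = 1" for y
    proof (rule end1)
      have "\<not> tri n y (Suc y)" by (simp add: tri_def)
      then show "card (E `` {(int y, int y)}) \<le> 1"
        using deg[of y y] noN[of y y] noW[of y y] S_left[of y] that by simp
    qed
    moreover have "end_of E (int (4 * n - 2 - y), int y)" if "y < 2 * n - 1" "\<tau> ! (2 * n - 1 - y) = 0" for y
    proof (rule end1)
      have "\<not> tri n (4 * n - 2 - y) (Suc y)" "\<not> tri n (Suc (4 * n - 2 - y)) y" using that by (auto simp: tri_def)
      then show "card (E `` {(int (4 * n - 2 - y), int y)}) \<le> 1"
        using deg[of "4 * n - 2 - y" y] noN[of "4 * n - 2 - y" y] noE[of "4 * n - 2 - y" y] S_right[of y] that by simp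
    qed
    ultimately show ?thesis using s ext_end unfolding A_def B_def by blast
  qed
  have disj: "A \<inter> B = {}"
    unfolding A_def B_def by (auto simp: external_end_def)
  have chain: "((hd p, p ! 1), (p ! (length p - 2), last p)) \<in> (dart_step E)\<^sup>*" if "epath E p" for p
    using D.path_last_step that .
  have linkE: "\<exists>c. ((external_end i, a), (c, external_end j)) \<in> (dart_step E)\<^sup>*"
    if ij: "{i, j} \<in> link_pattern n \<pi>" "i \<noteq> j" and a: "(external_end i, a) \<in> E" for i j a
  proof -
    obtain p where p: "graph_path G p" "hd p = external_end i" "last p = external_end j" using link[OF ij(1)] by blast
    have "external_end i \<noteq> external_end j" using ij(2) by (simp add: external_end_def)
    then have "hd p \<noteq> last p" using p by simp
    then have l: "2 \<le> length p" using p(1) by (cases p; cases "tl p") (auto simp: graph_path_def)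
    then have e: "epath E p" using graph_path_epath p(1) by (simp add: E_def)
    have pa: "p ! 1 = a" using D.path_first[OF e] a ext_end[of i] unfolding p(2) end_of_def by blast
    show ?thesis using chain[OF e] unfolding p(2,3) pa by blast
  qed
  have matched_link: "{i, j} \<in> link_pattern n \<pi>" "{j, i} \<in> link_pattern n \<pi>" if "matched \<pi> i j" for i j
    using that unfolding link_pattern_eq[OF w(3)] by (auto simp: insert_commute)
  have AB: "\<exists>t\<in>B. \<exists>c. ((s, a), (c, t)) \<in> (dart_step E)\<^sup>*" if s: "s \<in> A" "(s, a) \<in> E" for s a
  proof -
    from s(1) consider (bot) i where "s = external_end i" "1 \<le> i" "i \<le> 2 * n" "\<pi> ! (i - 1) = 0"
      | (lft) y where "s = (int y, int y)" "y < 2 * n - 1" "\<sigma> ! y = 1"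
      unfolding A_def by blast
    then show ?thesis
    proof cases
      case bot
      then obtain j where "matched \<pi> i j"
        using matched_exists[OF w(3), of i] matched_letters(2)[OF w(3), of _ i] by auto
      then have j: "{i, j} \<in> link_pattern n \<pi>" "i \<noteq> j" "1 \<le> j" "j \<le> 2 * n" "\<pi> ! (j - 1) = 1"
        using matched_link matched_letters[OF w(3)] length_w[OF w(3)] by (auto simp: matched_def)
      then have "external_end j \<in> B" unfolding B_def by blast
      then show ?thesis using linkE[OF j(1,2)] s(2) bot(1) by blast
    next
      case lft
      obtain p where p: "epath E p" "hd p = s" "p ! 1 = a" "end_of E (last p)"
        using D.maximal_path[OF s(2) ends] s(1) by blast
      have fp: "full_path G p" using full[OF p(1)] ends s(1) p by simp
      have "s \<in> left_vertices n" using lft left_vertices_iff by auto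
      then have "last p \<in> right_vertices n" using lr[OF fp] p(2) by simp
      then obtain i where i: "i \<in> {1..2 * n}" "last p = right_vertex n i" unfolding right_vertices_def by blast
      define y' where "y' = 2 * n - i"
      have y': "y' < 2 * n" "last p = (int (4 * n - 2 - y'), int y')"
        using i right_vertex_nat[of i n] by (auto simp: y'_def)
      have "y' < 2 * n - 1 \<and> \<tau> ! (2 * n - 1 - y') = 0"
        using right_end[OF y'(1)] p(4) D.symE[OF D.path_last[OF p(1)]] unfolding y'(2) by blast
      then have "last p \<in> B" unfolding B_def y'(2) by blast
      then show ?thesis using chain[OF p(1)] unfolding p(2,3) by blast
    qed
  qed
  have BA: "\<exists>s\<in>A. \<exists>c. ((t, a), (c, s)) \<in> (dart_step E)\<^sup>*" if t: "t \<in> B" "(t, a) \<in> E" for t a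
  proof -
    from t(1) consider (bot) j where "t = external_end j" "1 \<le> j" "j \<le> 2 * n" "\<pi> ! (j - 1) = 1"
      | (rgt) y where "t = (int (4 * n - 2 - y), int y)" "y < 2 * n - 1" "\<tau> ! (2 * n - 1 - y) = 0"
      unfolding B_def by blast
    then show ?thesis
    proof cases
      case bot
      then obtain i where "matched \<pi> i j"
        using matched_exists[OF w(3), of j] matched_letters(1)[OF w(3), of j] by auto
      then have i: "{j, i} \<in> link_pattern n \<pi>" "j \<noteq> i" "1 \<le> i" "i \<le> 2 * n" "\<pi> ! (i - 1) = 0"
        using matched_link matched_letters[OF w(3)] length_w[OF w(3)] by (auto simp: matched_def)
      then have "external_end i \<in> A" unfolding A_def by blast
      then show ?thesis using linkE[OF i(1,2)] t(2) bot(1) by blast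
    next
      case rgt
      obtain p where p: "epath E p" "hd p = t" "p ! 1 = a" "end_of E (last p)"
        using D.maximal_path[OF t(2) ends] t(1) by blast
      have fp: "full_path G p" using full[OF p(1)] ends t(1) p by simp
      have "y < 2 * n \<and> (4 * n - 2 - y) + y + 2 = 4 * n" using rgt by auto
      then have "t \<in> right_vertices n" unfolding rgt(1) right_vertices_iff .
      then have "last p \<in> left_vertices n" using rl[OF fp] p(2) by simp
      then obtain i where i: "i \<in> {1..2 * n}" "last p = left_vertex i" unfolding left_vertices_def by blast
      define y' where "y' = i - 1"
      have y': "y' < 2 * n" "last p = (int y', int y')"
        using i left_vertex_nat[of i] by (auto simp: y'_def)
      have "y' < 2 * n - 1 \<and> \<sigma> ! y' = 1"
        using left_end[OF y'(1)] p(4) D.symE[OF D.path_last[OF p(1)]] unfolding y'(2) by blast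
      then have "last p \<in> A" unfolding A_def y'(2) by blast
      then show ?thesis using chain[OF p(1)] unfolding p(2,3) by blast
    qed
  qed
  obtain R where R: "R \<subseteq> E" "\<And>u z. (u, z) \<in> E \<Longrightarrow> (u, z) \<in> R \<longleftrightarrow> (z, u) \<notin> R"
    "\<And>d d'. (d, d') \<in> dart_step E \<Longrightarrow> d \<in> R \<longleftrightarrow> d' \<in> R"
    "\<And>s a. s \<in> A \<Longrightarrow> (s, a) \<in> E \<Longrightarrow> (s, a) \<in> R"
    "\<And>t c. t \<in> B \<Longrightarrow> (t, c) \<in> E \<Longrightarrow> (c, t) \<in> R"
  proof (rule D.orientation_exists[of A B])
    show "end_of E s" if "s \<in> A \<union> B" for s using that by (rule ends)
    show "A \<inter> B = {}" by (rule disj)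
    show "\<exists>t\<in>B. \<exists>c. ((s, a), (c, t)) \<in> (dart_step E)\<^sup>*" if "s \<in> A" "(s, a) \<in> E" for s a
      using that by (rule AB)
    show "\<exists>s\<in>A. \<exists>c. ((t, a), (c, s)) \<in> (dart_step E)\<^sup>*" if "t \<in> B" "(t, a) \<in> E" for t a
      using that by (rule BA)
  qed (rule that)
  define dart :: "point \<Rightarrow> point \<Rightarrow> int" where
    "dart u z = (if (u, z) \<in> R then 1 else if (z, u) \<in> R then -1 else 0)" for u z
  have dart_abs: "\<bar>dart u z\<bar> = of_bool ((u, z) \<in> E)" "dart u z \<in> {-1, 0, 1}" "dart u z \<noteq> 0 \<longleftrightarrow> (u, z) \<in> E"
    "dart z u = - dart u z" for u z
    using R(1) R(2)[of u z] R(2)[of z u] D.symE[of u z] D.symE[of z u] by (auto simp: dart_def)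
  have dart_step: "dart u p = dart p z" if "(u, p) \<in> E" "(p, z) \<in> E" "u \<noteq> z" for u p z
  proof -
    have "(u, p) \<in> R \<longleftrightarrow> (p, z) \<in> R" using R(3) that unfolding dart_step_def by blast
    then show ?thesis using R(2)[OF that(1)] R(2)[OF that(2)] R(1) by (auto simp: dart_def)
  qed
  define v where "v x y = dart (int x, int y - 1) (int x, int y)" for x y :: nat
  define h where "h x y = (if tri n x y \<and> y < x then dart (int x - 1, int y) (int x, int y)
     else if x = y then of_bool (\<sigma> ! y = 1) else of_bool (\<tau> ! (2 * n - 1 - y) = 0))" for x y :: nat
  have fl: "flow n \<sigma> \<tau> \<pi> v h"
    unfolding flow_def
  proof (intro conjI allI impI)
    fix x y assume t: "tri n x y"
    let ?p = "(int x, int y)"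
    let ?s = "dart (int x, int y - 1) ?p" and ?n = "dart ?p (int x, int y + 1)"
      and ?l = "dart (int x - 1, int y) ?p" and ?r = "dart ?p (int x + 1, int y)"
    have val: "v x y = ?s" "v x (Suc y) = ?n" "h x y = (if y < x then ?l else of_bool (\<sigma> ! y = 1))"
      "h (Suc x) y = (if tri n (Suc x) y then ?r else of_bool (\<tau> ! (2 * n - 1 - y) = 0))"
      using t by (auto simp: v_def h_def tri_def add.commute)
    have nz: "?s \<noteq> 0 \<longleftrightarrow> ?S x y \<in> E" "?n \<noteq> 0 \<longleftrightarrow> ?N x y \<in> E" "?l \<noteq> 0 \<longleftrightarrow> ?W x y \<in> E" "?r \<noteq> 0 \<longleftrightarrow> ?E x y \<in> E"
      using dart_abs(3) D.symE by blast+
    have ab: "\<bar>?s\<bar> = of_bool (?S x y \<in> E)" "\<bar>?n\<bar> = of_bool (?N x y \<in> E)" "\<bar>?l\<bar> = of_bool (?W x y \<in> E)"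
      "\<bar>?r\<bar> = of_bool (?E x y \<in> E)"
      unfolding dart_abs(1) using D.symE by (auto intro!: arg_cong[of _ _ of_bool])
    have rng: "?s \<in> {-1, 0, 1}" "?n \<in> {-1, 0, 1}" "?l \<in> {-1, 0, 1}" "?r \<in> {-1, 0, 1}"
      by (rule dart_abs(2))+
    have sn: "?s = ?n" if "?s \<noteq> 0" "?n \<noteq> 0"
      using dart_step[of "(int x, int y - 1)" ?p "(int x, int y + 1)"] that dart_abs(3) by auto
    have sl: "?s = - ?l" if "?s \<noteq> 0" "?l \<noteq> 0"
      using dart_step[of "(int x, int y - 1)" ?p "(int x - 1, int y)"] that dart_abs(3) dart_abs(4)[of ?p "(int x - 1, int y)"]
        D.symE by auto
    have sr: "?s = ?r" if "?s \<noteq> 0" "?r \<noteq> 0"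
      using dart_step[of "(int x, int y - 1)" ?p "(int x + 1, int y)"] that dart_abs(3) by auto
    have nl: "?n = ?l" if "?n \<noteq> 0" "?l \<noteq> 0"
      using dart_step[of "(int x - 1, int y)" ?p "(int x, int y + 1)"] that dart_abs(3) by auto
    have nr: "?n = - ?r" if "?n \<noteq> 0" "?r \<noteq> 0"
      using dart_step[of "(int x, int y + 1)" ?p "(int x + 1, int y)"] that dart_abs(3) dart_abs(4)[of "(int x, int y + 1)" ?p]
        D.symE by auto
    have lr': "?l = ?r" if "?l \<noteq> 0" "?r \<noteq> 0"
      using dart_step[of "(int x - 1, int y)" ?p "(int x + 1, int y)"] that dart_abs(3) by auto
    (* on the boundary one or two of the four edges are ghost edges *)
    consider (inn) "y < x" "tri n (Suc x) y" | (lft) "\<not> y < x" "tri n (Suc x) y"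
      | (rgt) "y < x" "\<not> tri n (Suc x) y" | (apex) "\<not> y < x" "\<not> tri n (Suc x) y" by blast
    then show "vertex_ok (v x y) (v x (Suc y)) (h x y) (h (Suc x) y)"
    proof cases
      case inn
      then have "?p \<in> inner_vertices n" using t inner_vertices_iff by blast
      then have "card (E `` {?p}) = 2" using inner vertex_degree_card[OF GT] by (simp add: E_def)
      then have "int (of_bool (?S x y \<in> E) + of_bool (?N x y \<in> E) + of_bool (?W x y \<in> E)
          + of_bool (?E x y \<in> E)) = 2"
        unfolding deg by simp
      then have "\<bar>?s\<bar> + \<bar>?n\<bar> + \<bar>?l\<bar> + \<bar>?r\<bar> = 2" unfolding ab by (simp only: of_nat_add of_nat_of_bool)
      then show ?thesis unfolding val using inn rng sn sl sr nl nr lr' by (simp only: if_True) (rule vertex_okI)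
    next
      case lft
      then have xy: "x = y" "y < 2 * n" "y < 2 * n - 1" using t by (auto simp: tri_def)
      have "\<not> tri n x (Suc y)" using xy by (simp add: tri_def)
      then have n0: "?n = 0" using nz(2) noN by blast
      have r1: "?r \<noteq> 0" using nz(4) E_left[OF xy(3)] xy(1) by simp
      show ?thesis
      proof (cases "\<sigma> ! y = 0")
        case True
        then have "?s \<noteq> 0" using nz(1) S_left[OF xy(2)] xy(1) by simp
        then show ?thesis unfolding val using lft True n0 r1 sr rng by (auto simp: vertex_ok_def)
      next
        case False
        then have s1: "\<sigma> ! y = 1" using balanced_letter[OF b(1) xy(2)] by simp
        have s0: "?s = 0" using nz(1) S_left[OF xy(2)] xy(1) False by blast
        have "?p \<in> A" unfolding A_def using xy s1 by blast
        then have "?r = 1" using R(4) E_left[OF xy(3)] xy(1) by (simp add: dart_def)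
        then show ?thesis unfolding val using lft s1 n0 s0 by (simp add: vertex_ok_def)
      qed
    next
      case rgt
      have xy: "y < 2 * n" "x = 4 * n - 2 - y" "\<not> tri n x (Suc y)" using bnd[OF t rgt(2)] .
      have y1: "y < 2 * n - 1" using xy rgt by auto
      have n0: "?n = 0" using nz(2) noN[OF xy(3)] by blast
      have l1: "?l \<noteq> 0" using nz(3) W_right[OF y1] unfolding xy(2)[symmetric] by blast
      show ?thesis
      proof (cases "\<tau> ! (2 * n - 1 - y) = 1")
        case True
        then have "?s \<noteq> 0" using nz(1) S_right[OF xy(1)] unfolding xy(2)[symmetric] by blast
        then show ?thesis unfolding val using rgt True n0 l1 sl rng by (auto simp: vertex_ok_def)
      next
        case False
        then have t0: "\<tau> ! (2 * n - 1 - y) = 0" using balanced_letter[OF b(2), of "2 * n - 1 - y"] xy(1) by auto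
        have s0: "?s = 0" using nz(1) S_right[OF xy(1)] False unfolding xy(2)[symmetric] by blast
        have "?p \<in> B" unfolding B_def using xy y1 t0 by blast
        then have "((int x - 1, int y), ?p) \<in> R" using R(5) l1 nz(3) by blast
        then have "?l = 1" by (simp add: dart_def)
        then show ?thesis unfolding val using rgt t0 n0 s0 by (simp add: vertex_ok_def)
      qed
    next
      case apex
      have xy: "y < 2 * n" "x = 4 * n - 2 - y" "\<not> tri n x (Suc y)" using bnd[OF t apex(2)] .
      have y: "y = 2 * n - 1" "x = y" using xy apex t by (auto simp: tri_def)
      have l: "\<sigma> ! y = 1" "\<tau> ! (2 * n - 1 - y) = 0"
        using dyck_first_last(2)[OF w(1) n] dyck_first_last(1)[OF w(2) n] y by simp_all
      have "?n = 0" using nz(2) noN[OF xy(3)] by blast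
      moreover have "?s = 0" using nz(1) S_left[OF xy(1)] y(2) l(1) by simp
      ultimately show ?thesis unfolding val using apex l by (simp add: vertex_ok_def)
    qed
  next
    fix x y assume "\<not> tri n x y"
    then have "(int x, int y - 1) \<noteq> (int x, int y) \<and> {(int x, int y - 1), (int x, int y)} \<notin> G"
      using tv[of "int x" "int y"] by auto
    then have "((int x, int y - 1), (int x, int y)) \<notin> E" by (simp add: E_def edge_rel_def)
    then show "v x y = 0" using dart_abs(3) unfolding v_def by blast
  next
    fix x assume t: "tri n x 0"
    show "v x 0 = (if odd x then 0 else if \<pi> ! (x div 2) = 0 then 1 else - 1)"
    proof (cases "odd x")
      case True
      then have "{(int x, int 0 - 1), (int x, int 0)} \<notin> G"
        using tv[of "int x" "int 0"] by auto
      then have "((int x, int 0 - 1), (int x, int 0)) \<notin> E" by (simp add: E_def edge_rel_def)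
      then show ?thesis using dart_abs(3) True unfolding v_def by auto
    next
      case False
      then obtain k where k: "x = 2 * k" by blast
      have kn: "k < 2 * n" using t k by (auto simp: tri_def)
      have e: "external_end (Suc k) = (int x, int 0 - 1)" using k by (simp add: external_end_def)
      have ed: "(external_end (Suc k), (int x, int 0)) \<in> E" using ext_edge[of "Suc k"] kn k by simp
      have p01: "\<pi> ! k = 0 \<or> \<pi> ! k = 1" using balanced_letter[OF b(3) kn] .
      show ?thesis
      proof (cases "\<pi> ! k = 0")
        case True
        then have "external_end (Suc k) \<in> A" using kn unfolding A_def by fastforce
        then have "(external_end (Suc k), (int x, int 0)) \<in> R" using R(4) ed by blast
        then show ?thesis using True k unfolding v_def e[symmetric] by (simp add: dart_def)
      next
        case nz: False
        then have "external_end (Suc k) \<in> B" using kn p01 unfolding B_def by fastforce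
        then have "((int x, int 0), external_end (Suc k)) \<in> R" using R(5) ed by blast
        moreover from this have "(external_end (Suc k), (int x, int 0)) \<notin> R" using R(2)[OF ed] by blast
        ultimately show ?thesis using nz k unfolding v_def e[symmetric] by (simp add: dart_def)
      qed
    qed
  next
    fix y assume "y < 2 * n"
    then show "h y y = of_bool (\<sigma> ! y = 1)" "h (4 * n - 1 - y) y = of_bool (\<tau> ! (2 * n - 1 - y) = 0)"
      by (auto simp: h_def tri_def)
  qed
  moreover have "flow_graph n v h = G"
  proof -
    have V: "v x y \<noteq> 0 \<longleftrightarrow> vedge_below (int x, int y) \<in> G" for x y
      using dart_abs(3) D.symE eS[of x y] unfolding v_def by blast
    have H: "h x y \<noteq> 0 \<longleftrightarrow> hedge_right (int x - 1, int y) \<in> G" if "tri n x y" "y < x" for x y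
      using dart_abs(3) D.symE eW[of x y] that unfolding h_def by auto
    show ?thesis
    proof
      show "flow_graph n v h \<subseteq> G" unfolding flow_graph_def using V H by blast
      show "G \<subseteq> flow_graph n v h"
      proof
        fix e assume e: "e \<in> G"
        then have "e \<in> triangle_edges n" using GT by blast
        then consider x y where "e = vedge_below (int x, int y)" "tri n x y"
          | x y where "e = hedge_right (int x - 1, int y)" "tri n x y" "y < x"
          unfolding triangle_edges_eq flow_graph_def by blast
        then show "e \<in> flow_graph n v h"
          using e V H by cases (simp_all add: vedge_flow_graph hedge_flow_graph)
      qed
    qed
  qed
  ultimately show thesis by (rule that)
qed

section \<open>The bijection\<close>

theorem theorem11:
  fixes n :: nat and \<sigma> \<tau> \<pi> :: "nat list"
  assumes "n \<ge> 1"
    and "\<sigma> \<in> dyck_words n" and "\<tau> \<in> dyck_words n" and "\<pi> \<in> dyck_words n"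
    and "word_degree \<sigma> + word_degree \<tau> = word_degree \<pi>"
  shows "bij_betw (Phi n) (KT n \<sigma> \<tau> \<pi>) (TFPL n \<sigma> \<tau> \<pi>)"
proof -
  have b: "balanced n \<sigma>" "balanced n \<tau>" "balanced n \<pi>" using assms(2-4) by (auto intro: dyck_balanced)
  have "Phi n P \<in> TFPL n \<sigma> \<tau> \<pi>" if P: "P \<in> KT n \<sigma> \<tau> \<pi>" for P
  proof -
    note F = puzzle_to_flow[OF P b]
    have "puzzle_vert n P x y = 0" if "odd (x + y)" for x y using that by (simp add: puzzle_vert_def)
    from flow_graph_TFPL[OF F(2) F(3) this assms] show ?thesis unfolding Phi_encodes[OF F(1)] .
  qed
  moreover have "G \<in> Phi n ` KT n \<sigma> \<tau> \<pi>" if G: "G \<in> TFPL n \<sigma> \<tau> \<pi>" for G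
  proof -
    obtain v h where fl: "flow n \<sigma> \<tau> \<pi> v h" and Gv: "flow_graph n v h = G"
      using TFPL_flow[OF assms(1-4) G] by blast
    have nn: "0 \<le> vertex_excess v h x y" for x y by (simp add: vertex_excess_def excess_nonneg)
    define row where "row j = (\<Sum>x=j..<4 * n - 1 - j. vertex_excess v h x j)" for j
    have rn: "0 \<le> row j" for j unfolding row_def by (intro sum_nonneg nn)
    have "int (word_degree \<pi>) = int (word_degree \<sigma>) + int (word_degree \<tau>)"
      using assms(5) by (metis of_nat_add)
    then have "(\<Sum>j<2 * n. row j) = 0"
      using excess_identity[OF assms(1) fl b] unfolding row_def by presburger
    then have r0: "row j = 0" if "j < 2 * n" for j
      using sum_nonneg_eq_0_iff[of "{..<2 * n}" row] rn that by simp
    have "vertex_excess v h x y = 0" if t: "tri n x y" for x y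
    proof -
      have "y < 2 * n" "x \<in> {y..<4 * n - 1 - y}" using t by (auto simp: tri_def)
      then show ?thesis
        using r0[of y] sum_nonneg_eq_0_iff[of "{y..<4 * n - 1 - y}" "\<lambda>x. vertex_excess v h x y"] nn
        by (simp add: row_def)
    qed
    from flow_to_puzzle[OF fl this b] show ?thesis using Gv by (metis imageI)
  qed
  ultimately have "Phi n ` KT n \<sigma> \<tau> \<pi> = TFPL n \<sigma> \<tau> \<pi>" by blast
  then show ?thesis using Phi_inj[OF b] by (simp add: bij_betw_def)
qed

end
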